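(* Let $d\ge 1$. There exist constants $C_1>0$ and $C_2>0$ depending only on $d$ such that the following holds. Let $T>0$ and let $b:[0,T]\times\mathbb{T}^d\to\mathbb{R}^d$ be a vector field whose spatial distributional derivative satisfies $$\sup_{t\in[0,T]}\int_{\mathbb{T}^d}\exp\{\beta|\nabla b(t,x)|\}\,dx=K<\infty\quad\text{for some }\beta>0,\qquad \|\operatorname{div} b\|_{L^\infty([0,T]\times\mathbb{T}^d)}=L<\infty,$$ and let $X_t$ be the flow of $b$. Then for every $t\in[0,T]$ there is a nonnegative function $g_t$ on $\mathbb{T}^d$ such that for all $x,y\in\mathbb{T}^d$ $$\mathsf{d}(X_t(x),X_t(y))\le g_t(x)\,\mathsf{d}(x,y)\qquad\text{and}\qquad \mathsf{d}((X_t)^{-1}(x),(X_t)^{-1}(y))\le g_t(x)\,\mathsf{d}(x,y),$$ and $$\|g_t\|_{L^{q_t}}\le e^{\frac{t^2LC_1}{\beta}}(C_2K)^{\frac{tC_1}{\beta}}\qquad\forall t\in[0,T],\quad\text{with } q_t:=\frac{\beta}{C_1t}.$$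
   Context: $\mathbb{T}^d=\mathbb{R}^d/\mathbb{Z}^d$ is the flat torus with its Haar (Lebesgue) measure and its geodesic distance $\mathsf{d}$. Derivatives $\nabla b$ and $\operatorname{div}b$ are spatial and distributional; each $b_t=b(t,\cdot)$ is identified with its continuous representative, which exists whenever $\sup_{t\in[0,T]}\int_{\mathbb{T}^d}\exp\{\beta|\nabla b(t,x)|\}\,dx<\infty$ for some $\beta>0$. The flow $X:[0,T]\times\mathbb{T}^d\to\mathbb{T}^d$ of $b$ is the solution of $\frac{d}{dt}X(t,x)=b(t,X(t,x))$, $X(0,x)=x$, with $X_t=X(t,\cdot)$; it is known that if $\sup_{t\in[0,T]}\int_{\mathbb{T}^d}\exp\{\beta|\nabla b(t,x)|\}\,dx<\infty$ for some $\beta>0$ and $\operatorname{div}b\in L^\infty([0,T]\times\mathbb{T}^d)$, then the flow exists, is unique, and each $X_t$ is invertible. For $0<q<\infty$, $\|g\|_{L^q}=(\int_{\mathbb{T}^d}|g|^q\,dx)^{1/q}$ (also when $q<1$), and $q_0=\infty$.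
   Formalization: The nonnegative function g_t may take the value +∞ (on a null set for the given norm bound, with ∞·0=0 when x=y); a finite-valued g_t at every x does not exist in general, as the flow can fail to be Lipschitz at a point. *)

theory Defs
  imports "HOL-Analysis.Analysis" "HOL-Probability.Essential_Supremum"
begin

section \<open>The flat torus\<close>

definition int_lattice :: "(real ^ 'n) set" where
  "int_lattice = {k. \<forall>i. k $ i \<in> \<int>}"

quotient_type 'n torus = "real ^ 'n" / "\<lambda>x y. x - y \<in> (int_lattice :: (real ^ 'n) set)"
  morphisms torus_rep torus_proj
proof (rule equivpI)
  show "reflp (\<lambda>x y. x - y \<in> (int_lattice :: (real ^ 'n) set))"
    by (auto intro!: reflpI simp: int_lattice_def)
  show "symp (\<lambda>x y. x - y \<in> (int_lattice :: (real ^ 'n) set))"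
  proof (rule sympI)
    fix x y :: "real ^ 'n" assume "x - y \<in> int_lattice"
    then have "- (x $ i - y $ i) \<in> \<int>" for i
      by (intro Ints_minus) (simp add: int_lattice_def)
    then show "y - x \<in> int_lattice" unfolding int_lattice_def minus_diff_eq by simp
  qed
  show "transp (\<lambda>x y. x - y \<in> (int_lattice :: (real ^ 'n) set))"
  proof (rule transpI)
    fix x y z :: "real ^ 'n"
    assume "x - y \<in> int_lattice" "y - z \<in> int_lattice"
    then have "(x $ i - y $ i) + (y $ i - z $ i) \<in> \<int>" for i
      by (intro Ints_add) (simp_all add: int_lattice_def)
    then show "x - z \<in> int_lattice" by (simp add: int_lattice_def)
  qed
qed

abbreviation torus_fibre :: "'n torus \<Rightarrow> (real ^ 'n) set" where
  "torus_fibre p \<equiv> torus_proj -` {p}"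

lemma torus_proj_eq_iff: "torus_proj x = torus_proj y \<longleftrightarrow> x - y \<in> int_lattice"
  by (rule torus.abs_eq_iff)

lemma torus_proj_rep [simp]: "torus_proj (torus_rep p) = p"
  by (rule Quotient_abs_rep[OF Quotient_torus])

lemma closed_int_lattice: "closed (int_lattice :: (real ^ 'n) set)"
proof -
  have "closed (\<Inter>i. (\<lambda>x :: real ^ 'n. x $ i) -` \<int>)"
    by (intro closed_INT ballI closed_vimage closed_Ints continuous_intros)
  also have "(\<Inter>i. (\<lambda>x. x $ i) -` \<int>) = (int_lattice :: (real ^ 'n) set)"
    by (auto simp: int_lattice_def)
  finally show ?thesis .
qed

lemma closed_torus_fibre: "closed (torus_fibre p)"
proof -
  have "torus_fibre p = (\<lambda>x. x - torus_rep p) -` int_lattice"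
    using torus_proj_eq_iff[of _ "torus_rep p"] by auto
  then show ?thesis
    by (auto intro!: closed_vimage closed_int_lattice continuous_intros)
qed

text \<open>On \<open>\<real>\<^sup>n / \<int>\<^sup>n\<close> the geodesic distance is the Euclidean distance between the
  two fibres, i.e. the minimum of \<open>|u - v - k|\<close> over \<open>k \<in> \<int>\<^sup>n\<close>.\<close>

instantiation torus :: (finite) metric_space
begin

definition dist_torus :: "'a torus \<Rightarrow> 'a torus \<Rightarrow> real" where
  "dist_torus p q = setdist (torus_fibre p) (torus_fibre q)"

definition uniformity_torus :: "('a torus \<times> 'a torus) filter" where
  "uniformity_torus = (INF e\<in>{0 <..}. principal {(p, q). dist p q < e})"

definition open_torus :: "'a torus set \<Rightarrow> bool" where
  "open_torus U \<longleftrightarrow> (\<forall>p\<in>U. eventually (\<lambda>(p', q). p' = p \<longrightarrow> q \<in> U) uniformity)"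

lemma dist_torus_infdist:
  "dist (torus_proj u) q = infdist u (torus_fibre q :: (real ^ 'a) set)"
proof (rule antisym)
  have "setdist (torus_fibre (torus_proj u)) (torus_fibre q) \<le> setdist {u} (torus_fibre q)"
    by (rule setdist_subset_left) auto
  then show "dist (torus_proj u) q \<le> infdist u (torus_fibre q)"
    by (simp add: dist_torus_def infdist_eq_setdist)
next
  have ne: "torus_fibre (torus_proj u) \<noteq> {}" "torus_fibre q \<noteq> {}"
    using torus_proj_rep[of q] by blast+
  have "infdist u (torus_fibre q) \<le> dist a b"
    if ab: "a \<in> torus_fibre (torus_proj u)" "b \<in> torus_fibre q" for a b
  proof -
    have "u - a \<in> int_lattice"
      using ab(1) torus_proj_eq_iff[of u a] by simp
    then have "torus_proj (b + (u - a)) = torus_proj b"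
      by (simp add: torus_proj_eq_iff)
    then have "infdist u (torus_fibre q) \<le> dist u (b + (u - a))"
      using ab(2) by (intro infdist_le) auto
    also have "dist u (b + (u - a)) = dist a b"
      by (simp add: dist_norm)
    finally show ?thesis .
  qed
  then show "infdist u (torus_fibre q) \<le> dist (torus_proj u) q"
    using ne by (auto simp: dist_torus_def le_setdist_iff)
qed

instance
proof
  fix p q r :: "'a torus"
  have ne: "torus_fibre s \<noteq> {}" for s :: "'a torus"
    using torus_proj_rep[of s] by blast
  show "(dist p q = 0) = (p = q)"
    using dist_torus_infdist[of "torus_rep p" q]
      in_closed_iff_infdist_zero[OF closed_torus_fibre ne, of "torus_rep p" q] by auto
  have sym: "dist s t = dist t s" for s t :: "'a torus"
    by (simp add: dist_torus_def setdist_sym)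
  have "dist p q - dist r q \<le> dist (torus_rep p) v" if "v \<in> torus_fibre r" for v
    using infdist_triangle[of "torus_rep p" "torus_fibre q" v] that
      dist_torus_infdist[of "torus_rep p" q] dist_torus_infdist[of v q] by simp
  then have "dist p q - dist r q \<le> infdist (torus_rep p) (torus_fibre r)"
    unfolding infdist_notempty[OF ne] by (rule cINF_greatest[OF ne])
  then show "dist p q \<le> dist p r + dist q r"
    using dist_torus_infdist[of "torus_rep p" r] sym[of r q] by simp
qed (simp_all add: uniformity_torus_def open_torus_def)

end

lemma dist_torus_proj_le: "dist (torus_proj u) (torus_proj v) \<le> dist u v"
  by (simp add: dist_torus_infdist infdist_le)

lemma continuous_on_torus_proj: "continuous_on S torus_proj"
  unfolding continuous_on_iff using dist_torus_proj_le by (metis le_less_trans)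

text \<open>The normalised Haar measure: the image of Lebesgue measure on the fundamental
  domain \<open>[0,1)\<^sup>n\<close>.\<close>

definition torus_measure :: "'n::finite torus measure" where
  "torus_measure =
     distr (restrict_space lborel {x :: real ^ 'n. \<forall>i. 0 \<le> x $ i \<and> x $ i < 1}) borel torus_proj"


section \<open>Weak derivatives on the torus\<close>

definition partial :: "'n \<Rightarrow> (real ^ 'n \<Rightarrow> real) \<Rightarrow> real ^ 'n \<Rightarrow> real" where
  "partial j f x = frechet_derivative f (at x) (axis j 1)"

primrec C_k :: "nat \<Rightarrow> (real ^ 'n \<Rightarrow> real) \<Rightarrow> bool" where
  "C_k 0 f \<longleftrightarrow> continuous_on UNIV f"
| "C_k (Suc k) f \<longleftrightarrow> f differentiable_on UNIV \<and> (\<forall>j. C_k k (partial j f))"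

definition torus_smooth :: "('n::finite torus \<Rightarrow> real) \<Rightarrow> bool" where
  "torus_smooth \<phi> \<longleftrightarrow> (\<forall>k. C_k k (\<phi> \<circ> torus_proj))"

definition torus_partial :: "'n::finite \<Rightarrow> ('n torus \<Rightarrow> real) \<Rightarrow> 'n torus \<Rightarrow> real" where
  "torus_partial j \<phi> p = partial j (\<phi> \<circ> torus_proj) (torus_rep p)"

text \<open>\<open>G\<close> is the distributional Jacobian of \<open>v\<close>; the entry \<open>G p $ i $ j\<close> is
  \<open>\<partial>\<^sub>j v\<^sub>i\<close>, so the distributional divergence of \<open>v\<close> is \<open>trace (G p)\<close> and
  \<open>norm (G p)\<close> is the Euclidean (Frobenius) norm.\<close>

definition weak_gradient :: "('n torus \<Rightarrow> real ^ 'n) \<Rightarrow> ('n torus \<Rightarrow> real ^ 'n ^ 'n) \<Rightarrow> bool" where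
  "weak_gradient v G \<longleftrightarrow>
     integrable torus_measure v \<and> integrable torus_measure G \<and>
     (\<forall>\<phi> i j. torus_smooth \<phi> \<longrightarrow>
        (\<integral>p. v p $ i * torus_partial j \<phi> p \<partial>torus_measure) =
        - (\<integral>p. G p $ i $ j * \<phi> p \<partial>torus_measure))"

definition space_time :: "real \<Rightarrow> (real \<times> 'n::finite torus) measure" where
  "space_time T = lebesgue_on {0..T} \<Otimes>\<^sub>M torus_measure"


section \<open>Norms\<close>

text \<open>Functions are \<open>[0,\<infinity>]\<close>-valued: the pointwise Lipschitz constant of the flow can be
  infinite on a null set. The exponent \<open>q\<close> ranges over \<open>(0,\<infinity>]\<close>.\<close>

definition ennreal_powr :: "ennreal \<Rightarrow> real \<Rightarrow> ennreal" where
  "ennreal_powr a q = (if a = \<infinity> then \<infinity> else ennreal (enn2real a powr q))"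

definition Lq_norm :: "'a measure \<Rightarrow> ereal \<Rightarrow> ('a \<Rightarrow> ennreal) \<Rightarrow> ennreal" where
  "Lq_norm M q g =
     (if q = \<infinity> then esssup M g
      else ennreal_powr (\<integral>\<^sup>+ x. ennreal_powr (g x) (real_of_ereal q) \<partial>M) (1 / real_of_ereal q))"


section \<open>Flows\<close>

text \<open>A vector field is only measurable in time, so \<open>dX/dt = b(t,X)\<close> is understood in the
  sense of Caratheodory: each trajectory is absolutely continuous and satisfies the equation
  for almost every \<open>t\<close>, that is, it solves the integral equation. The curve \<open>\<gamma>\<close> is a lift
  of the trajectory to the universal cover.\<close>

definition is_flow ::
    "real \<Rightarrow> (real \<Rightarrow> 'n torus \<Rightarrow> real ^ 'n) \<Rightarrow> (real \<Rightarrow> 'n torus \<Rightarrow> 'n torus) \<Rightarrow> bool" where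
  "is_flow T b X \<longleftrightarrow>
     (\<forall>x. X 0 x = x \<and>
        (\<lambda>s. b s (X s x)) absolutely_integrable_on {0..T} \<and>
        (\<exists>\<gamma> :: real \<Rightarrow> real ^ 'n. \<forall>t\<in>{0..T}.
           torus_proj (\<gamma> t) = X t x \<and>
           \<gamma> t = \<gamma> 0 + integral {0..t} (\<lambda>s. b s (X s x))))"

end

theory Submission
  imports Defs "HOL-Probability.Giry_Monad"
begin

text \<open>Why the theorem holds. Write \<beta> for the exponent and n for the dimension. For a field v on
  the torus with exp(\<beta>|\<nabla>v|) integrable, Morrey's inequality (lemma Morrey) bounds
  |v x - v y| by |x - y| / \<beta> times a dimensional constant plus the logarithm of the mean of
  exp(\<beta>|\<nabla>v|) over the ball about x of radius |x - y|. Hence the best Lipschitz constant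
  lip_at v x of v at the point x satisfies exp(\<beta>/4 lip_at v x) \<le> C M(x), where M is the maximal
  function of an integrable function. The weak type (1,1) estimate for M then makes
  exp(\<beta>/8 lip_at v) integrable, with integral at most C K (exp_lip_at_integral).

  Let h_s be this pointwise Lipschitz constant of b_s. Along the flow, |X_t x - X_t y| is at most
  exp(\<integral> h_s(X_s x) ds) |x - y|, and backwards in time a similar bound holds for the inverse.
  For q = \<beta> / (16 t), Jensen's inequality in time bounds the integral over x of
  exp(2 q \<integral> h_s(X_s x) ds) by a mean over s in [0,t] of the integrals of exp(\<beta>/8 h_s(X_s x)).
  Since |div b| \<le> L, composing a nonnegative function with X_s increases its integral by a factor
  at most exp(s L), so the mean is at most exp(t L) C K. Taking the power 1/q gives the
  asserted bound; C1 = 16 is the product of the 8 above and of the factor 2 in the exponent, which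
  pays for inverting the discrete steps below.

  The field b is only log-Lipschitz in space and measurable in time, so X_t has no Jacobian to work
  with. Both estimates are therefore proved for Euler schemes: on each of many short
  time intervals b is averaged over the interval and mollified by a trigonometric kernel (locale
  averaged_field); this preserves the bound L, and by Jensen's inequality the bound K. One step
  x + \<delta> v(x) is then a diffeomorphism with Jacobian 1 + \<delta> div v + O(\<delta>^2)
  (step_map), and the estimates for the composition of the steps are finite sums (locale
  euler_scheme). The schemes converge to the flow uniformly, in both time directions, by a
  discrete Osgood inequality (discrete_Osgood, approximation). This also shows that X_t is
  invertible. Finally g_t is the lower limit of the Lipschitz constants of the schemes, and Fatou's
  lemma carries the integral bound over (flow_regularity).

  All analysis takes place on \<real>^n with functions and maps that respect the lattice \<int>^n.\<close>


section \<open>Periodic functions and fundamental domains\<close>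

definition cube :: "(real ^ 'n) set" where
  "cube = {x. \<forall>i. 0 \<le> x $ i \<and> x $ i < 1}"

definition periodic :: "(real ^ 'n \<Rightarrow> 'b) \<Rightarrow> bool" where
  "periodic f \<longleftrightarrow> (\<forall>x. \<forall>k\<in>int_lattice. f (x + k) = f x)"

lemma periodicD: "periodic f \<Longrightarrow> k \<in> int_lattice \<Longrightarrow> f (x + k) = f x"
  by (auto simp: periodic_def)

lemma int_lattice_add: "k \<in> int_lattice \<Longrightarrow> l \<in> int_lattice \<Longrightarrow> k + l \<in> int_lattice"
  and int_lattice_diff: "k \<in> int_lattice \<Longrightarrow> l \<in> int_lattice \<Longrightarrow> k - l \<in> int_lattice"
  and int_lattice_minus: "k \<in> int_lattice \<Longrightarrow> - k \<in> int_lattice"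
  and int_lattice_zero: "0 \<in> int_lattice"
  by (auto simp: int_lattice_def)

lemma torus_proj_add: "k \<in> int_lattice \<Longrightarrow> torus_proj (x + k) = torus_proj x"
  by (simp add: torus_proj_eq_iff)

lemma periodic_diff: "periodic f \<Longrightarrow> k \<in> int_lattice \<Longrightarrow> f (x - k) = f x"
  using periodicD[of f "-k" x] int_lattice_minus by auto

definition int_part :: "real ^ 'n \<Rightarrow> real ^ 'n" where
  "int_part x = (\<chi> i. of_int \<lfloor>x $ i\<rfloor>)"

lemma int_part_lattice: "int_part x \<in> int_lattice"
  by (simp add: int_part_def int_lattice_def)

lemma frac_cube: "x - int_part x \<in> cube"
  by (simp add: int_part_def cube_def) linarith

lemma cube_lattice_unique:
  assumes "k \<in> int_lattice" "x - k \<in> cube"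
  shows "k = int_part x"
proof -
  have "k $ i = of_int \<lfloor>x $ i\<rfloor>" for i
  proof -
    obtain m where m: "k $ i = of_int m" using assms(1) by (auto simp: int_lattice_def elim: Ints_cases)
    moreover have "0 \<le> x $ i - k $ i" "x $ i - k $ i < 1" using assms(2) by (auto simp: cube_def)
    ultimately have "\<lfloor>x $ i\<rfloor> = m" by (intro floor_unique) auto
    then show ?thesis using m by simp
  qed
  then show ?thesis by (simp add: int_part_def vec_eq_iff)
qed

lemma int_part_cube: "x \<in> cube \<Longrightarrow> int_part x = 0"
  using cube_lattice_unique[of 0 x] int_lattice_zero by simp

lemma norm_cube: "x \<in> cube \<Longrightarrow> norm (x :: real ^ 'n::finite) \<le> real CARD('n)"
proof -
  assume "x \<in> cube"
  then have "\<And>i. \<bar>x $ i\<bar> \<le> 1" by (auto simp: cube_def less_imp_le)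
  then have "(\<Sum>i\<in>UNIV. \<bar>x $ i\<bar>) \<le> (\<Sum>i\<in>(UNIV::'n set). 1)" by (intro sum_mono) auto
  then show ?thesis using norm_le_l1_cart[of x] by simp
qed

lemma cube_borel [measurable]: "(cube :: (real ^ 'n::finite) set) \<in> sets borel"
proof -
  have "cube = (\<Inter>i. (\<lambda>x :: real ^ 'n. x $ i) -` {0..<1})" by (auto simp: cube_def)
  also have "\<dots> \<in> sets borel"
    by (intro sets.countable_INT) (auto intro!: measurable_sets_borel[OF _ atLeastLessThan_borel] borel_measurable_continuous_onI continuous_intros)
  finally show ?thesis .
qed

lemma emeasure_cube: "emeasure lborel (cube :: (real ^ 'n::finite) set) = 1"
proof -
  let ?A = "box 0 (1::real ^ 'n)" and ?B = "cbox 0 (1::real^'n)"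
  have s: "?A \<subseteq> cube" "cube \<subseteq> ?B" by (auto simp: cube_def mem_box_cart less_imp_le)
  have p: "(\<Prod>b\<in>Basis. (1 :: real^'n) \<bullet> b) = 1"
    by (intro prod.neutral) (auto simp: Basis_vec_def inner_axis)
  have le: "\<And>b. b \<in> (Basis :: (real^'n) set) \<Longrightarrow> 0 \<bullet> b \<le> 1 \<bullet> b"
    by (auto simp: Basis_vec_def inner_axis)
  have "emeasure lborel ?A = 1" "emeasure lborel ?B = 1"
    using p le by (simp_all add: emeasure_lborel_box emeasure_lborel_cbox del: emeasure_lborel_box_eq emeasure_lborel_cbox_eq)
  moreover have "emeasure lborel ?A \<le> emeasure lborel (cube :: (real ^ 'n) set)"
    "emeasure lborel (cube :: (real ^ 'n) set) \<le> emeasure lborel ?B"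
    using s by (auto intro!: emeasure_mono)
  ultimately show ?thesis by (metis antisym)
qed

lemma countable_int_lattice: "countable (int_lattice :: (real ^ 'n::finite) set)"
proof -
  have "inj_on (\<lambda>k :: real^'n. (\<lambda>i. k $ i)) int_lattice" by (auto simp: inj_on_def vec_eq_iff fun_eq_iff)
  moreover have "(\<lambda>k :: real^'n. (\<lambda>i. k $ i)) ` int_lattice \<subseteq> (\<Pi>\<^sub>E i\<in>UNIV. \<int>)"
    by (auto simp: int_lattice_def)
  moreover have "countable (\<Pi>\<^sub>E i\<in>(UNIV::'n set). (\<int> :: real set))"
    by (intro countable_PiE) (auto simp: Ints_def)
  ultimately show ?thesis by (meson countable_image_inj_on countable_subset)
qed

lemma nn_integral_translate:
  fixes f :: "'a::euclidean_space \<Rightarrow> ennreal"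
  assumes [measurable]: "f \<in> borel_measurable borel"
  shows "(\<integral>\<^sup>+x. f (x + c) \<partial>lborel) = (\<integral>\<^sup>+x. f x \<partial>lborel)"
proof -
  have "(\<integral>\<^sup>+x. f x \<partial>lborel) = (\<integral>\<^sup>+x. f x \<partial>distr lborel borel ((+) c))"
    by (simp add: lborel_distr_plus)
  also have "\<dots> = (\<integral>\<^sup>+x. f (c + x) \<partial>lborel)" by (subst nn_integral_distr) auto
  finally show ?thesis by (simp add: add.commute)
qed

lemma nn_integral_one_point:
  assumes "k0 \<in> I" "\<And>k. k \<in> I \<Longrightarrow> k \<noteq> k0 \<Longrightarrow> f k = 0"
  shows "(\<integral>\<^sup>+k. f k \<partial>count_space I) = f k0"
proof -
  have "(\<integral>\<^sup>+k. f k \<partial>count_space I) = (\<integral>\<^sup>+k. f k0 * indicator {k0} k \<partial>count_space I)"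
    using assms by (intro nn_integral_cong) (auto simp: indicator_def)
  also have "\<dots> = f k0" using assms(1) by (simp add: nn_integral_cmult_indicator)
  finally show ?thesis .
qed

text \<open>Exact systems of representatives of \<real>^n modulo \<int>^n. Affine images of the cube, and its
  images under lifts of bijections of the torus, are again of this kind, so a periodic function has
  the same integral over all of them.\<close>

definition fundamental :: "(real ^ 'n) set \<Rightarrow> bool" where
  "fundamental A \<longleftrightarrow> (\<forall>x. \<exists>!k. k \<in> int_lattice \<and> x - k \<in> A)"

lemma fundamental_cube: "fundamental cube"
  unfolding fundamental_def
  using cube_lattice_unique int_part_lattice frac_cube by blast

lemma fundamental_sum:
  assumes "fundamental A"
  shows "(\<integral>\<^sup>+k. indicator A (x - k) \<partial>count_space int_lattice) = 1"
    and "(\<integral>\<^sup>+k. indicator A (x + k) \<partial>count_space int_lattice) = 1"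
proof -
  have "\<exists>!k. k \<in> int_lattice \<and> x - k \<in> A" using assms by (auto simp: fundamental_def)
  then obtain k0 where k0: "k0 \<in> int_lattice" "x - k0 \<in> A" "\<And>k. k \<in> int_lattice \<Longrightarrow> x - k \<in> A \<Longrightarrow> k = k0"
    by blast
  have "(\<integral>\<^sup>+k. indicator A (x - k) \<partial>count_space int_lattice) = indicator A (x - k0)"
  proof (rule nn_integral_one_point)
    fix k assume "k \<in> int_lattice" "k \<noteq> k0"
    then have "x - k \<notin> A" using k0(3) by blast
    then show "indicator A (x - k) = (0::ennreal)" by simp
  qed (rule k0)
  then show "(\<integral>\<^sup>+k. indicator A (x - k) \<partial>count_space int_lattice) = 1" using k0(2) by simp
  have "(\<integral>\<^sup>+k. indicator A (x + k) \<partial>count_space int_lattice) = indicator A (x + - k0)"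
  proof (rule nn_integral_one_point)
    show "- k0 \<in> int_lattice" using k0(1) by (rule int_lattice_minus)
    fix k assume k: "k \<in> int_lattice" "k \<noteq> - k0"
    have "x - (- k) \<notin> A" using k0(3)[of "-k"] k int_lattice_minus[of k] by auto
    then show "indicator A (x + k) = (0::ennreal)" by simp
  qed
  then show "(\<integral>\<^sup>+k. indicator A (x + k) \<partial>count_space int_lattice) = 1" using k0(2) by simp
qed

text \<open>Cut A along the translates of B and move every piece back into B: a point x of B is then
  covered once for every lattice vector k with x + k in A.\<close>

lemma nn_integral_tiling:
  fixes F :: "real ^ 'n::finite \<Rightarrow> ennreal"
  assumes [measurable]: "F \<in> borel_measurable borel" "A \<in> sets borel" "B \<in> sets borel"
    and per: "periodic F" and fund: "fundamental B"
  shows "(\<integral>\<^sup>+x\<in>A. F x \<partial>lborel) =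
    (\<integral>\<^sup>+x\<in>B. F x * (\<integral>\<^sup>+k. indicator A (x + k) \<partial>count_space int_lattice) \<partial>lborel)"
proof -
  have "(\<integral>\<^sup>+x\<in>A. F x \<partial>lborel) = 
     (\<integral>\<^sup>+x. (\<integral>\<^sup>+k. F x * indicator A x * indicator B (x - k) \<partial>count_space int_lattice) \<partial>lborel)"
    by (simp add: nn_integral_cmult fundamental_sum[OF fund])
  also have "\<dots> = (\<integral>\<^sup>+k. (\<integral>\<^sup>+x. F x * indicator A x * indicator B (x - k) \<partial>lborel) \<partial>count_space int_lattice)"
    by (intro nn_integral_count_space_nn_integral countable_int_lattice) measurable
  also have "\<dots> = (\<integral>\<^sup>+k. (\<integral>\<^sup>+x. F (x + k) * indicator A (x + k) * indicator B x \<partial>lborel) \<partial>count_space int_lattice)"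
  proof (rule nn_integral_cong)
    fix k :: "real ^ 'n"
    show "(\<integral>\<^sup>+x. F x * indicator A x * indicator B (x - k) \<partial>lborel) =
      (\<integral>\<^sup>+x. F (x + k) * indicator A (x + k) * indicator B x \<partial>lborel)"
      using nn_integral_translate[of "\<lambda>x. F x * indicator A x * indicator B (x - k)" k] by simp
  qed
  also have "\<dots> = (\<integral>\<^sup>+k. (\<integral>\<^sup>+x. F x * indicator A (x + k) * indicator B x \<partial>lborel) \<partial>count_space int_lattice)"
    by (intro nn_integral_cong) (simp add: periodicD[OF per])
  also have "\<dots> = (\<integral>\<^sup>+x. (\<integral>\<^sup>+k. F x * indicator A (x + k) * indicator B x \<partial>count_space int_lattice) \<partial>lborel)"
    by (intro nn_integral_count_space_nn_integral[symmetric] countable_int_lattice) measurable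
  also have "\<dots> = (\<integral>\<^sup>+x\<in>B. F x * (\<integral>\<^sup>+k. indicator A (x + k) \<partial>count_space int_lattice) \<partial>lborel)"
    by (intro nn_integral_cong) (simp add: nn_integral_cmult nn_integral_multc mult.assoc)
  finally show ?thesis .
qed

lemma nn_integral_fundamental:
  fixes F :: "real ^ 'n::finite \<Rightarrow> ennreal"
  assumes "F \<in> borel_measurable borel" "A \<in> sets borel" "periodic F" "fundamental A"
  shows "(\<integral>\<^sup>+x\<in>A. F x \<partial>lborel) = (\<integral>\<^sup>+x\<in>cube. F x \<partial>lborel)"
  using nn_integral_tiling[OF assms(1,2) cube_borel assms(3) fundamental_cube] fundamental_sum[OF assms(4)] by simp

lemma finite_lattice_cball: "finite (int_lattice \<inter> cball (0 :: real ^ 'n::finite) r)"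
proof -
  let ?S = "real_of_int ` {- \<lceil>r\<rceil>..\<lceil>r\<rceil>}"
  have "int_lattice \<inter> cball 0 r \<subseteq> (\<lambda>f :: 'n \<Rightarrow> real. \<chi> i. f i) ` (\<Pi>\<^sub>E i\<in>UNIV. ?S)"
  proof
    fix k :: "real ^ 'n" assume k: "k \<in> int_lattice \<inter> cball 0 r"
    have "k $ i \<in> ?S" for i
    proof -
      obtain m where m: "k $ i = of_int m" using k by (auto simp: int_lattice_def elim: Ints_cases)
      have "\<bar>k $ i\<bar> \<le> r" using component_le_norm_cart[of k i] k by simp
      then have "\<bar>m\<bar> \<le> \<lceil>r\<rceil>" using m by linarith
      then have "m \<in> {- \<lceil>r\<rceil>..\<lceil>r\<rceil>}" by auto
      then show ?thesis using m by blast
    qed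
    then have "(\<lambda>i. k $ i) \<in> (\<Pi>\<^sub>E i\<in>UNIV. ?S)" by auto
    moreover have "k = (\<chi> i. (\<lambda>i. k $ i) i)" by (simp add: vec_eq_iff)
    ultimately show "k \<in> (\<lambda>f. \<chi> i. f i) ` (\<Pi>\<^sub>E i\<in>UNIV. ?S)" by (intro image_eqI)
  qed
  then show ?thesis by (rule finite_subset) (intro finite_imageI finite_PiE; simp)
qed

text \<open>Two lattice vectors that move the same point into the ball differ by a vector of length at most
  2 r, so the ball covers each point of the torus at most that many times, whatever its centre.\<close>

lemma nn_integral_cball_periodic:
  fixes F :: "real ^ 'n::finite \<Rightarrow> ennreal"
  assumes [measurable]: "F \<in> borel_measurable borel" and per: "periodic F"
  shows "(\<integral>\<^sup>+x\<in>cball a r. F x \<partial>lborel) \<le>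
    of_nat (card (int_lattice \<inter> cball (0 :: real ^ 'n) (2 * r))) * (\<integral>\<^sup>+x\<in>cube. F x \<partial>lborel)"
proof -
  let ?L = "int_lattice \<inter> cball (0 :: real ^ 'n) (2 * r)"
  have cnt: "(\<integral>\<^sup>+k. indicator (cball a r) (x + k) \<partial>count_space int_lattice) \<le> of_nat (card ?L)" for x
  proof (cases "\<exists>k0\<in>int_lattice. x + k0 \<in> cball a r")
    case False
    then have "(\<integral>\<^sup>+k. indicator (cball a r) (x + k) \<partial>count_space int_lattice) = (\<integral>\<^sup>+k. 0 \<partial>count_space (int_lattice :: (real^'n) set))"
      by (intro nn_integral_cong) (auto simp: indicator_def)
    then show ?thesis by simp
  next
    case True
    then obtain k0 where k0: "k0 \<in> int_lattice" "x + k0 \<in> cball a r" by blast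
    let ?T = "(\<lambda>k. k + k0) ` ?L"
    have T: "finite ?T" "?T \<subseteq> int_lattice" "card ?T = card ?L"
      using finite_lattice_cball[of "2 * r"] k0(1) by (auto simp: card_image int_lattice_add)
    have "(\<integral>\<^sup>+k. indicator (cball a r) (x + k) \<partial>count_space int_lattice) \<le> (\<integral>\<^sup>+k. indicator ?T k \<partial>count_space int_lattice)"
    proof (intro nn_integral_mono)
      fix k :: "real ^ 'n" assume k: "k \<in> space (count_space int_lattice)"
      have "k \<in> ?T" if "x + k \<in> cball a r"
      proof (rule image_eqI)
        show "k = (k - k0) + k0" by simp
        have "norm (k - k0) \<le> norm ((x + k) - a) + norm (a - (x + k0))"
          using norm_triangle_ineq[of "(x + k) - a" "a - (x + k0)"] by simp
        also have "\<dots> \<le> 2 * r" using that k0(2) by (simp add: dist_norm norm_minus_commute)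
        finally show "k - k0 \<in> ?L" using k k0 by (simp add: int_lattice_diff)
      qed
      then show "indicator (cball a r) (x + k) \<le> (indicator ?T k :: ennreal)" by (auto simp: indicator_def)
    qed
    also have "\<dots> = of_nat (card ?L)" using T by (simp add: emeasure_count_space_finite)
    finally show ?thesis .
  qed
  have "(\<integral>\<^sup>+x\<in>cball a r. F x \<partial>lborel) = 
     (\<integral>\<^sup>+x\<in>cube. F x * (\<integral>\<^sup>+k. indicator (cball a r) (x + k) \<partial>count_space int_lattice) \<partial>lborel)"
    by (rule nn_integral_tiling[OF _ _ cube_borel per fundamental_cube]) measurable
  also have "\<dots> \<le> (\<integral>\<^sup>+x. of_nat (card ?L) * (F x * indicator cube x) \<partial>lborel)"
  proof (rule nn_integral_mono)
    fix x :: "real^'n"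
    have "F x * (\<integral>\<^sup>+k. indicator (cball a r) (x + k) \<partial>count_space int_lattice) * indicator cube x
       \<le> F x * of_nat (card ?L) * indicator cube x"
      by (intro mult_right_mono mult_left_mono cnt) auto
    then show "F x * (\<integral>\<^sup>+k. indicator (cball a r) (x + k) \<partial>count_space int_lattice) * indicator cube x
       \<le> of_nat (card ?L) * (F x * indicator cube x)" by (simp add: mult_ac)
  qed
  also have "\<dots> = of_nat (card ?L) * (\<integral>\<^sup>+x\<in>cube. F x \<partial>lborel)"
    by (rule nn_integral_cmult) measurable
  finally show ?thesis .
qed

lemma fundamental_reflect: 
  assumes "fundamental A" shows "fundamental {x. c - x \<in> A}"
  unfolding fundamental_def
proof
  fix x
  have "\<exists>!k. k \<in> int_lattice \<and> (c - x) - k \<in> A" using assms by (auto simp: fundamental_def)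
  then obtain k where k: "k \<in> int_lattice" "(c - x) - k \<in> A" 
    and u: "\<And>l. l \<in> int_lattice \<Longrightarrow> (c - x) - l \<in> A \<Longrightarrow> l = k" by blast
  show "\<exists>!k. k \<in> int_lattice \<and> x - k \<in> {x. c - x \<in> A}"
  proof (rule ex1I[of _ "-k"])
    show "- k \<in> int_lattice \<and> x - - k \<in> {x. c - x \<in> A}" using k int_lattice_minus[of k] by (simp add: algebra_simps)
    fix l assume "l \<in> int_lattice \<and> x - l \<in> {x. c - x \<in> A}"
    then have "- l = k" using u[of "-l"] int_lattice_minus[of l] by (simp add: algebra_simps)
    then show "l = - k" by auto
  qed
qed

lemma nn_integral_cube_reflect:
  fixes F :: "real ^ 'n::finite \<Rightarrow> ennreal"
  assumes [measurable]: "F \<in> borel_measurable borel" and "periodic F"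
  shows "(\<integral>\<^sup>+x\<in>cube. F (c - x) \<partial>lborel) = (\<integral>\<^sup>+x\<in>cube. F x \<partial>lborel)"
proof -
  have "(\<integral>\<^sup>+x\<in>cube. F x \<partial>lborel) = (\<integral>\<^sup>+x\<in>{x. c - x \<in> cube}. F x \<partial>lborel)"
    using assms by (intro nn_integral_fundamental[symmetric] fundamental_reflect fundamental_cube) measurable
  also have "\<dots> = (\<integral>\<^sup>+x. F x * indicator cube (c - x) \<partial>lborel)"
    by (intro nn_integral_cong) (simp add: indicator_def)
  also have "\<dots> = (\<integral>\<^sup>+x. F x * indicator cube (c - x) \<partial>distr lborel borel (\<lambda>x. c - x))"
    using lborel_affine[of "-1" c] by (simp add: density_1)
  also have "\<dots> = (\<integral>\<^sup>+x\<in>cube. F (c - x) \<partial>lborel)" by (subst nn_integral_distr) auto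
  finally show ?thesis by simp
qed

lemma nn_integral_cube_translate:
  fixes F :: "real ^ 'n::finite \<Rightarrow> ennreal"
  assumes [measurable]: "F \<in> borel_measurable borel" and per: "periodic F"
  shows "(\<integral>\<^sup>+x\<in>cube. F (x - c) \<partial>lborel) = (\<integral>\<^sup>+x\<in>cube. F x \<partial>lborel)"
proof -
  have p: "periodic (\<lambda>x. F (- x))" unfolding periodic_def
  proof safe
    fix x k :: "real^'n" assume "k \<in> int_lattice" 
    then show "F (- (x + k)) = F (- x)" using periodic_diff[OF per, of k "-x"] by simp
  qed
  have "(\<integral>\<^sup>+x\<in>cube. F (x - c) \<partial>lborel) = (\<integral>\<^sup>+x\<in>cube. F (- (c - x)) \<partial>lborel)" by simp
  also have "\<dots> = (\<integral>\<^sup>+x\<in>cube. F (- x) \<partial>lborel)" by (rule nn_integral_cube_reflect[OF _ p]) measurable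
  also have "\<dots> = (\<integral>\<^sup>+x\<in>cube. F x \<partial>lborel)" using nn_integral_cube_reflect[OF _ per, of 0] by simp
  finally show ?thesis .
qed

lemma torus_proj_measurable [measurable]: "torus_proj \<in> borel_measurable (borel :: (real^'n::finite) measure)"
  by (intro borel_measurable_continuous_onI continuous_on_torus_proj)

lemma sets_torus_measure [simp, measurable_cong]: "sets torus_measure = sets borel"
  by (simp add: torus_measure_def)

lemma space_torus_measure [simp]: "space torus_measure = UNIV"
  by (simp add: torus_measure_def)

lemma torus_measure_cube: "torus_measure = distr (restrict_space lborel (cube :: (real^'n::finite) set)) borel torus_proj"
  by (simp add: torus_measure_def cube_def)

lemma nn_integral_torus:
  fixes f :: "'n::finite torus \<Rightarrow> ennreal"
  assumes [measurable]: "f \<in> borel_measurable borel"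
  shows "(\<integral>\<^sup>+p. f p \<partial>torus_measure) = (\<integral>\<^sup>+x\<in>cube. f (torus_proj x) \<partial>lborel)"
  unfolding torus_measure_cube
  by (subst nn_integral_distr) (auto simp: nn_integral_restrict_space measurable_restrict_space1)

lemma prob_space_torus: "prob_space (torus_measure :: 'n::finite torus measure)"
proof (rule prob_spaceI)
  have "emeasure (torus_measure :: 'n torus measure) UNIV = (\<integral>\<^sup>+p. indicator UNIV p \<partial>(torus_measure :: 'n torus measure))"
    by (rule nn_integral_indicator[symmetric]) simp
  also have "\<dots> = (\<integral>\<^sup>+x\<in>cube. indicator UNIV (torus_proj x :: 'n torus) \<partial>lborel)"
    by (rule nn_integral_torus) simp
  also have "\<dots> = (\<integral>\<^sup>+x. indicator (cube :: (real^'n) set) x \<partial>lborel)" by (intro nn_integral_cong) simp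
  also have "\<dots> = 1" by (subst nn_integral_indicator) (simp_all add: emeasure_cube)
  finally show "emeasure (torus_measure :: 'n torus measure) (space torus_measure) = 1" by simp
qed

text \<open>The representatives torus_rep are chosen arbitrarily; those in the half-open cube form a Borel
  section of the projection, through which functions on \<real>^n become functions on the torus.\<close>

definition cube_rep :: "'n::finite torus \<Rightarrow> real ^ 'n" where
  "cube_rep p = torus_rep p - int_part (torus_rep p)"

lemma torus_proj_cube_rep [simp]: "torus_proj (cube_rep p) = p"
  using torus_proj_add[of "- int_part (torus_rep p)" "torus_rep p"] int_part_lattice int_lattice_minus
  by (fastforce simp: cube_rep_def)

lemma cube_rep_cube: "cube_rep p \<in> cube"
  by (simp add: cube_rep_def frac_cube)

lemma cube_rep_proj: "x \<in> cube \<Longrightarrow> cube_rep (torus_proj x) = x"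
proof -
  assume x: "x \<in> cube"
  have l: "x - cube_rep (torus_proj x) \<in> int_lattice" by (simp flip: torus_proj_eq_iff)
  have "x - cube_rep (torus_proj x) = int_part x"
    by (rule cube_lattice_unique[OF l]) (simp add: cube_rep_cube)
  then show ?thesis using int_part_cube[OF x] by simp
qed

text \<open>The cube is a countable union of compact boxes, so the preimage of a closed set is a countable
  union of continuous images of compact sets.\<close>

lemma cube_rep_measurable [measurable]: "cube_rep \<in> borel_measurable (borel :: 'n::finite torus measure)"
proof (rule borel_measurableI)
  fix S' :: "(real^'n) set" assume "open S'"
  define S where "S = - S'"
  have S: "closed S" using \<open>open S'\<close> by (simp add: S_def closed_open)
  let ?B = "\<lambda>m::nat. S \<inter> cbox 0 (\<chi> i. 1 - 1 / real (Suc m))"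
  have "cube_rep -` S \<inter> space borel = (\<Union>m. torus_proj ` ?B m)"
  proof safe
    fix p assume p: "cube_rep p \<in> S"
    let ?x = "cube_rep p"
    have c: "0 \<le> ?x $ i" "?x $ i < 1" for i using cube_rep_cube[of p] by (auto simp: cube_def)
    have "\<forall>\<^sub>F m in sequentially. \<forall>i. 1 / real (Suc m) < 1 - ?x $ i"
    proof (rule eventually_all_finite)
      fix i
      have "(\<lambda>m. 1 / real (Suc m)) \<longlonglongrightarrow> 0" by (rule LIMSEQ_Suc[OF lim_1_over_n])
      then show "\<forall>\<^sub>F m in sequentially. 1 / real (Suc m) < 1 - ?x $ i"
        using c(2)[of i] by (intro order_tendstoD(2)) auto
    qed
    then obtain m where m: "\<And>i. 1 / real (Suc m) < 1 - ?x $ i" unfolding eventually_sequentially by blast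
    have le: "?x $ i \<le> 1 - 1 / real (Suc m)" for i using m[of i] by linarith
    have "?x \<in> ?B m" using p c(1) le by (simp add: mem_box_cart)
    then have "torus_proj ?x \<in> torus_proj ` ?B m" by (rule imageI)
    then show "p \<in> (\<Union>m. torus_proj ` ?B m)" unfolding torus_proj_cube_rep by blast
  next
    fix m x assume x: "x \<in> S" "x \<in> cbox 0 (\<chi> i. 1 - 1 / real (Suc m))"
    have "x \<in> cube" unfolding cube_def
    proof (rule CollectI, rule allI)
      fix i
      have "0 \<le> x $ i" "x $ i \<le> 1 - 1 / real (Suc m)" using x(2) by (auto simp: mem_box_cart)
      moreover have "1 / real (Suc m) > 0" by simp
      ultimately show "0 \<le> x $ i \<and> x $ i < 1" by linarith
    qed
    then show "torus_proj x \<in> cube_rep -` S" using x(1) cube_rep_proj[OF \<open>x \<in> cube\<close>] by simp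
  qed auto
  also have "\<dots> \<in> sets borel"
  proof (intro sets.countable_UN image_subsetI)
    fix m
    have "compact (?B m)" using S by (intro closed_Int_compact compact_cbox)
    then have "compact (torus_proj ` ?B m)" by (rule compact_continuous_image[OF continuous_on_torus_proj])
    then show "torus_proj ` ?B m \<in> sets borel" by (intro borel_closed compact_imp_closed)
  qed
  finally have "space borel - (cube_rep -` S \<inter> space borel) \<in> sets borel" by (rule sets.compl_sets)
  also have "space borel - (cube_rep -` S \<inter> space borel) = cube_rep -` S' \<inter> space borel" by (auto simp: S_def)
  finally show "cube_rep -` S' \<inter> space borel \<in> sets borel" .
qed


section \<open>Morrey's inequality for exponentially integrable gradients\<close>

lemma cball_borel [measurable]: "cball c r \<in> sets borel"
  by (intro borel_closed closed_cball)

lemma norm_matrix_vector_le: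
  fixes A :: "real ^ 'n::finite ^ 'm::finite"
  shows "norm (A *v x) \<le> norm A * norm x"
proof -
  have "norm (A *v x) = L2_set (\<lambda>i. norm ((A *v x) $ i)) UNIV" by (simp add: norm_vec_def)
  also have "\<dots> \<le> L2_set (\<lambda>i. norm (A $ i) * norm x) UNIV"
    by (intro L2_set_mono) (auto simp: matrix_vector_mul_component intro: Cauchy_Schwarz_ineq2)
  also have "\<dots> = norm A * norm x"
    by (simp add: L2_set_right_distrib[symmetric] L2_set_left_distrib[symmetric] norm_vec_def[of A])
  finally show ?thesis .
qed

text \<open>By convexity the contraction towards x by the factor s maps the ball into itself.\<close>

lemma nn_integral_cball_contract:
  fixes F :: "real ^ 'n::finite \<Rightarrow> ennreal"
  assumes [measurable]: "F \<in> borel_measurable borel" and s: "0 < s" "s \<le> 1" and x: "x \<in> cball c R"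
  shows "(\<integral>\<^sup>+z\<in>cball c R. F (x + s *\<^sub>R (z - x)) \<partial>lborel)
    \<le> ennreal ((1 / s) ^ CARD('n)) * (\<integral>\<^sup>+z\<in>cball c R. F z \<partial>lborel)"
proof -
  let ?T = "\<lambda>z. (x - s *\<^sub>R x) + s *\<^sub>R z" and ?n = "CARD('n)" and ?B = "cball c R"
  have T: "?T z = x + s *\<^sub>R (z - x)" for z by (simp add: algebra_simps)
  have TB: "?T z \<in> ?B" if "z \<in> ?B" for z
  proof -
    have "?T z = (1 - s) *\<^sub>R x + s *\<^sub>R z" by (simp add: algebra_simps)
    then show ?thesis using convexD[OF convex_cball x that, of "1 - s" s] s by simp
  qed
  have le: "F (?T z) * indicator ?B z \<le> F (?T z) * indicator ?B (?T z)" for z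
    using TB[of z] by (auto simp: indicator_def)
  have "(\<integral>\<^sup>+z\<in>?B. F z \<partial>lborel) = (\<integral>\<^sup>+z. F z * indicator ?B z \<partial>density (distr lborel borel ?T) (\<lambda>_. ennreal (\<bar>s\<bar> ^ DIM(real^'n))))"
    using s by (subst lborel_affine[of s "x - s *\<^sub>R x"]) auto
  also have "\<dots> = ennreal (s ^ ?n) * (\<integral>\<^sup>+z. F (?T z) * indicator ?B (?T z) \<partial>lborel)"
    using s by (simp add: nn_integral_density nn_integral_distr nn_integral_cmult)
  finally have eq: "(\<integral>\<^sup>+z\<in>?B. F z \<partial>lborel) = ennreal (s ^ ?n) * (\<integral>\<^sup>+z. F (?T z) * indicator ?B (?T z) \<partial>lborel)" .
  have "ennreal ((1 / s) ^ ?n) * (\<integral>\<^sup>+z\<in>?B. F z \<partial>lborel) = (\<integral>\<^sup>+z. F (?T z) * indicator ?B (?T z) \<partial>lborel)"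
    using s unfolding eq mult.assoc[symmetric]
    by (simp flip: ennreal_mult power_mult_distrib)
  moreover have "(\<integral>\<^sup>+z\<in>?B. F (?T z) \<partial>lborel) \<le> (\<integral>\<^sup>+z. F (?T z) * indicator ?B (?T z) \<partial>lborel)"
    by (intro nn_integral_mono le)
  ultimately show ?thesis unfolding T by simp
qed

lemma norm_diff_le_nn_integral_segment:
  fixes v :: "real ^ 'n::finite \<Rightarrow> real ^ 'm::finite" and G :: "real ^ 'n \<Rightarrow> real ^ 'n ^ 'm"
  assumes der: "\<And>x. (v has_derivative (\<lambda>h. G x *v h)) (at x)"
    and cont: "continuous_on UNIV G"
  shows "ennreal (norm (v x - v z)) \<le>
    (\<integral>\<^sup>+s\<in>{0..1}. ennreal (norm (z - x) * norm (G (x + s *\<^sub>R (z - x)))) \<partial>lborel)"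
proof -
  let ?g = "\<lambda>s. x + s *\<^sub>R (z - x)"
  let ?b = "\<lambda>s. norm (z - x) * norm (G (?g s))"
  have "((\<lambda>s. G (?g s) *v (z - x)) has_integral (v (?g 1) - v (?g 0))) {0..1}"
  proof (rule fundamental_theorem_of_calculus)
    fix s :: real assume "s \<in> {0..1}"
    have "((\<lambda>s. v (?g s)) has_derivative (\<lambda>t. G (?g s) *v (t *\<^sub>R (z - x)))) (at s within {0..1})"
      by (rule has_derivative_compose[where f = ?g, OF _ der])
         (auto intro!: derivative_eq_intros)
    then show "((\<lambda>s. v (?g s)) has_vector_derivative (G (?g s) *v (z - x))) (at s within {0..1})"
      by (simp add: has_vector_derivative_def matrix_vector_mult_scaleR)
  qed simp
  then have I: "((\<lambda>s. G (?g s) *v (z - x)) has_integral (v z - v x)) {0..1}" by simp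
  have ci: "?b integrable_on {0..1}"
    by (intro integrable_continuous_interval continuous_intros continuous_on_compose2[OF cont]) auto
  have "norm (v z - v x) \<le> integral {0..1} ?b"
    unfolding integral_unique[OF I, symmetric]
    using I ci norm_matrix_vector_le by (intro Henstock_Kurzweil_Integration.integral_norm_bound_integral) (auto simp: mult.commute)
  also have "ennreal (integral {0..1} ?b) = (\<integral>\<^sup>+s\<in>{0..1}. ennreal (?b s) \<partial>lborel)"
    by (rule nn_integral_has_integral_lebesgue'[symmetric, OF _ integrable_integral[OF ci]]) auto
  finally show ?thesis by (simp add: norm_minus_commute ennreal_leI)
qed

text \<open>The mean over z of |v x - v z| is at most 2 R times the integral over s in (0,1] of the mean of |G| on
  the ball contracted by s towards x. The mean of exp(\<beta>|G|) on the contracted ball is at most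
  s^(-n) J, so by Jensen the mean of |G| there is at most (ln J + n ln (1/s)) / \<beta>, and ln (1/s) is
  integrable at 0. This use of the exponential is what makes the bound logarithmic in J.\<close>

lemma Morrey_average:
  fixes v :: "real ^ 'n::finite \<Rightarrow> real ^ 'm::finite" and G :: "real ^ 'n \<Rightarrow> real ^ 'n ^ 'm"
  assumes der: "\<And>x. (v has_derivative (\<lambda>h. G x *v h)) (at x)"
    and cont: "continuous_on UNIV G"
    and \<beta>: "\<beta> > 0" and R: "R > 0" and x: "x \<in> cball c R"
    and J: "J \<ge> 1" "(\<integral>\<^sup>+z\<in>cball c R. ennreal (exp (\<beta> * norm (G z))) \<partial>lborel) \<le> ennreal (J * m)"
    and m: "emeasure lborel (cball c R) = ennreal m" "m > 0"
  shows "(\<integral>\<^sup>+z\<in>cball c R. ennreal (norm (v x - v z)) \<partial>lborel)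
     \<le> ennreal (2 * R / \<beta> * (ln J + 4 * CARD('n) + 1) * m)"
proof -
  let ?B = "cball c R" and ?n = "real CARD('n)"
  have [measurable]: "G \<in> borel_measurable borel" using cont by (rule borel_measurable_continuous_onI)
  let ?g = "\<lambda>s z. norm (G (x + s *\<^sub>R (z - x)))"
  let ?w = "\<lambda>s::real. (ln J + 1) + 2 * ?n * s powr (-1/2)"
  have zx: "norm (z - x) \<le> 2 * R" if "z \<in> ?B" for z
    using that x dist_triangle[of z x c] by (simp add: dist_norm norm_minus_commute)
  have inner: "(\<integral>\<^sup>+z\<in>?B. ennreal (?g s z) \<partial>lborel) \<le> ennreal (?w s * m / \<beta>)" if s: "0 < s" "s \<le> 1" for s
  proof -
    \<comment> \<open>\<open>a\<close> dominates \<open>ln J + n ln (1/s)\<close> and has an elementary integral in \<open>s\<close>\<close>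
    define a where "a = ln J + 2 * ?n * s powr (-1/2)"
    have a0: "a \<ge> 0" using J by (simp add: a_def)
    have "ln (1 / s) = 2 * ln (s powr (-1/2))" using s by (simp add: ln_powr ln_div)
    also have "\<dots> \<le> 2 * s powr (-1/2)" using ln_le_minus_one[of "s powr (-1/2)"] s by simp
    finally have "?n * ln (1 / s) \<le> ?n * (2 * s powr (-1/2))" by (intro mult_left_mono) auto
    then have "(1 / s) ^ CARD('n) * J \<le> exp a"
    proof -
      have "(1 / s) ^ CARD('n) * J = exp (?n * ln (1/s) + ln J)"
        using s J by (simp add: exp_add exp_of_nat_mult)
      also have "\<dots> \<le> exp a" using \<open>?n * ln (1 / s) \<le> ?n * (2 * s powr (-1/2))\<close> by (simp add: a_def)
      finally show ?thesis .
    qed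
    then have "exp (- a) * ((1 / s) ^ CARD('n) * J) \<le> exp (- a) * exp a" by (intro mult_left_mono) auto
    then have ea: "exp (- a) * ((1 / s) ^ CARD('n) * J) \<le> 1" by (simp flip: exp_add)
    \<comment> \<open>Jensen's inequality in pointwise form: \<open>y \<le> exp y\<close> at \<open>y = \<beta> |G| - a\<close>\<close>
    have pw: "ennreal (?g s z) \<le> ennreal (a / \<beta>) + ennreal (exp (- a) / \<beta>) * ennreal (exp (\<beta> * ?g s z))" for z
    proof -
      have "\<beta> * ?g s z - a \<le> exp (\<beta> * ?g s z - a)" using exp_ge_add_one_self[of "\<beta> * ?g s z - a"] by linarith
      then have "?g s z \<le> a / \<beta> + exp (- a) / \<beta> * exp (\<beta> * ?g s z)"
        using \<beta> by (simp add: field_simps exp_diff exp_minus)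
      then show ?thesis using a0 \<beta> by (simp add: ennreal_leI flip: ennreal_mult ennreal_plus)
    qed
    have "(\<integral>\<^sup>+z\<in>?B. ennreal (?g s z) \<partial>lborel) \<le> 
        (\<integral>\<^sup>+z. ennreal (a / \<beta>) * indicator ?B z + ennreal (exp (- a) / \<beta>) * (ennreal (exp (\<beta> * ?g s z)) * indicator ?B z) \<partial>lborel)"
      using pw by (intro nn_integral_mono) (auto simp: indicator_def)
    also have "\<dots> = ennreal (a / \<beta>) * ennreal m + ennreal (exp (- a) / \<beta>) * (\<integral>\<^sup>+z\<in>?B. ennreal (exp (\<beta> * ?g s z)) \<partial>lborel)"
      using m by (subst nn_integral_add) (auto simp: nn_integral_cmult)
    also have "(\<integral>\<^sup>+z\<in>?B. ennreal (exp (\<beta> * ?g s z)) \<partial>lborel) \<le> ennreal ((1 / s) ^ CARD('n)) * ennreal (J * m)"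
      by (rule order_trans[OF nn_integral_cball_contract[OF _ s x, where F = "\<lambda>y. ennreal (exp (\<beta> * norm (G y)))"]])
         (use J in \<open>auto intro: mult_left_mono\<close>)
    also have "ennreal (a / \<beta>) * ennreal m + ennreal (exp (- a) / \<beta>) * (ennreal ((1 / s) ^ CARD('n)) * ennreal (J * m))
       = ennreal (a / \<beta> * m + exp (- a) / \<beta> * ((1 / s) ^ CARD('n) * (J * m)))"
      using s J m a0 \<beta> by (simp flip: ennreal_mult ennreal_plus)
    also have "\<dots> \<le> ennreal (?w s * m / \<beta>)"
    proof (rule ennreal_leI)
      have "exp (- a) / \<beta> * ((1 / s) ^ CARD('n) * (J * m)) = (exp (- a) * ((1 / s) ^ CARD('n) * J)) * (m / \<beta>)" by simp
      also have "\<dots> \<le> 1 * (m / \<beta>)" using ea m \<beta> by (intro mult_right_mono) auto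
      finally show "a / \<beta> * m + exp (- a) / \<beta> * ((1 / s) ^ CARD('n) * (J * m)) \<le> ?w s * m / \<beta>"
      proof -
        assume *: "exp (- a) / \<beta> * ((1 / s) ^ CARD('n) * (J * m)) \<le> 1 * (m / \<beta>)"
        have "?w s * m / \<beta> = a / \<beta> * m + 1 * (m / \<beta>)" by (simp add: a_def add_divide_distrib distrib_right)
        then show ?thesis using * by linarith
      qed
    qed
    finally show ?thesis by (simp add: add_left_mono mult_left_mono)
  qed
  have "(\<integral>\<^sup>+z\<in>?B. ennreal (norm (v x - v z)) \<partial>lborel) \<le>
     (\<integral>\<^sup>+z. (\<integral>\<^sup>+s. ennreal (2 * R) * (ennreal (?g s z) * indicator ?B z) * indicator {0..1} s \<partial>lborel) \<partial>lborel)"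
  proof (rule nn_integral_mono)
    fix z
    have "ennreal (norm (v x - v z)) \<le> (\<integral>\<^sup>+s. ennreal (2 * R) * ennreal (?g s z) * indicator {0..1} s \<partial>lborel)" if "z \<in> ?B"
    proof (rule order_trans[OF norm_diff_le_nn_integral_segment[OF der cont]], rule nn_integral_mono)
      fix s
      show "ennreal (norm (z - x) * ?g s z) * indicator {0..1} s \<le> ennreal (2 * R) * ennreal (?g s z) * indicator {0..1} s"
        using zx[OF that] R by (auto simp: ennreal_mult[symmetric] indicator_def intro!: ennreal_leI mult_right_mono)
    qed
    then show "ennreal (norm (v x - v z)) * indicator ?B z \<le>
      (\<integral>\<^sup>+s. ennreal (2 * R) * (ennreal (?g s z) * indicator ?B z) * indicator {0..1} s \<partial>lborel)"
      by (auto simp: indicator_def)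
  qed
  also have "\<dots> = (\<integral>\<^sup>+s. (\<integral>\<^sup>+z. ennreal (2 * R) * (ennreal (?g s z) * indicator ?B z) * indicator {0..1} s \<partial>lborel) \<partial>lborel)"
    by (rule lborel_pair.Fubini') measurable
  also have "\<dots> = (\<integral>\<^sup>+s. ennreal (2 * R) * (\<integral>\<^sup>+z\<in>?B. ennreal (?g s z) \<partial>lborel) * indicator {0..1} s \<partial>lborel)"
    by (intro nn_integral_cong) (simp add: nn_integral_cmult nn_integral_multc)
  also have "\<dots> \<le> (\<integral>\<^sup>+s. ennreal (2 * R / \<beta> * m * ?w s) * indicator {0..1} s \<partial>lborel)"
  proof (rule nn_integral_mono_AE)
    show "AE s in lborel. ennreal (2 * R) * (\<integral>\<^sup>+z\<in>?B. ennreal (?g s z) \<partial>lborel) * indicator {0..1} s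
      \<le> ennreal (2 * R / \<beta> * m * ?w s) * indicator {0..1} s"
      using AE_lborel_singleton[of 0]
    proof eventually_elim
      case (elim s)
      show ?case
      proof (cases "s \<in> {0..1}")
        case True
        then have "0 < s" "s \<le> 1" using elim by auto
        then have "ennreal (2 * R) * (\<integral>\<^sup>+z\<in>?B. ennreal (?g s z) \<partial>lborel) \<le> ennreal (2 * R) * ennreal (?w s * m / \<beta>)"
          by (intro mult_left_mono inner) auto
        also have "\<dots> = ennreal (2 * R / \<beta> * m * ?w s)"
          using R J m \<beta> by (subst ennreal_mult[symmetric]) (auto simp: field_simps intro!: add_nonneg_nonneg)
        finally show ?thesis using True by simp
      qed simp
    qed
  qed
  also have "\<dots> = ennreal (2 * R / \<beta> * m * ((ln J + 1) + 2 * ?n * (1 powr (-1/2+1) / (-1/2+1))))"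
  proof (rule nn_integral_has_integral_lebesgue')
    show "0 \<le> 2 * R / \<beta> * m * ?w s" if "s \<in> {0..1}" for s
      using R J m \<beta> by (intro mult_nonneg_nonneg add_nonneg_nonneg) auto
    have "((\<lambda>s::real. ln J + 1) has_integral (ln J + 1)) {0..1}" 
      using has_integral_const_real[of "ln J + 1" 0 1] by simp
    then show "((\<lambda>s. 2 * R / \<beta> * m * ?w s) has_integral 2 * R / \<beta> * m * ((ln J + 1) + 2 * ?n * (1 powr (-1/2+1) / (-1/2+1)))) {0..1}"
      by (intro has_integral_mult_right has_integral_add[where f = "\<lambda>s. ln J + 1"] has_integral_powr_from_0) auto
  qed
  also have "2 * R / \<beta> * m * ((ln J + 1) + 2 * ?n * (1 powr (-1/2+1) / (-1/2+1))) = 2 * R / \<beta> * (ln J + 4 * CARD('n) + 1) * m"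
    by simp
  finally show ?thesis .
qed

text \<open>Average |v x - v y| \<le> |v x - v z| + |v y - v z| over all z in the ball.\<close>

lemma Morrey:
  fixes v :: "real ^ 'n::finite \<Rightarrow> real ^ 'm::finite" and G :: "real ^ 'n \<Rightarrow> real ^ 'n ^ 'm"
  assumes der: "\<And>x. (v has_derivative (\<lambda>h. G x *v h)) (at x)"
    and cont: "continuous_on UNIV G"
    and \<beta>: "\<beta> > 0" and R: "R > 0" and xy: "x \<in> cball c R" "y \<in> cball c R"
    and J: "J \<ge> 1" "(\<integral>\<^sup>+z\<in>cball c R. ennreal (exp (\<beta> * norm (G z))) \<partial>lborel) \<le> ennreal J * emeasure lborel (cball c R)"
  shows "norm (v x - v y) \<le> 4 * R / \<beta> * (ln J + 4 * CARD('n) + 1)"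
proof -
  let ?B = "cball c R"
  define m where "m = measure lborel ?B"
  have m: "emeasure lborel ?B = ennreal m" unfolding m_def
    using emeasure_lborel_cball_finite[of c R] by (intro emeasure_eq_ennreal_measure) auto
  have m0: "m > 0" unfolding m_def using content_cball_pos[OF R, of c] by simp
  have J': "(\<integral>\<^sup>+z\<in>cball c R. ennreal (exp (\<beta> * norm (G z))) \<partial>lborel) \<le> ennreal (J * m)"
    using J m m0 by (simp add: ennreal_mult)
  have [measurable]: "v \<in> borel_measurable borel"
    using der by (intro borel_measurable_continuous_onI continuous_at_imp_continuous_on ballI has_derivative_continuous)
  let ?D = "2 * R / \<beta> * (ln J + 4 * CARD('n) + 1) * m"
  have D: "?D \<ge> 0" using R \<beta> J m0 by (intro mult_nonneg_nonneg add_nonneg_nonneg) auto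
  have "ennreal (norm (v x - v y) * m) = (\<integral>\<^sup>+z. ennreal (norm (v x - v y)) * indicator ?B z \<partial>lborel)"
    using m m0 by (simp add: nn_integral_cmult_indicator ennreal_mult)
  also have "\<dots> \<le> (\<integral>\<^sup>+z. ennreal (norm (v x - v z)) * indicator ?B z + ennreal (norm (v y - v z)) * indicator ?B z \<partial>lborel)"
  proof (rule nn_integral_mono)
    fix z
    have "norm (v x - v y) \<le> norm (v x - v z) + norm (v y - v z)"
      using norm_triangle_ineq4[of "v x - v z" "v y - v z"] by simp
    then show "ennreal (norm (v x - v y)) * indicator ?B z \<le> 
        ennreal (norm (v x - v z)) * indicator ?B z + ennreal (norm (v y - v z)) * indicator ?B z"
      by (auto simp: indicator_def simp flip: ennreal_plus intro!: ennreal_leI)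
  qed
  also have "\<dots> = (\<integral>\<^sup>+z\<in>?B. ennreal (norm (v x - v z)) \<partial>lborel) + (\<integral>\<^sup>+z\<in>?B. ennreal (norm (v y - v z)) \<partial>lborel)"
    by (rule nn_integral_add) auto
  also have "\<dots> \<le> ennreal ?D + ennreal ?D"
    by (intro add_mono Morrey_average[OF der cont \<beta> R _ J(1) J' m m0] xy)
  also have "\<dots> = ennreal (2 * ?D)" unfolding ennreal_plus[OF D D, symmetric] mult_2[of ?D] ..
  finally have "norm (v x - v y) * m \<le> 2 * ?D" using D by (simp add: ennreal_le_iff)
  also have "2 * ?D = (4 * R / \<beta> * (ln J + 4 * CARD('n) + 1)) * m" by simp
  finally show ?thesis using m0 by (simp only: mult_le_cancel_right_pos)
qed


section \<open>Log-Lipschitz modulus and pointwise Lipschitz constants\<close>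

definition smooth_field ::
  "real \<Rightarrow> real \<Rightarrow> (real ^ 'n::finite \<Rightarrow> real ^ 'n) \<Rightarrow> (real ^ 'n \<Rightarrow> real ^ 'n ^ 'n) \<Rightarrow> bool" where
  "smooth_field \<beta> K v G \<longleftrightarrow> periodic v \<and> periodic G \<and>
     (\<forall>x. (v has_derivative (\<lambda>h. G x *v h)) (at x)) \<and> continuous_on UNIV G \<and>
     (\<integral>\<^sup>+x\<in>cube. ennreal (exp (\<beta> * norm (G x))) \<partial>lborel) \<le> ennreal K"

text \<open>The Osgood modulus of continuity r (a + A ln (1/r)), continued linearly for r \<ge> 1.\<close>

definition modulus :: "real \<Rightarrow> real \<Rightarrow> real \<Rightarrow> real" where
  "modulus a A r = r * (a + A * max 0 (- ln r))"

lemma nearby_translate: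
  fixes x y :: "real ^ 'n::finite"
  obtains z where "z - y \<in> int_lattice" "norm (x - z) \<le> real CARD('n)" "norm (x - z) \<le> norm (x - y)"
proof (cases "norm (x - y) \<le> real CARD('n)")
  case True
  then show thesis by (intro that[of y]) (auto simp: int_lattice_zero)
next
  case False
  let ?z = "y + int_part (x - y)"
  have "norm (x - ?z) \<le> real CARD('n)" 
    using norm_cube[OF frac_cube[of "x - y"]] by (simp add: algebra_simps)
  then show thesis using False by (intro that[of ?z]) (auto simp: int_part_lattice)
qed

lemma periodic_translate: "periodic f \<Longrightarrow> z - y \<in> int_lattice \<Longrightarrow> f z = f y"
  using periodicD[of f "z - y" y] by simp

lemma mult_max_ln_le_one: 
  fixes r :: real assumes "r \<ge> 0" shows "r * max 0 (- ln r) \<le> 1"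
proof (cases "r > 0 \<and> r < 1")
  case True
  then have "- ln r \<le> 1 / r - 1" using ln_le_minus_one[of "1/r"] by (simp add: ln_div)
  then have "r * (- ln r) \<le> r * (1 / r)" using True by (intro mult_left_mono) auto
  then show ?thesis using True by (simp add: max_def)
next
  case False
  then show ?thesis using assms by (cases "r = 0") (auto simp: max_def)
qed

lemma smooth_field_cball:
  fixes v :: "real ^ 'n::finite \<Rightarrow> real ^ 'n"
  assumes "smooth_field \<beta> K v G" "r \<le> real CARD('n)"
  shows "(\<integral>\<^sup>+z\<in>cball c r. ennreal (exp (\<beta> * norm (G z))) \<partial>lborel)
    \<le> ennreal (real (card (int_lattice \<inter> cball (0 :: real ^ 'n) (2 * real CARD('n)))) * K)"
proof -
  have [measurable]: "G \<in> borel_measurable borel" 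
    using assms by (intro borel_measurable_continuous_onI) (auto simp: smooth_field_def)
  have "(\<integral>\<^sup>+z\<in>cball c r. ennreal (exp (\<beta> * norm (G z))) \<partial>lborel) \<le> (\<integral>\<^sup>+z\<in>cball c (real CARD('n)). ennreal (exp (\<beta> * norm (G z))) \<partial>lborel)"
    using assms(2) by (intro nn_integral_mono) (auto simp: indicator_def)
  also have "\<dots> \<le> of_nat (card (int_lattice \<inter> cball (0 :: real ^ 'n) (2 * real CARD('n)))) * (\<integral>\<^sup>+x\<in>cube. ennreal (exp (\<beta> * norm (G x))) \<partial>lborel)"
    using assms(1) by (intro nn_integral_cball_periodic) (auto simp: smooth_field_def periodic_def)
  also have "\<dots> \<le> of_nat (card (int_lattice \<inter> cball (0 :: real ^ 'n) (2 * real CARD('n)))) * ennreal K"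
    using assms(1) by (intro mult_left_mono) (auto simp: smooth_field_def)
  finally show ?thesis by (simp add: ennreal_mult' ennreal_of_nat_eq_real_of_nat)
qed

lemma card_lattice_pos: "card (int_lattice \<inter> cball (0 :: real ^ 'n::finite) (2 * real CARD('n))) > 0"
  using finite_lattice_cball by (auto simp: card_gt_0_iff intro: int_lattice_zero)

text \<open>Morrey's inequality on the ball of radius r = |x - y|, where the mean of exp(\<beta>|G|) is at most a
  constant times K r^(-n). The constants depend on \<beta>, K and n alone, which makes
  them uniform over all mollifications of a field.\<close>

lemma smooth_field_log_Lipschitz:
  assumes \<beta>: "\<beta> > 0" and K: "K \<ge> 1"
  obtains a A where "a \<ge> 0" "A \<ge> 0"
    "\<And>(v :: real ^ 'n::finite \<Rightarrow> real ^ 'n) G x y. smooth_field \<beta> K v G \<Longrightarrow>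
       norm (v x - v y) \<le> modulus a A (norm (x - y))"
proof -
  let ?n = "real CARD('n)"
  define N where "N = real (card (int_lattice \<inter> cball (0 :: real ^ 'n) (2 * ?n)))"
  define u where "u = unit_ball_vol ?n"
  define l where "l = max 0 (ln (N * K / u))"
  define A where "A = 4 / \<beta> * ?n"
  define a where "a = 4 / \<beta> * (l + 4 * ?n + 1)"
  have pos: "N > 0" "u > 0" "A \<ge> 0" "a \<ge> 0" "l \<ge> 0" "?n \<ge> 1"
    using card_lattice_pos[where 'n = 'n] \<beta> by (auto simp: N_def u_def A_def a_def l_def)
  have near: "norm (v x - v y) \<le> modulus a A (norm (x - y))"
    if v: "smooth_field \<beta> K v G" and xy: "norm (x - y) \<le> ?n" for v :: "real ^ 'n \<Rightarrow> real ^ 'n" and G and x y :: "real ^ 'n"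
  proof (cases "x = y")
    case False
    define r where "r = norm (x - y)"
    have r: "r > 0" using False by (simp add: r_def)
    define J where "J = max 1 (N * K / (u * r ^ CARD('n)))"
    have em: "emeasure lborel (cball x r) = ennreal (u * r ^ CARD('n))"
      using emeasure_cball[of r x] r by (simp add: u_def)
    have "(\<integral>\<^sup>+z\<in>cball x r. ennreal (exp (\<beta> * norm (G z))) \<partial>lborel) \<le> ennreal (N * K)"
      using smooth_field_cball[OF v, of r x] xy by (simp add: r_def N_def)
    also have "N * K \<le> J * (u * r ^ CARD('n))"
      using r pos by (simp add: J_def max_def field_simps)
    finally have J: "(\<integral>\<^sup>+z\<in>cball x r. ennreal (exp (\<beta> * norm (G z))) \<partial>lborel) \<le> ennreal J * emeasure lborel (cball x r)"
      using em r pos K by (simp add: ennreal_mult J_def ennreal_leI)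
    have "norm (v x - v y) \<le> 4 * r / \<beta> * (ln J + 4 * CARD('n) + 1)"
      by (rule Morrey[OF _ _ \<beta> r _ _ _ J]) (use v r in \<open>auto simp: smooth_field_def J_def r_def dist_norm\<close>)
    also have "\<dots> \<le> 4 * r / \<beta> * ((l + ?n * max 0 (- ln r)) + 4 * CARD('n) + 1)"
    proof (intro mult_left_mono add_mono order_refl)
      have "ln J = max 0 (ln (N * K / u) - ?n * ln r)"
      proof -
        have "ln (N * K / (u * r ^ CARD('n))) = ln (N * K / u) - ?n * ln r"
          using pos K r by (simp add: ln_div ln_mult ln_realpow)
        moreover have "ln J = max 0 (ln (N * K / (u * r ^ CARD('n))))"
          using pos K r unfolding J_def by (auto simp: max_def)
        ultimately show ?thesis by simp
      qed
      also have "\<dots> \<le> l + ?n * max 0 (- ln r)"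
      proof -
        have "- (?n * ln r) \<le> ?n * max 0 (- ln r)" by (metis max.cobounded2 mult_left_mono mult_minus_right of_nat_0_le_iff)
        moreover have "ln (N * K / u) \<le> l" "0 \<le> ?n * max 0 (- ln r)" by (auto simp: l_def)
        ultimately show ?thesis using pos by linarith
      qed
      finally show "ln J \<le> l + ?n * max 0 (- ln r)" .
    qed (use r \<beta> in auto)
    also have "\<dots> = modulus a A r" by (simp add: modulus_def a_def A_def algebra_simps add_divide_distrib)
    finally show ?thesis by (simp add: r_def)
  qed (simp add: modulus_def)
  show thesis
  proof (rule that[of "a + A" A])
    fix v :: "real ^ 'n \<Rightarrow> real ^ 'n" and G and x y :: "real ^ 'n" assume v: "smooth_field \<beta> K v G"
    obtain z where z: "z - y \<in> int_lattice" "norm (x - z) \<le> ?n" "norm (x - z) \<le> norm (x - y)"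
      by (rule nearby_translate[where x=x and y=y])
    have "periodic v" using v by (simp add: smooth_field_def)
    then have vz: "v z = v y" by (rule periodic_translate[OF _ z(1)])
    show "norm (v x - v y) \<le> modulus (a + A) A (norm (x - y))"
    proof (cases "norm (x - y) \<le> ?n")
      case True
      have "norm (v x - v y) \<le> modulus a A (norm (x - y))" by (rule near[OF v True])
      also have "\<dots> \<le> modulus (a + A) A (norm (x - y))" using pos by (auto simp: modulus_def intro!: mult_left_mono)
      finally show ?thesis .
    next
      case False
      let ?r = "norm (x - z)"
      have "norm (v x - v y) \<le> modulus a A ?r" using near[OF v z(2)] vz by simp
      also have "\<dots> = ?r * a + A * (?r * max 0 (- ln ?r))" by (simp add: modulus_def algebra_simps)
      also have "\<dots> \<le> norm (x - y) * a + A * 1"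
        using z(3) pos mult_max_ln_le_one[of ?r] by (intro add_mono mult_left_mono mult_right_mono) auto
      also have "\<dots> \<le> norm (x - y) * a + A * norm (x - y)" 
      proof -
        have "1 \<le> norm (x - y)" using False pos(6) by linarith
        then show ?thesis using pos by (intro add_mono mult_left_mono order_refl) auto
      qed
      also have "\<dots> \<le> modulus (a + A) A (norm (x - y))"
        using pos by (simp add: modulus_def algebra_simps)
      finally show ?thesis .
    qed
  qed (use pos in auto)
qed

text \<open>The quotient at y = x is 0 / 0 = 0, so the supremum is never negative.\<close>

definition lip_at :: "(real ^ 'n::finite \<Rightarrow> real ^ 'n) \<Rightarrow> real ^ 'n \<Rightarrow> real" where
  "lip_at v x = (SUP y. norm (v x - v y) / norm (x - y))"

lemma field_Lipschitz:
  fixes v :: "real ^ 'n::finite \<Rightarrow> real ^ 'n"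
  assumes der: "\<And>x. (v has_derivative (\<lambda>h. G x *v h)) (at x)" and C: "\<And>x. norm (G x) \<le> C"
  shows "norm (v x - v y) \<le> C * norm (x - y)"
proof (rule differentiable_bound[OF convex_UNIV])
  fix x
  show "onorm ((*v) (G x)) \<le> C"
  proof (rule onorm_le)
    fix h have "norm (G x *v h) \<le> norm (G x) * norm h" by (rule norm_matrix_vector_le)
    also have "\<dots> \<le> C * norm h" using C by (intro mult_right_mono) auto
    finally show "norm (G x *v h) \<le> C * norm h" .
  qed
qed (use der in auto)

context
  fixes v :: "real ^ 'n::finite \<Rightarrow> real ^ 'n" and C :: real
  assumes lip: "\<And>x y. norm (v x - v y) \<le> C * norm (x - y)"
begin

lemma quot_le: "norm (v x - v y) / norm (x - y) \<le> max 0 C"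
proof (cases "x = y")
  case False
  then have "norm (v x - v y) / norm (x - y) \<le> C" using lip[of x y] by (simp add: divide_simps)
  then show ?thesis by simp
qed simp

lemma lip_at_bdd: "bdd_above (range (\<lambda>y. norm (v x - v y) / norm (x - y)))"
  using quot_le by (auto intro!: bdd_aboveI)

lemma lip_at_nonneg: "lip_at v x \<ge> 0"
  unfolding lip_at_def using cSUP_upper[OF UNIV_I lip_at_bdd, of x x] by simp

lemma lip_at_le: "lip_at v x \<le> max 0 C"
  unfolding lip_at_def using quot_le by (intro cSUP_least) auto

lemma lip_at_bound: "norm (v x - v y) \<le> lip_at v x * norm (x - y)"
proof (cases "x = y")
  case False
  have "norm (v x - v y) / norm (x - y) \<le> lip_at v x"
    unfolding lip_at_def by (rule cSUP_upper[OF UNIV_I lip_at_bdd])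
  then show ?thesis using False by (simp add: divide_simps)
qed simp

lemma lip_at_greater_iff: "s \<ge> 0 \<Longrightarrow> s < lip_at v x \<longleftrightarrow> (\<exists>y. s * norm (x - y) < norm (v x - v y))"
proof -
  assume s: "s \<ge> 0"
  have "s < lip_at v x \<longleftrightarrow> (\<exists>y. s < norm (v x - v y) / norm (x - y))"
    unfolding lip_at_def by (subst less_cSUP_iff) (auto intro: lip_at_bdd)
  also have "\<dots> \<longleftrightarrow> (\<exists>y. s * norm (x - y) < norm (v x - v y))"
  proof (intro ex_cong1)
    fix y
    show "(s < norm (v x - v y) / norm (x - y)) = (s * norm (x - y) < norm (v x - v y))"
      using s by (cases "x = y") (auto simp: pos_less_divide_eq)
  qed
  finally show ?thesis .
qed

text \<open>The set where lip_at v exceeds s is a union over y of open sets: lip_at v is lower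
  semicontinuous.\<close>

lemma lip_at_measurable: "lip_at v \<in> borel_measurable borel"
proof -
  have cv: "continuous_on UNIV v"
  proof (rule continuous_on_iff[THEN iffD2], safe)
    fix x and e :: real assume e: "e > 0"
    have "dist (v y) (v x) < e" if "dist y x < e / (\<bar>C\<bar> + 1)" for y
    proof -
      have "dist (v y) (v x) \<le> C * dist y x" using lip[of y x] by (simp add: dist_norm)
      also have "\<dots> \<le> (\<bar>C\<bar> + 1) * dist y x" by (intro mult_right_mono) auto
      also have "\<dots> < e" using that by (simp add: pos_less_divide_eq mult.commute)
      finally show ?thesis .
    qed
    then show "\<exists>d>0. \<forall>x'\<in>UNIV. dist x' x < d \<longrightarrow> dist (v x') (v x) < e"
      using e by (intro exI[of _ "e / (\<bar>C\<bar> + 1)"]) auto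
  qed
  show ?thesis
  proof (rule borel_measurable_iff_greater[THEN iffD2], rule allI)
    fix s
    show "{x \<in> space borel. s < lip_at v x} \<in> sets borel"
    proof (cases "s < 0")
      case True
      then have "{x \<in> space borel. s < lip_at v x} = UNIV" using lip_at_nonneg less_le_trans by auto
      then show ?thesis by simp
    next
      case False
      then have "{x \<in> space borel. s < lip_at v x} = (\<Union>y. {x. s * norm (x - y) < norm (v x - v y)})"
        using lip_at_greater_iff by auto
      moreover have "open (\<Union>y. {x. s * norm (x - y) < norm (v x - v y)})"
        by (intro open_UN ballI open_Collect_less continuous_intros cv)
      ultimately show ?thesis by simp
    qed
  qed
qed

end

lemma lip_at_periodic:
  fixes v :: "real ^ 'n::finite \<Rightarrow> real ^ 'n"
  assumes "periodic v" shows "periodic (lip_at v)"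
  unfolding periodic_def
proof safe
  fix x k :: "real ^ 'n" assume k: "k \<in> int_lattice"
  have "range (\<lambda>y. norm (v (x + k) - v y) / norm (x + k - y)) = range (\<lambda>y. norm (v x - v y) / norm (x - y))"
  proof (intro equalityI subsetI; elim rangeE)
    fix q y assume "q = norm (v (x + k) - v y) / norm (x + k - y)"
    moreover have "v (x + k) = v x" "v (y - k) = v y" "x + k - y = x - (y - k)"
      using periodicD[OF assms k] periodic_diff[OF assms k] by auto
    ultimately have "q = norm (v x - v (y - k)) / norm (x - (y - k))" by simp
    then show "q \<in> range (\<lambda>y. norm (v x - v y) / norm (x - y))" by blast
  next
    fix q y assume "q = norm (v x - v y) / norm (x - y)"
    then have "q = norm (v (x + k) - v (y + k)) / norm (x + k - (y + k))"
      using periodicD[OF assms k] by simp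
    then show "q \<in> range (\<lambda>y. norm (v (x + k) - v y) / norm (x + k - y))" by blast
  qed
  then show "lip_at v (x + k) = lip_at v x" by (simp add: lip_at_def)
qed

text \<open>The Hardy-Littlewood maximal inequality. By Vitali's lemma S is covered by the fivefold
  enlargements of countably many disjoint balls on which the mean of F exceeds s; the total measure of
  the disjoint balls is at most 1/s times the integral of F over a ball about the origin that
  contains them all.\<close>

lemma maximal_weak_type:
  fixes F :: "real ^ 'n::finite \<Rightarrow> ennreal"
  assumes F[measurable]: "F \<in> borel_measurable borel" and per: "periodic F"
    and S[measurable]: "S \<in> sets borel" and Sc: "S \<subseteq> cube" and s: "s > 0"
    and avg: "\<And>x. x \<in> S \<Longrightarrow> \<exists>R. 0 < R \<and> R \<le> real CARD('n) \<and>
        ennreal s * emeasure lborel (cball x R) < (\<integral>\<^sup>+z\<in>cball x R. F z \<partial>lborel)"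
  shows "emeasure lborel S \<le> ennreal (5 ^ CARD('n) * real (card (int_lattice \<inter> cball (0 :: real ^ 'n) (2 * (2 * real CARD('n))))) / s)
     * (\<integral>\<^sup>+z\<in>cube. F z \<partial>lborel)"
proof -
  let ?n = "real CARD('n)"
  obtain R where R: "\<And>x. x \<in> S \<Longrightarrow> 0 < R x \<and> R x \<le> ?n" 
    and RF: "\<And>x. x \<in> S \<Longrightarrow> ennreal s * emeasure lborel (cball x (R x)) < (\<integral>\<^sup>+z\<in>cball x (R x). F z \<partial>lborel)"
    using avg by metis
  have "S \<subseteq> (\<Union>i\<in>S. cball i (R i))" using R by (force simp: less_imp_le)
  then obtain D where D: "countable D" "D \<subseteq> S" "pairwise (\<lambda>i j. disjnt (cball i (R i)) (cball j (R j))) D"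
     "S \<subseteq> (\<Union>i\<in>D. cball i (5 * R i))"
    by (rule Vitali_covering_lemma_cballs[where r = R and a = "\<lambda>x. x" and B = ?n, OF _ R])
  have "emeasure lborel S = (\<integral>\<^sup>+x. indicator S x \<partial>lborel)" by simp
  also have "\<dots> \<le> (\<integral>\<^sup>+x. (\<integral>\<^sup>+i. indicator (cball i (5 * R i)) x \<partial>count_space D) \<partial>lborel)"
  proof (rule nn_integral_mono)
    fix x
    show "indicator S x \<le> (\<integral>\<^sup>+i. indicator (cball i (5 * R i)) x \<partial>count_space D)"
    proof (cases "x \<in> S")
      case True
      then obtain i where i: "i \<in> D" "x \<in> cball i (5 * R i)" using D(4) by blast
      have "(1::ennreal) = (\<integral>\<^sup>+j. indicator {i} j \<partial>count_space D)" using i by simp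
      also have "\<dots> \<le> (\<integral>\<^sup>+i. indicator (cball i (5 * R i)) x \<partial>count_space D)"
        using i(2) by (intro nn_integral_mono) (auto simp: indicator_def)
      finally show ?thesis using True by simp
    qed simp
  qed
  also have "\<dots> = (\<integral>\<^sup>+i. (\<integral>\<^sup>+x. indicator (cball i (5 * R i)) x \<partial>lborel) \<partial>count_space D)"
    using D(1) by (intro nn_integral_count_space_nn_integral) auto
  also have "\<dots> \<le> (\<integral>\<^sup>+i. ennreal (5 ^ CARD('n) / s) * (\<integral>\<^sup>+x. F x * indicator (cball i (R i)) x \<partial>lborel) \<partial>count_space D)"
  proof (rule nn_integral_mono)
    fix i assume "i \<in> space (count_space D)"
    then have i: "i \<in> S" using D by auto
    have Ri: "R i > 0" using R[OF i] by simp
    have "(\<integral>\<^sup>+x. indicator (cball i (5 * R i)) x \<partial>lborel) = ennreal (5 ^ CARD('n)) * emeasure lborel (cball i (R i))"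
      using Ri by (simp add: emeasure_cball power_mult_distrib ennreal_mult[symmetric] mult_ac)
    also have "\<dots> = ennreal (5 ^ CARD('n) / s) * (ennreal s * emeasure lborel (cball i (R i)))"
      using s by (simp add: mult.assoc[symmetric] ennreal_mult[symmetric])
    also have "\<dots> \<le> ennreal (5 ^ CARD('n) / s) * (\<integral>\<^sup>+z\<in>cball i (R i). F z \<partial>lborel)"
      using RF[OF i] by (intro mult_left_mono) auto
    finally show "(\<integral>\<^sup>+x. indicator (cball i (5 * R i)) x \<partial>lborel) \<le> ennreal (5 ^ CARD('n) / s) * (\<integral>\<^sup>+z\<in>cball i (R i). F z \<partial>lborel)" .
  qed
  also have "\<dots> = ennreal (5 ^ CARD('n) / s) * (\<integral>\<^sup>+i. (\<integral>\<^sup>+x. F x * indicator (cball i (R i)) x \<partial>lborel) \<partial>count_space D)"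
    by (rule nn_integral_cmult) simp
  also have "(\<integral>\<^sup>+i. (\<integral>\<^sup>+x. F x * indicator (cball i (R i)) x \<partial>lborel) \<partial>count_space D)
      = (\<integral>\<^sup>+x. (\<integral>\<^sup>+i. F x * indicator (cball i (R i)) x \<partial>count_space D) \<partial>lborel)"
    using D(1) by (intro nn_integral_count_space_nn_integral[symmetric]) auto
  also have "\<dots> \<le> (\<integral>\<^sup>+x\<in>cball 0 (2 * ?n). F x \<partial>lborel)"
  proof (rule nn_integral_mono)
    fix x
    show "(\<integral>\<^sup>+i. F x * indicator (cball i (R i)) x \<partial>count_space D) \<le> F x * indicator (cball 0 (2 * ?n)) x"
    proof (cases "\<exists>i\<in>D. x \<in> cball i (R i)")
      case True
      then obtain i where i: "i \<in> D" "x \<in> cball i (R i)" by blast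
      have "(\<integral>\<^sup>+i. F x * indicator (cball i (R i)) x \<partial>count_space D) = F x * indicator (cball i (R i)) x"
      proof (rule nn_integral_one_point[OF i(1)])
        fix j assume "j \<in> D" "j \<noteq> i"
        then have "x \<notin> cball j (R j)" using D(3) i unfolding pairwise_def disjnt_def by blast
        then show "F x * indicator (cball j (R j)) x = 0" by simp
      qed
      moreover have "x \<in> cball 0 (2 * ?n)"
      proof -
        have "i \<in> S" using i D by auto
        then have "norm i \<le> ?n" "R i \<le> ?n" using Sc norm_cube R by auto
        moreover have "norm x \<le> norm i + dist i x" using norm_triangle_ineq[of i "x - i"] by (simp add: dist_norm norm_minus_commute)
        ultimately show ?thesis using i by simp
      qed
      ultimately show ?thesis using i by simp
    next
      case False
      then have "(\<integral>\<^sup>+i. F x * indicator (cball i (R i)) x \<partial>count_space D) = (\<integral>\<^sup>+i. 0 \<partial>count_space D)"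
        by (intro nn_integral_cong) auto
      then show ?thesis by simp
    qed
  qed
  also have "\<dots> \<le> of_nat (card (int_lattice \<inter> cball (0 :: real ^ 'n) (2 * (2 * ?n)))) * (\<integral>\<^sup>+x\<in>cube. F x \<partial>lborel)"
    by (rule nn_integral_cball_periodic[OF F per])
  finally have "emeasure lborel S \<le> ennreal (5 ^ CARD('n) / s) *
     (of_nat (card (int_lattice \<inter> cball (0 :: real ^ 'n) (2 * (2 * ?n)))) * (\<integral>\<^sup>+x\<in>cube. F x \<partial>lborel))"
    by (simp add: mult_left_mono)
  also have "\<dots> = ennreal (5 ^ CARD('n) * real (card (int_lattice \<inter> cball (0 :: real ^ 'n) (2 * (2 * ?n)))) / s) * (\<integral>\<^sup>+z\<in>cube. F z \<partial>lborel)"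
    using s by (simp add: mult.assoc[symmetric] ennreal_of_nat_eq_real_of_nat ennreal_mult[symmetric])
  finally show ?thesis .
qed

text \<open>Decompose along the levels 4^k: where 4^k < H \<le> 4^(k+1) the root is at most 2^(k+1), and
  the sum of 2^(k+1) D / 4^k is 4 D.\<close>

lemma weak_type_sqrt:
  fixes H :: "'a \<Rightarrow> real"
  assumes [measurable]: "H \<in> borel_measurable M" "A \<in> sets M" and D: "D \<ge> 0"
    and A: "emeasure M A \<le> 1"
    and weak: "\<And>k::nat. emeasure M {x\<in>space M. x \<in> A \<and> 4 ^ k < H x} \<le> ennreal (D / 4 ^ k)"
  shows "(\<integral>\<^sup>+x\<in>A. ennreal (sqrt (H x)) \<partial>M) \<le> ennreal (1 + 4 * D)"
proof -
  let ?S = "\<lambda>k::nat. {x\<in>space M. x \<in> A \<and> 4 ^ k < H x}"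
  have "(\<integral>\<^sup>+x\<in>A. ennreal (sqrt (H x)) \<partial>M) \<le> (\<integral>\<^sup>+x. indicator A x + (\<Sum>k. ennreal (2 ^ Suc k) * indicator (?S k) x) \<partial>M)"
  proof (rule nn_integral_mono)
    fix x assume x: "x \<in> space M"
    show "ennreal (sqrt (H x)) * indicator A x \<le> indicator A x + (\<Sum>k. ennreal (2 ^ Suc k) * indicator (?S k) x)"
    proof (cases "x \<in> A \<and> H x > 1")
      case False
      then have "x \<in> A \<Longrightarrow> ennreal (sqrt (H x)) \<le> 1" by (simp add: ennreal_le_1)
      then have "ennreal (sqrt (H x)) * indicator A x \<le> indicator A x" by (auto simp: indicator_def)
      then show ?thesis by (rule order_trans) simp
    next
      case True
      have "\<exists>m::nat. H x \<le> 4 ^ m" using real_arch_pow[of 4 "H x"] less_imp_le by fastforce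
      then obtain m where m: "H x \<le> 4 ^ m" "\<And>j. j < m \<Longrightarrow> \<not> H x \<le> 4 ^ j" 
        using exists_least_iff[of "\<lambda>m. H x \<le> 4 ^ m"] by blast
      obtain k where k: "m = Suc k" using m True by (cases m) auto
      have "sqrt (H x) \<le> sqrt (4 ^ m)" using m by simp
      also have "sqrt (4 ^ m) = 2 ^ m" by (simp add: real_sqrt_power)
      finally have "ennreal (sqrt (H x)) \<le> ennreal (2 ^ Suc k) * indicator (?S k) x"
        using m(2)[of k] k True x by (auto simp: indicator_def intro: ennreal_leI)
      also have "\<dots> \<le> (\<Sum>k. ennreal (2 ^ Suc k) * indicator (?S k) x)"
      proof -
        define f where "f = (\<lambda>k. ennreal (2 ^ Suc k) * indicator (?S k) x)"
        have "sum f {k} \<le> suminf f" by (rule sum_le_suminf) auto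
        then have "f k \<le> suminf f" by simp
        then show ?thesis by (simp only: f_def)
      qed
      finally show ?thesis using True by (simp add: add_increasing)
    qed
  qed
  also have "\<dots> = emeasure M A + (\<Sum>k. ennreal (2 ^ Suc k) * emeasure M (?S k))"
    by (simp add: nn_integral_add nn_integral_suminf nn_integral_cmult)
  also have "\<dots> \<le> 1 + (\<Sum>k. ennreal (2 * D * (1/2) ^ k))"
  proof (intro add_mono A suminf_le allI)
    fix k :: nat
    have "ennreal (2 ^ Suc k) * emeasure M (?S k) \<le> ennreal (2 ^ Suc k) * ennreal (D / 4 ^ k)"
      by (intro mult_left_mono weak) auto
    also have "\<dots> = ennreal (2 * D * (1/2) ^ k)"
    proof -
      have "(4::real) ^ k = 2 ^ k * 2 ^ k" by (simp add: power_mult_distrib[symmetric])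
      then show ?thesis using D by (simp add: ennreal_mult[symmetric] power_divide field_simps)
    qed
    finally show "ennreal (2 ^ Suc k) * emeasure M (?S k) \<le> ennreal (2 * D * (1/2) ^ k)" .
  qed auto
  also have "(\<Sum>k. ennreal (2 * D * (1/2) ^ k)) = ennreal (4 * D)"
  proof (rule suminf_ennreal_eq)
    show "(\<lambda>k. 2 * D * (1/2) ^ k) sums (4 * D)"
      using sums_mult[OF geometric_sums[of "1/2::real"], of "2 * D"] by simp
  qed (use D in auto)
  also have "1 + ennreal (4 * D) = ennreal (1 + 4 * D)" using D by (simp flip: ennreal_1 ennreal_plus)
  finally show ?thesis .
qed

definition lip_const :: "'n::finite itself \<Rightarrow> real" where
  "lip_const _ = exp (2 * real CARD('n) + 1/2) * 
     (1 + 4 * (5 ^ CARD('n) * real (card (int_lattice \<inter> cball (0 :: real ^ 'n) (2 * (2 * real CARD('n)))))))"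

lemma lip_const_pos: "lip_const TYPE('n::finite) > 0"
  by (simp add: lip_const_def add_pos_nonneg)

text \<open>If lip_at v x is large, then by Morrey's inequality some ball about x has a large mean of exp(\<beta>|G|).
  So H = exp(\<beta>/4 lip_at v - 4 n - 1) is dominated by a maximal function and of weak type 1; its
  square root is integrable. This is where the exponent drops from \<beta>/4 to \<beta>/8.\<close>

lemma exp_lip_at_integral:
  fixes v :: "real ^ 'n::finite \<Rightarrow> real ^ 'n"
  assumes v: "smooth_field \<beta> K v G" and C: "\<And>x. norm (G x) \<le> C" and \<beta>: "\<beta> > 0" and K: "K \<ge> 1"
  shows "(\<integral>\<^sup>+x\<in>cube. ennreal (exp (\<beta> / 8 * lip_at v x)) \<partial>lborel) \<le> ennreal (lip_const TYPE('n) * K)"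
proof -
  let ?n = "real CARD('n)"
  define N where "N = 5 ^ CARD('n) * real (card (int_lattice \<inter> cball (0 :: real ^ 'n) (2 * (2 * ?n))))"
  have N: "N \<ge> 0" by (simp add: N_def)
  have der: "\<And>x. (v has_derivative (\<lambda>h. G x *v h)) (at x)" and cont: "continuous_on UNIV G"
    and per: "periodic v" "periodic G" using v by (auto simp: smooth_field_def)
  note lip = field_Lipschitz[OF der C]
  have [measurable]: "lip_at v \<in> borel_measurable borel" by (rule lip_at_measurable[OF lip])
  have [measurable]: "G \<in> borel_measurable borel" using cont by (rule borel_measurable_continuous_onI)
  define H where "H = (\<lambda>x. exp (\<beta> / 4 * lip_at v x - (4 * ?n + 1)))"
  have [measurable]: "H \<in> borel_measurable borel" unfolding H_def by measurable
  have sq: "exp (\<beta> / 8 * lip_at v x) = exp (2 * ?n + 1/2) * sqrt (H x)" for x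
  proof -
    have "sqrt (H x) = exp ((\<beta> / 4 * lip_at v x - (4 * ?n + 1)) / 2)"
      unfolding H_def by (rule real_sqrt_unique) (auto simp flip: exp_double)
    then show ?thesis by (simp flip: exp_add add: field_simps)
  qed
  have weak: "emeasure lborel {x\<in>space lborel. x \<in> cube \<and> 4 ^ k < H x} \<le> ennreal (N * K / 4 ^ k)" for k :: nat
  proof -
    have "emeasure lborel {x\<in>space lborel. x \<in> cube \<and> 4 ^ k < H x} \<le> 
      ennreal (N / 4 ^ k) * (\<integral>\<^sup>+z\<in>cube. ennreal (exp (\<beta> * norm (G z))) \<partial>lborel)"
      unfolding N_def
    proof (rule maximal_weak_type)
      show "periodic (\<lambda>z. ennreal (exp (\<beta> * norm (G z))))" using per by (auto simp: periodic_def)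
      fix x assume "x \<in> {x\<in>space lborel. x \<in> cube \<and> 4 ^ k < H x}"
      then have "4 ^ k < H x" by simp
      then have "ln (4 ^ k) < \<beta> / 4 * lip_at v x - (4 * ?n + 1)"
        unfolding H_def by (subst (asm) ln_less_cancel_iff[symmetric]) auto
      then have "4 / \<beta> * (ln (4 ^ k) + 4 * ?n + 1) < lip_at v x"
        using \<beta> by (simp add: field_simps)
      moreover have nn: "4 / \<beta> * (ln (4 ^ k) + 4 * ?n + 1) \<ge> 0" using \<beta> by (intro mult_nonneg_nonneg add_nonneg_nonneg) auto
      ultimately obtain y where y: "4 / \<beta> * (ln (4 ^ k) + 4 * ?n + 1) * norm (x - y) < norm (v x - v y)"
        using lip_at_greater_iff[OF lip] by blast
      obtain z where z: "z - y \<in> int_lattice" "norm (x - z) \<le> ?n" "norm (x - z) \<le> norm (x - y)"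
        by (rule nearby_translate[where x=x and y=y])
      have vz: "v z = v y" by (rule periodic_translate[OF per(1) z(1)])
      let ?R = "norm (x - z)"
      have "4 / \<beta> * (ln (4 ^ k) + 4 * ?n + 1) * ?R \<le> 4 / \<beta> * (ln (4 ^ k) + 4 * ?n + 1) * norm (x - y)"
        using nn z by (intro mult_left_mono) auto
      then have "4 / \<beta> * (ln (4 ^ k) + 4 * ?n + 1) * ?R < norm (v x - v z)" unfolding vz by (rule le_less_trans[OF _ y])
      then have less: "4 * ?R / \<beta> * (ln (4 ^ k) + 4 * ?n + 1) < norm (v x - v z)"
      proof -
        have eq: "4 / \<beta> * W * r = 4 * r / \<beta> * W" for W r :: real by simp
        assume "4 / \<beta> * (ln (4 ^ k) + 4 * ?n + 1) * ?R < norm (v x - v z)"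
        then show ?thesis unfolding eq .
      qed
      have R: "?R > 0" using less by (cases "x = z") auto
      have "ennreal (4 ^ k) * emeasure lborel (cball x ?R) < (\<integral>\<^sup>+z\<in>cball x ?R. ennreal (exp (\<beta> * norm (G z))) \<partial>lborel)"
      proof (rule ccontr)
        assume "\<not> ?thesis"
        then have le: "(\<integral>\<^sup>+z\<in>cball x ?R. ennreal (exp (\<beta> * norm (G z))) \<partial>lborel) \<le> ennreal (4 ^ k) * emeasure lborel (cball x ?R)"
          by (simp only: not_less)
        have "norm (v x - v z) \<le> 4 * ?R / \<beta> * (ln (4 ^ k) + 4 * CARD('n) + 1)"
          by (rule Morrey[OF der cont \<beta> R _ _ _ le]) (auto simp: dist_norm)
        then show False using less by simp
      qed
      then show "\<exists>R. 0 < R \<and> R \<le> ?n \<and> ennreal (4 ^ k) * emeasure lborel (cball x R) < (\<integral>\<^sup>+z\<in>cball x R. ennreal (exp (\<beta> * norm (G z))) \<partial>lborel)"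
        using R z(2) by blast
    qed auto
    also have "\<dots> \<le> ennreal (N / 4 ^ k) * ennreal K"
      using v by (intro mult_left_mono) (auto simp: smooth_field_def)
    also have "\<dots> = ennreal (N * K / 4 ^ k)" using N K by (simp add: ennreal_mult[symmetric])
    finally show ?thesis .
  qed
  have "(\<integral>\<^sup>+x\<in>cube. ennreal (exp (\<beta> / 8 * lip_at v x)) \<partial>lborel) = ennreal (exp (2 * ?n + 1/2)) * (\<integral>\<^sup>+x\<in>cube. ennreal (sqrt (H x)) \<partial>lborel)"
    unfolding sq by (subst nn_integral_cmult[symmetric]) (auto simp: ennreal_mult H_def mult.assoc)
  also have "\<dots> \<le> ennreal (exp (2 * ?n + 1/2)) * ennreal (1 + 4 * (N * K))"
    using N K weak by (intro mult_left_mono weak_type_sqrt) (auto simp: emeasure_cube)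
  also have "\<dots> = ennreal (exp (2 * ?n + 1/2) * (1 + 4 * (N * K)))" using N K by (simp add: ennreal_mult)
  also have "\<dots> \<le> ennreal (lip_const TYPE('n) * K)"
  proof (rule ennreal_leI)
    have "1 + 4 * (N * K) \<le> (1 + 4 * N) * K" using K N by (simp add: algebra_simps)
    then have "exp (2 * ?n + 1/2) * (1 + 4 * (N * K)) \<le> exp (2 * ?n + 1/2) * ((1 + 4 * N) * K)" by (intro mult_left_mono) auto
    then show "exp (2 * ?n + 1/2) * (1 + 4 * (N * K)) \<le> lip_const TYPE('n) * K"
      by (simp add: lip_const_def N_def mult.assoc)
  qed
  finally show ?thesis .
qed


section \<open>Trigonometric polynomials and a concentrating kernel\<close>

text \<open>Trigonometric polynomials are closed under partial derivatives, products and reflections, so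
  their smoothness and periodicity follow by induction.\<close>

inductive trig :: "(real ^ 'n::finite \<Rightarrow> real) \<Rightarrow> bool" where
  trig_const: "trig (\<lambda>x. c)"
| trig_cos: "trig (\<lambda>x. cos (2 * pi * x $ i))"
| trig_sin: "trig (\<lambda>x. sin (2 * pi * x $ i))"
| trig_add: "trig f \<Longrightarrow> trig g \<Longrightarrow> trig (\<lambda>x. f x + g x)"
| trig_mult: "trig f \<Longrightarrow> trig g \<Longrightarrow> trig (\<lambda>x. f x * g x)"

lemma trig_cmult: "trig f \<Longrightarrow> trig (\<lambda>x. c * f x)"
  by (intro trig_mult trig_const)

lemma trig_power: "trig f \<Longrightarrow> trig (\<lambda>x. f x ^ k)"
  by (induction k) (simp_all add: trig_const trig_mult)

lemma trig_prod: "finite I \<Longrightarrow> (\<And>i. i \<in> I \<Longrightarrow> trig (f i)) \<Longrightarrow> trig (\<lambda>x. \<Prod>i\<in>I. f i x)"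
  by (induction I rule: finite_induct) (simp_all add: trig_const trig_mult)

lemma trig_reflect: "trig f \<Longrightarrow> trig (\<lambda>z. f (y - z))"
proof (induction rule: trig.induct)
  case (trig_cos i)
  have "cos (2 * pi * (y - z) $ i) = cos (2 * pi * y $ i) * cos (2 * pi * z $ i) + sin (2 * pi * y $ i) * sin (2 * pi * z $ i)" for z
    by (simp add: right_diff_distrib cos_diff)
  then show ?case by (simp add: trig.intros)
next
  case (trig_sin i)
  have "sin (2 * pi * (y - z) $ i) = sin (2 * pi * y $ i) * cos (2 * pi * z $ i) + (- cos (2 * pi * y $ i)) * sin (2 * pi * z $ i)" for z
    by (simp add: right_diff_distrib sin_diff)
  then show ?case unfolding \<open>\<And>z. sin (2 * pi * (y - z) $ i) = _ z\<close> by (intro trig.intros)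
qed (auto intro: trig.intros)

lemma trig_periodic: "trig f \<Longrightarrow> periodic f"
proof (induction rule: trig.induct)
  case (trig_cos i)
  show ?case unfolding periodic_def
  proof safe
    fix x k :: "real ^ 'a" assume "k \<in> int_lattice"
    then obtain m where "k $ i = of_int m" by (auto simp: int_lattice_def elim: Ints_cases)
    then have "2 * pi * (x + k) $ i = 2 * pi * x $ i + 2 * pi * of_int m" by (simp add: algebra_simps)
    then show "cos (2 * pi * (x + k) $ i) = cos (2 * pi * x $ i)"
      by (simp add: cos_add)
  qed
next
  case (trig_sin i)
  show ?case unfolding periodic_def
  proof safe
    fix x k :: "real ^ 'a" assume "k \<in> int_lattice"
    then obtain m where "k $ i = of_int m" by (auto simp: int_lattice_def elim: Ints_cases)
    then have "2 * pi * (x + k) $ i = 2 * pi * x $ i + 2 * pi * of_int m" by (simp add: algebra_simps)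
    then show "sin (2 * pi * (x + k) $ i) = sin (2 * pi * x $ i)"
      by (simp add: sin_add)
  qed
qed (auto simp: periodic_def)

lemma Taylor_quadratic_bound:
  fixes f :: "real \<Rightarrow> real"
  assumes der: "\<And>x. (f has_field_derivative f' x) (at x)" and lip: "\<And>x y. \<bar>f' x - f' y\<bar> \<le> \<bar>x - y\<bar>"
  shows "\<bar>f (a + t) - f a - f' a * t\<bar> \<le> t\<^sup>2"
proof -
  let ?S = "closed_segment a (a + t)"
  have "norm ((f (a + t) - f' a * (a + t)) - (f a - f' a * a)) \<le> \<bar>t\<bar> * norm ((a + t) - a)"
  proof (rule field_differentiable_bound[where S = ?S and f' = "\<lambda>x. f' x - f' a"])
    fix z assume z: "z \<in> ?S"
    show "((\<lambda>x. f x - f' a * x) has_field_derivative f' z - f' a) (at z within ?S)"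
      by (auto intro!: derivative_eq_intros has_field_derivative_at_within[OF der])
    have "\<bar>z - a\<bar> \<le> \<bar>t\<bar>" using segment_bound(1)[OF z] by simp
    then show "norm (f' z - f' a) \<le> \<bar>t\<bar>" using lip[of z a] by simp
  qed auto
  then show ?thesis by (simp add: algebra_simps power2_eq_square abs_mult[symmetric])
qed

lemma cos_sin_Lipschitz: "\<bar>cos x - cos y\<bar> \<le> \<bar>x - y\<bar>" "\<bar>sin x - sin y\<bar> \<le> \<bar>x - (y::real)\<bar>"
proof -
  show "\<bar>cos x - cos y\<bar> \<le> \<bar>x - y\<bar>"
    using field_differentiable_bound[of UNIV cos "\<lambda>x. - sin x" 1 x y] DERIV_cos by auto
  show "\<bar>sin x - sin y\<bar> \<le> \<bar>x - y\<bar>"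
    using field_differentiable_bound[of UNIV sin cos 1 x y] DERIV_sin by auto
qed

text \<open>D is the gradient of f with a remainder that is quadratic uniformly in x. The other bounds are
  included because the remainder of a product depends on them.\<close>

definition expandable :: "(real ^ 'n::finite \<Rightarrow> real) \<Rightarrow> (real ^ 'n \<Rightarrow> real ^ 'n) \<Rightarrow> real \<Rightarrow> bool" where
  "expandable f D B \<longleftrightarrow> (\<forall>x h. \<bar>f x\<bar> \<le> B \<and> norm (D x) \<le> B \<and> 
     \<bar>f (x + h) - f x\<bar> \<le> B * norm h \<and> \<bar>f (x + h) - f x - D x \<bullet> h\<bar> \<le> B * (norm h)\<^sup>2)"

lemma expandable_coordinate:
  fixes i :: "'n::finite"
  assumes der: "\<And>x. (f has_field_derivative f' x) (at x)" 
    and lip: "\<And>x y. \<bar>f x - f y\<bar> \<le> \<bar>x - y\<bar>" "\<And>x y. \<bar>f' x - f' y\<bar> \<le> \<bar>x - y\<bar>"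
    and bd: "\<And>x. \<bar>f x\<bar> \<le> 1" "\<And>x. \<bar>f' x\<bar> \<le> 1"
  shows "expandable (\<lambda>x :: real ^ 'n. f (2 * pi * x $ i)) (\<lambda>x. axis i (2 * pi * f' (2 * pi * x $ i))) (4 * pi\<^sup>2)"
  unfolding expandable_def
proof (intro allI conjI)
  fix x h :: "real ^ 'n"
  have pi: "1 \<le> 4 * pi\<^sup>2" "2 * pi \<le> 4 * pi\<^sup>2"
    using pi_gt3 mult_mono[of 1 pi 1 pi] by (auto simp: power2_eq_square)
  show "\<bar>f (2 * pi * x $ i)\<bar> \<le> 4 * pi\<^sup>2" using bd(1)[of "2 * pi * x $ i"] pi by linarith
  have "norm (axis i (2 * pi * f' (2 * pi * x $ i)) :: real ^ 'n) = 2 * pi * \<bar>f' (2 * pi * x $ i)\<bar>"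
  proof -
    have ax: "axis i c = c *\<^sub>R (axis i 1 :: real ^ 'n)" for c by (simp add: vec_eq_iff axis_def)
    show ?thesis by (subst ax) (simp add: abs_mult)
  qed
  also have "\<dots> \<le> 2 * pi * 1" by (intro mult_left_mono bd) auto
  finally show "norm (axis i (2 * pi * f' (2 * pi * x $ i)) :: real ^ 'n) \<le> 4 * pi\<^sup>2" using pi by linarith
  have hi: "\<bar>h $ i\<bar> \<le> norm h" by (rule component_le_norm_cart)
  have eq: "2 * pi * (x + h) $ i = 2 * pi * x $ i + 2 * pi * h $ i" by (simp add: algebra_simps)
  have "\<bar>f (2 * pi * (x + h) $ i) - f (2 * pi * x $ i)\<bar> \<le> 2 * pi * \<bar>h $ i\<bar>"
    unfolding eq using lip(1)[of "2 * pi * x $ i + 2 * pi * h $ i" "2 * pi * x $ i"] by (simp add: abs_mult)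
  also have "\<dots> \<le> 4 * pi\<^sup>2 * norm h" by (rule mult_mono[OF pi(2) hi]) auto
  finally show "\<bar>f (2 * pi * (x + h) $ i) - f (2 * pi * x $ i)\<bar> \<le> 4 * pi\<^sup>2 * norm h" .
  have "\<bar>f (2 * pi * (x + h) $ i) - f (2 * pi * x $ i) - axis i (2 * pi * f' (2 * pi * x $ i)) \<bullet> h\<bar> \<le> (2 * pi * h $ i)\<^sup>2"
    unfolding eq using Taylor_quadratic_bound[OF der lip(2), of "2 * pi * x $ i" "2 * pi * h $ i"] by (simp add: inner_axis' mult_ac)
  also have "\<dots> = 4 * pi\<^sup>2 * (h $ i)\<^sup>2" by (simp add: power_mult_distrib)
  also have "\<dots> \<le> 4 * pi\<^sup>2 * (norm h)\<^sup>2" using hi by (intro mult_left_mono) (auto simp: abs_le_square_iff[symmetric])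
  finally show "\<bar>f (2 * pi * (x + h) $ i) - f (2 * pi * x $ i) - axis i (2 * pi * f' (2 * pi * x $ i)) \<bullet> h\<bar> \<le> 4 * pi\<^sup>2 * (norm h)\<^sup>2" .
qed

lemma trig_axis: "trig f \<Longrightarrow> trig (\<lambda>x. axis i (f x) $ j)"
  by (cases "i = j") (auto simp: axis_def trig_const)

lemma trig_expansion:
  assumes "trig f"
  shows "\<exists>D B. (\<forall>j. trig (\<lambda>x. D x $ j)) \<and> expandable f D B"
  using assms
proof (induction rule: trig.induct)
  case (trig_const c)
  show ?case by (intro exI[of _ "\<lambda>x. 0"] exI[of _ "\<bar>c\<bar>"]) (simp add: trig.intros expandable_def)
next
  case (trig_cos i)
  have "expandable (\<lambda>x. cos (2 * pi * x $ i)) (\<lambda>x. axis i (2 * pi * - sin (2 * pi * x $ i))) (4 * pi\<^sup>2)"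
    by (rule expandable_coordinate) 
       (use cos_sin_Lipschitz in \<open>auto simp: abs_minus_commute\<close>)
  moreover have "trig (\<lambda>x. 2 * pi * - sin (2 * pi * x $ i))"
    using trig_cmult[OF trig.trig_sin, of "- (2 * pi)" i] by simp
  ultimately show ?case 
    by (intro exI[of _ "\<lambda>x. axis i (2 * pi * - sin (2 * pi * x $ i))"] exI[of _ "4 * pi\<^sup>2"] conjI allI trig_axis)
next
  case (trig_sin i)
  have "expandable (\<lambda>x. sin (2 * pi * x $ i)) (\<lambda>x. axis i (2 * pi * cos (2 * pi * x $ i))) (4 * pi\<^sup>2)"
    by (rule expandable_coordinate) (use cos_sin_Lipschitz in auto)
  moreover have "trig (\<lambda>x. 2 * pi * cos (2 * pi * x $ i))"
    using trig_cmult[OF trig.trig_cos, of "2 * pi" i] by simp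
  ultimately show ?case
    by (intro exI[of _ "\<lambda>x. axis i (2 * pi * cos (2 * pi * x $ i))"] exI[of _ "4 * pi\<^sup>2"] conjI allI trig_axis)
next
  case (trig_add f g)
  obtain D B where D: "\<And>j. trig (\<lambda>x. D x $ j)" "\<And>x. \<bar>f x\<bar> \<le> B" "\<And>x. norm (D x) \<le> B" 
     "\<And>x h. \<bar>f (x + h) - f x\<bar> \<le> B * norm h" "\<And>x h. \<bar>f (x + h) - f x - D x \<bullet> h\<bar> \<le> B * (norm h)\<^sup>2"
    using trig_add.IH(1) unfolding expandable_def by blast
  obtain E B' where E: "\<And>j. trig (\<lambda>x. E x $ j)" "\<And>x. \<bar>g x\<bar> \<le> B'" "\<And>x. norm (E x) \<le> B'" 
     "\<And>x h. \<bar>g (x + h) - g x\<bar> \<le> B' * norm h" "\<And>x h. \<bar>g (x + h) - g x - E x \<bullet> h\<bar> \<le> B' * (norm h)\<^sup>2"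
    using trig_add.IH(2) unfolding expandable_def by blast
  show ?case
  proof (rule exI[of _ "\<lambda>x. D x + E x"], rule exI[of _ "B + B'"], unfold expandable_def, intro conjI allI)
    fix j show "trig (\<lambda>x. (D x + E x) $ j)" using D(1) E(1) by (simp add: trig.trig_add)
  next
    fix x h
    show "\<bar>f x + g x\<bar> \<le> B + B'" using D(2)[of x] E(2)[of x] by linarith
    show "norm (D x + E x) \<le> B + B'" using D(3)[of x] E(3)[of x] norm_triangle_ineq[of "D x" "E x"] by linarith
    show "\<bar>f (x + h) + g (x + h) - (f x + g x)\<bar> \<le> (B + B') * norm h"
      using D(4)[of x h] E(4)[of x h] by (simp add: distrib_right)
    show "\<bar>f (x + h) + g (x + h) - (f x + g x) - (D x + E x) \<bullet> h\<bar> \<le> (B + B') * (norm h)\<^sup>2"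
      using D(5)[of x h] E(5)[of x h] by (simp add: distrib_right inner_add_left)
  qed
next
  case (trig_mult f g)
  obtain D B where D: "\<And>j. trig (\<lambda>x. D x $ j)" "\<And>x. \<bar>f x\<bar> \<le> B" "\<And>x. norm (D x) \<le> B" 
     "\<And>x h. \<bar>f (x + h) - f x\<bar> \<le> B * norm h" "\<And>x h. \<bar>f (x + h) - f x - D x \<bullet> h\<bar> \<le> B * (norm h)\<^sup>2"
    using trig_mult.IH(1) unfolding expandable_def by blast
  obtain E B' where E: "\<And>j. trig (\<lambda>x. E x $ j)" "\<And>x. \<bar>g x\<bar> \<le> B'" "\<And>x. norm (E x) \<le> B'" 
     "\<And>x h. \<bar>g (x + h) - g x\<bar> \<le> B' * norm h" "\<And>x h. \<bar>g (x + h) - g x - E x \<bullet> h\<bar> \<le> B' * (norm h)\<^sup>2"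
    using trig_mult.IH(2) unfolding expandable_def by blast
  have B: "B \<ge> 0" "B' \<ge> 0" using D(2)[of 0] E(2)[of 0] by auto
  show ?case
  proof (rule exI[of _ "\<lambda>x. g x *\<^sub>R D x + f x *\<^sub>R E x"], rule exI[of _ "3 * (B * B')"], unfold expandable_def, intro conjI allI)
    fix j show "trig (\<lambda>x. (g x *\<^sub>R D x + f x *\<^sub>R E x) $ j)" using D(1) E(1) trig_mult.hyps
      by (simp add: trig.trig_add trig.trig_mult)
  next
    fix x h
    show "\<bar>f x * g x\<bar> \<le> 3 * (B * B')"
      using mult_mono[OF D(2)[of x] E(2)[of x]] B by (simp add: abs_mult) (smt (verit) mult_nonneg_nonneg)
    have "norm (g x *\<^sub>R D x + f x *\<^sub>R E x) \<le> \<bar>g x\<bar> * norm (D x) + \<bar>f x\<bar> * norm (E x)"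
      using norm_triangle_ineq[of "g x *\<^sub>R D x" "f x *\<^sub>R E x"] by simp
    also have "\<dots> \<le> B' * B + B * B'" using B D E by (intro add_mono mult_mono) auto
    also have "\<dots> \<le> 3 * (B * B')" using B by simp
    finally show "norm (g x *\<^sub>R D x + f x *\<^sub>R E x) \<le> 3 * (B * B')" .
    have "\<bar>f (x + h) * g (x + h) - f x * g x\<bar> = \<bar>(f (x + h) - f x) * g (x + h) + f x * (g (x + h) - g x)\<bar>"
      by (simp add: algebra_simps)
    also have "\<dots> \<le> \<bar>f (x + h) - f x\<bar> * \<bar>g (x + h)\<bar> + \<bar>f x\<bar> * \<bar>g (x + h) - g x\<bar>"
      by (metis abs_mult abs_triangle_ineq)
    also have "\<dots> \<le> (B * norm h) * B' + B * (B' * norm h)"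
      using B D E by (intro add_mono mult_mono) auto
    also have "\<dots> \<le> 3 * (B * B') * norm h" using B by (simp add: mult_ac)
    finally show "\<bar>f (x + h) * g (x + h) - f x * g x\<bar> \<le> 3 * (B * B') * norm h" .
    have abs3: "\<bar>a + b + c\<bar> \<le> \<bar>a\<bar> + \<bar>b\<bar> + \<bar>c\<bar>" for a b c :: real by linarith
    have eq: "f (x + h) * g (x + h) - f x * g x - (g x *\<^sub>R D x + f x *\<^sub>R E x) \<bullet> h = 
      (f (x + h) - f x - D x \<bullet> h) * g (x + h) + f x * (g (x + h) - g x - E x \<bullet> h) + (D x \<bullet> h) * (g (x + h) - g x)"
      by (simp add: inner_add_left algebra_simps)
    have "\<bar>f (x + h) * g (x + h) - f x * g x - (g x *\<^sub>R D x + f x *\<^sub>R E x) \<bullet> h\<bar> \<le> \<bar>f (x + h) - f x - D x \<bullet> h\<bar> * \<bar>g (x + h)\<bar> + \<bar>f x\<bar> * \<bar>g (x + h) - g x - E x \<bullet> h\<bar> + \<bar>D x \<bullet> h\<bar> * \<bar>g (x + h) - g x\<bar>"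
      unfolding eq abs_mult[symmetric] by (rule abs3)
    also have "\<dots> \<le> (B * (norm h)\<^sup>2) * B' + B * (B' * (norm h)\<^sup>2) + (B * norm h) * (B' * norm h)"
    proof (intro add_mono mult_mono)
      show "\<bar>D x \<bullet> h\<bar> \<le> B * norm h"
        by (rule order_trans[OF Cauchy_Schwarz_ineq2[of "D x" h] mult_right_mono[OF D(3)[of x] norm_ge_zero[of h]]])
    qed (simp_all add: B D(2-5) E(2-5))
    also have "\<dots> = 3 * (B * B') * (norm h)\<^sup>2" by (simp add: power2_eq_square mult_ac)
    finally show "\<bar>f (x + h) * g (x + h) - f x * g x - (g x *\<^sub>R D x + f x *\<^sub>R E x) \<bullet> h\<bar> \<le> 3 * (B * B') * (norm h)\<^sup>2" .
  qed
qed

lemma has_derivative_quadratic: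
  fixes f :: "'a::real_normed_vector \<Rightarrow> 'b::real_normed_vector"
  assumes "bounded_linear L" and q: "\<And>h. norm (f (x + h) - f x - L h) \<le> B * (norm h)\<^sup>2"
  shows "(f has_derivative L) (at x)"
  unfolding has_derivative_at
proof (intro conjI assms(1))
  show "(\<lambda>h. norm (f (x + h) - f x - L h) / norm h) \<midarrow>0\<rightarrow> 0"
  proof (rule tendsto_sandwich[where f = "\<lambda>_. 0" and h = "\<lambda>h. B * norm h"])
    show "\<forall>\<^sub>F h in at 0. norm (f (x + h) - f x - L h) / norm h \<le> B * norm h"
    proof (rule always_eventually, rule allI)
      fix h
      show "norm (f (x + h) - f x - L h) / norm h \<le> B * norm h"
        using q[of h] by (cases "h = 0") (auto simp: divide_simps power2_eq_square mult_ac)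
    qed
    have "((\<lambda>h::'a. B * norm h) \<longlongrightarrow> B * norm (0::'a)) (at 0)" by (intro tendsto_mult tendsto_const tendsto_norm tendsto_ident_at)
    then show "((\<lambda>h. B * norm h) \<longlongrightarrow> 0) (at (0::'a))" by simp
  qed auto
qed

lemma expandable_has_derivative:
  assumes "expandable f D B" shows "(f has_derivative (\<lambda>h. D x \<bullet> h)) (at x)"
  using assms by (intro has_derivative_quadratic[where B = B]) (auto simp: expandable_def bounded_linear_inner_right)

lemma partial_eq: "(f has_derivative (\<lambda>h. D \<bullet> h)) (at x) \<Longrightarrow> partial j f x = D $ j"
  unfolding partial_def by (simp add: frechet_derivative_at[symmetric] inner_axis)

lemma trig_C_k: "trig f \<Longrightarrow> C_k k f"
proof (induction k arbitrary: f)
  case 0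
  obtain D B where "expandable f D B" using trig_expansion[OF 0] by blast
  then show ?case 
    by (auto intro!: continuous_at_imp_continuous_on has_derivative_continuous expandable_has_derivative)
next
  case (Suc k)
  obtain D B where D: "\<And>j. trig (\<lambda>x. D x $ j)" "expandable f D B" using trig_expansion[OF Suc.prems] by blast
  have "partial j f = (\<lambda>x. D x $ j)" for j
    using partial_eq[OF expandable_has_derivative[OF D(2)]] by auto
  moreover have "f differentiable (at x)" for x
    unfolding differentiable_def using expandable_has_derivative[OF D(2)] by blast
  ultimately show ?case using Suc.IH D(1) by (auto simp: differentiable_on_def)
qed

lemma trig_continuous: "trig f \<Longrightarrow> continuous_on UNIV f"
  using trig_C_k[of f 0] by simp

lemma trig_measurable: "trig f \<Longrightarrow> f \<in> borel_measurable borel"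
  by (intro borel_measurable_continuous_onI trig_continuous)

definition far :: "real \<Rightarrow> real ^ 'n::finite \<Rightarrow> bool" where
  "far r x \<longleftrightarrow> (\<forall>k\<in>int_lattice. r \<le> norm (x - k))"

lemma far_periodic: "periodic (far r :: real ^ 'n::finite \<Rightarrow> bool)"
  unfolding periodic_def
proof (intro allI ballI)
  have *: "far r (x + k)" if "far r x" "k \<in> int_lattice" for x k :: "real ^ 'n"
    unfolding far_def
  proof
    fix l :: "real ^ 'n" assume "l \<in> int_lattice"
    then have "r \<le> norm (x - (l - k))" using that int_lattice_diff by (auto simp: far_def)
    then show "r \<le> norm (x + k - l)" by (simp add: algebra_simps)
  qed
  fix x k :: "real ^ 'n" assume k: "k \<in> int_lattice"
  show "far r (x + k) = far r x"
    using *[of x k] *[of "x + k" "- k"] k int_lattice_minus[OF k] by auto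
qed

lemma far_closed: "closed {x :: real ^ 'n::finite. far r x}"
proof -
  have eq: "{x :: real ^ 'n. far r x} = (\<Inter>k\<in>int_lattice. {x. r \<le> norm (x - k)})" by (auto simp: far_def)
  show ?thesis unfolding eq by (intro closed_INT ballI closed_Collect_le continuous_intros)
qed

lemma far_measurable [measurable]: "{x. far r x} \<in> sets borel"
  by (intro borel_closed far_closed)

text \<open>A trigonometric polynomial with values in [0,1] that equals 1 exactly on the lattice.\<close>

definition bump :: "real ^ 'n::finite \<Rightarrow> real" where
  "bump x = (\<Prod>i\<in>UNIV. 1/2 + 1/2 * cos (2 * pi * x $ i))"

lemma trig_bump: "trig bump"
proof -
  have "trig (\<lambda>x :: real ^ 'n. \<Prod>i\<in>UNIV. 1/2 + 1/2 * cos (2 * pi * x $ i))"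
    by (intro trig_prod trig_add trig_const trig_cmult trig_cos) auto
  then show ?thesis by (simp add: bump_def[abs_def])
qed

lemma bump_factor: "0 \<le> 1/2 + 1/2 * cos (t::real)" "1/2 + 1/2 * cos t \<le> (1::real)"
  using cos_ge_minus_one[of t] cos_le_one[of t] by linarith+

lemma bump_bounds: "0 \<le> bump x" "bump x \<le> 1"
  unfolding bump_def by (intro prod_nonneg prod_le_1 ballI conjI bump_factor)+

lemma bump_eq_1:
  assumes "bump x = 1" shows "x \<in> int_lattice"
  unfolding int_lattice_def
proof (rule CollectI, rule allI)
  fix i
  let ?c = "\<lambda>i. 1/2 + 1/2 * cos (2 * pi * x $ i)"
  have "bump x = ?c i * (\<Prod>i\<in>UNIV - {i}. ?c i)" unfolding bump_def by (rule prod.remove) auto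
  also have "\<dots> \<le> ?c i * 1" by (intro mult_left_mono prod_le_1 ballI conjI bump_factor)
  finally have "?c i \<ge> 1" using assms by simp
  then have "cos (2 * pi * x $ i) = 1" using cos_le_one[of "2 * pi * x $ i"] by linarith
  then obtain m where "2 * pi * x $ i = of_int m * 2 * pi" unfolding cos_one_2pi_int by auto
  then have "x $ i = of_int m" by simp
  then show "x $ i \<in> \<int>" by simp
qed

lemma bump_lattice: "k \<in> int_lattice \<Longrightarrow> bump (k :: real ^ 'n::finite) = 1"
proof -
  assume "k \<in> int_lattice"
  then have "bump k = bump (0 :: real ^ 'n)" using periodicD[OF trig_periodic[OF trig_bump], of k 0] by simp
  then show ?thesis by (simp add: bump_def)
qed

text \<open>Normalised powers of the bump concentrate at the lattice: away from it bump \<le> q < 1, while for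
  q < q' < 1 the integral of bump^N is at least a constant times q'^N, the constant being the
  measure of a neighbourhood of 0 divided by the largest number of its translates that overlap.\<close>

lemma kernel_exists:
  assumes r: "r > 0" and \<eta>: "\<eta> > 0"
  obtains \<rho> :: "real ^ 'n::finite \<Rightarrow> real" where "trig \<rho>" "\<And>x. \<rho> x \<ge> 0" "(\<integral>\<^sup>+x\<in>cube. ennreal (\<rho> x) \<partial>lborel) = 1"
    "(\<integral>\<^sup>+x\<in>cube. ennreal (\<rho> x) * indicator {x. far r x} x \<partial>lborel) \<le> ennreal \<eta>"
proof -
  have cont: "continuous_on S bump" for S :: "(real ^ 'n) set" using trig_continuous[OF trig_bump] continuous_on_subset by blast
  have [measurable]: "(bump :: real ^ 'n \<Rightarrow> real) \<in> borel_measurable borel" by (rule trig_measurable[OF trig_bump])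
  let ?F = "{x :: real ^ 'n. far r x} \<inter> cbox 0 1"
  obtain q where q: "0 \<le> q" "q < 1" "\<And>x. x \<in> ?F \<Longrightarrow> bump x \<le> q"
  proof (cases "?F = {}")
    case True
    then show thesis by (intro that[of 0]) auto
  next
    case False
    have "compact ?F" using far_closed by (intro closed_Int_compact compact_cbox)
    then obtain x0 where x0: "x0 \<in> ?F" "\<And>x. x \<in> ?F \<Longrightarrow> bump x \<le> bump x0"
      using continuous_attains_sup[OF _ False cont] by blast
    have "x0 \<notin> int_lattice" using x0(1) r by (auto simp: far_def)
    then have "bump x0 < 1" using bump_eq_1[of x0] bump_bounds(2)[of x0] by fastforce
    then show thesis using x0(2) bump_bounds(1)[of x0] by (intro that[of "bump x0"]) auto
  qed
  define q' where "q' = (q + 1) / 2"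
  have q': "q < q'" "q' < 1" "0 < q'" using q by (auto simp: q'_def)
  have "bump (0 :: real ^ 'n) = 1" by (rule bump_lattice[OF int_lattice_zero])
  then have "open (bump -` {q'<..} :: (real ^ 'n) set)" "(0 :: real ^ 'n) \<in> bump -` {q'<..}"
    using q' by (auto intro!: open_vimage cont)
  then obtain d where d: "d > 0" "cball (0 :: real ^ 'n) d \<subseteq> bump -` {q'<..}"
    using open_contains_cball by blast
  define m where "m = measure lborel (cball (0 :: real ^ 'n) d)"
  have m: "emeasure lborel (cball (0 :: real ^ 'n) d) = ennreal m" "m > 0" 
    using emeasure_lborel_cball_finite[of "0 :: real ^ 'n" d] content_cball_pos[OF d(1), of "0 :: real ^ 'n"]
    by (auto simp: m_def intro!: emeasure_eq_ennreal_measure)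
  define c where "c = real (card (int_lattice \<inter> cball (0 :: real ^ 'n) (2 * d)))"
  have "(0 :: real ^ 'n) \<in> int_lattice \<inter> cball 0 (2 * d)" using d(1) int_lattice_zero by auto
  then have c: "c > 0" using finite_lattice_cball[of "2 * d"] unfolding c_def card_gt_0_iff of_nat_0_less_iff by blast
  define I where "I = (\<lambda>N::nat. \<integral>\<^sup>+x\<in>cube. ennreal (bump (x :: real ^ 'n) ^ N) \<partial>lborel)"
  have I1: "I N \<le> 1" for N
  proof -
    have "I N \<le> (\<integral>\<^sup>+x. indicator (cube :: (real ^ 'n) set) x \<partial>lborel)" unfolding I_def
      by (intro nn_integral_mono) (auto simp: indicator_def ennreal_le_1 intro!: power_le_one bump_bounds)
    then show ?thesis by (simp add: emeasure_cube)
  qed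
  have I2: "ennreal (q' ^ N * m / c) \<le> I N" for N
  proof -
    have "ennreal (q' ^ N) * ennreal m = (\<integral>\<^sup>+x\<in>cball (0 :: real ^ 'n) d. ennreal (q' ^ N) \<partial>lborel)" using m
      by (simp add: nn_integral_cmult_indicator)
    also have "\<dots> \<le> (\<integral>\<^sup>+x\<in>cball (0 :: real ^ 'n) d. ennreal (bump x ^ N) \<partial>lborel)"
    proof (rule nn_integral_mono)
      fix x :: "real ^ 'n"
      have "q' ^ N \<le> bump x ^ N" if "x \<in> cball 0 d" using d(2) that q' by (intro power_mono) (auto simp: less_imp_le)
      then show "ennreal (q' ^ N) * indicator (cball 0 d) x \<le> ennreal (bump x ^ N) * indicator (cball 0 d) x"
        by (auto simp: indicator_def intro: ennreal_leI)
    qed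
    also have "\<dots> \<le> ennreal c * I N"
      unfolding I_def c_def ennreal_of_nat_eq_real_of_nat[symmetric]
    proof (rule nn_integral_cball_periodic)
      have per: "periodic (bump :: real ^ 'n \<Rightarrow> real)" by (rule trig_periodic[OF trig_bump])
      show "periodic (\<lambda>x :: real ^ 'n. ennreal (bump x ^ N))" using per by (auto simp: periodic_def)
    qed auto
    finally have le: "ennreal (q' ^ N * m) \<le> ennreal c * I N" using q' m by (simp add: ennreal_mult)
    obtain i where i: "i \<ge> 0" "I N = ennreal i" using I1[of N] by (cases "I N") (auto simp: top_unique)
    have "q' ^ N * m \<le> c * i" using le i c by (simp add: ennreal_mult[symmetric])
    then show ?thesis using i c by (simp add: ennreal_leI divide_simps mult.commute)
  qed
  have "(\<lambda>N. (q / q') ^ N * (c / m)) \<longlonglongrightarrow> 0 * (c / m)"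
    using q q' by (intro tendsto_mult LIMSEQ_realpow_zero tendsto_const) auto
  then have "\<forall>\<^sub>F N in sequentially. (q / q') ^ N * (c / m) < \<eta>" using \<eta> by (intro order_tendstoD(2)) auto
  then obtain N where N: "(q / q') ^ N * (c / m) < \<eta>" by (auto simp: eventually_sequentially)
  obtain i where i: "i \<ge> 0" "I N = ennreal i" using I1[of N] by (cases "I N") (auto simp: top_unique)
  have iN: "q' ^ N * m / c \<le> i" using I2[of N] i by simp
  then have i0: "i > 0" using q' m c by (smt (verit) divide_pos_pos mult_pos_pos zero_less_power)
  show thesis
  proof (rule that[of "\<lambda>x. 1 / i * bump x ^ N"])
    show "trig (\<lambda>x :: real ^ 'n. 1 / i * bump x ^ N)" by (intro trig_cmult trig_power trig_bump)
    show "0 \<le> 1 / i * bump x ^ N" for x :: "real ^ 'n"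
      by (intro mult_nonneg_nonneg zero_le_power bump_bounds) (use i0 in auto)
    have "(\<integral>\<^sup>+x\<in>cube. ennreal (1 / i * bump (x :: real ^ 'n) ^ N) \<partial>lborel) = ennreal (1 / i) * I N"
    proof -
      have "ennreal (1 / i * bump x ^ N) = ennreal (1 / i) * ennreal (bump x ^ N)" for x :: "real ^ 'n"
        using i0 by (intro ennreal_mult) (auto intro!: zero_le_power bump_bounds)
      then have "(\<integral>\<^sup>+x\<in>cube. ennreal (1 / i * bump (x :: real ^ 'n) ^ N) \<partial>lborel) = (\<integral>\<^sup>+x. ennreal (1 / i) * (ennreal (bump (x :: real ^ 'n) ^ N) * indicator cube x) \<partial>lborel)"
        by (simp only: mult.assoc)
      then show ?thesis unfolding I_def by (subst nn_integral_cmult[symmetric]) auto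
    qed
    also have "\<dots> = 1" using i i0 by (simp add: ennreal_mult[symmetric])
    finally show "(\<integral>\<^sup>+x\<in>cube. ennreal (1 / i * bump (x :: real ^ 'n) ^ N) \<partial>lborel) = 1" .
    have "(\<integral>\<^sup>+x\<in>cube. ennreal (1 / i * bump (x :: real ^ 'n) ^ N) * indicator {x. far r x} x \<partial>lborel) \<le> (\<integral>\<^sup>+x\<in>(cube :: (real ^ 'n) set). ennreal (1 / i * q ^ N) \<partial>lborel)"
    proof (rule nn_integral_mono)
      fix x :: "real ^ 'n"
      have "1 / i * bump x ^ N \<le> 1 / i * q ^ N" if "x \<in> cube" "far r x"
      proof -
        have "x \<in> ?F" using that by (auto simp: cube_def mem_box_cart less_imp_le)
        then show ?thesis using q(3) i0 bump_bounds by (intro mult_left_mono power_mono) auto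
      qed
      then show "ennreal (1 / i * bump x ^ N) * indicator {x. far r x} x * indicator cube x \<le> ennreal (1 / i * q ^ N) * indicator cube x"
        by (auto simp: indicator_def intro: ennreal_leI)
    qed
    also have "\<dots> = ennreal (1 / i * q ^ N)" by (simp add: nn_integral_cmult_indicator emeasure_cube)
    also have "\<dots> \<le> ennreal \<eta>"
    proof (rule ennreal_leI)
      have "1 / i * q ^ N \<le> 1 / (q' ^ N * m / c) * q ^ N"
        using iN i0 q' m c q by (intro mult_right_mono divide_left_mono) auto
      also have "\<dots> = (q / q') ^ N * (c / m)" by (simp add: power_divide)
      finally show "1 / i * q ^ N \<le> \<eta>" using N by linarith
    qed
    finally show "(\<integral>\<^sup>+x\<in>cube. ennreal (1 / i * bump (x :: real ^ 'n) ^ N) * indicator {x. far r x} x \<partial>lborel) \<le> ennreal \<eta>" .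
  qed
qed


section \<open>Averaging in time and mollifying in space\<close>

lemma vec_nth_measurable [measurable (raw)]:
  fixes f :: "'a \<Rightarrow> real ^ 'n::finite"
  assumes "f \<in> borel_measurable M" shows "(\<lambda>x. f x $ i) \<in> borel_measurable M"
  by (rule measurable_compose[OF assms]) (auto intro!: borel_measurable_continuous_onI continuous_intros)

lemma integrable_bounded_scaleR:
  fixes W :: "'a \<Rightarrow> 'b::{banach, second_countable_topology}"
  assumes W: "integrable M W" and [measurable]: "f \<in> borel_measurable M" and B: "\<And>x. x \<in> space M \<Longrightarrow> \<bar>f x\<bar> \<le> B"
  shows "integrable M (\<lambda>x. f x *\<^sub>R W x)"
proof (rule Bochner_Integration.integrable_bound)
  show "integrable M (\<lambda>x. B *\<^sub>R W x)" using W by simp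
  have [measurable]: "W \<in> borel_measurable M" using W by simp
  show "(\<lambda>x. f x *\<^sub>R W x) \<in> borel_measurable M" by measurable
  show "AE x in M. norm (f x *\<^sub>R W x) \<le> norm (B *\<^sub>R W x)"
  proof (rule AE_I2)
    fix x assume "x \<in> space M"
    then have "\<bar>f x\<bar> \<le> \<bar>B\<bar>" using B[of x] by linarith
    then show "norm (f x *\<^sub>R W x) \<le> norm (B *\<^sub>R W x)" by (simp add: mult_right_mono)
  qed
qed

lemma integral_norm_le:
  fixes f :: "'a \<Rightarrow> 'b::{banach, second_countable_topology}"
  assumes "integrable M f" "integrable M g" "\<And>x. x \<in> space M \<Longrightarrow> norm (f x) \<le> g x"
  shows "norm (\<integral>x. f x \<partial>M) \<le> (\<integral>x. g x \<partial>M)"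
  using integral_norm_bound[of M f] integral_mono[OF integrable_norm[OF assms(1)] assms(2) assms(3)] by linarith

text \<open>Integrate the tangent line of exp at the mean of f.\<close>

lemma Jensen_exp:
  fixes w f :: "'a \<Rightarrow> real"
  assumes [measurable]: "w \<in> borel_measurable M" "f \<in> borel_measurable M" 
    and w0: "\<And>x. w x \<ge> 0" and w1: "(\<integral>\<^sup>+x. ennreal (w x) \<partial>M) = 1" and wf: "integrable M (\<lambda>x. w x * f x)"
  shows "ennreal (exp (\<integral>x. w x * f x \<partial>M)) \<le> (\<integral>\<^sup>+x. ennreal (w x * exp (f x)) \<partial>M)"
proof (cases "(\<integral>\<^sup>+x. ennreal (w x * exp (f x)) \<partial>M) = \<infinity>")
  case False
  then have fin: "integrable M (\<lambda>x. w x * exp (f x))"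
    using w0 by (intro integrableI_nonneg) (auto simp: less_top)
  have wi: "integrable M w" using w0 w1 by (intro integrableI_nonneg) auto
  have wv: "(\<integral>x. w x \<partial>M) = 1" using w0 w1 by (simp add: integral_eq_nn_integral)
  define a where "a = (\<integral>x. w x * f x \<partial>M)"
  have "exp a = (\<integral>x. exp a * ((1 - a) * w x + w x * f x) \<partial>M)"
    using wi wf wv by (simp add: a_def[symmetric])
  also have "\<dots> \<le> (\<integral>x. w x * exp (f x) \<partial>M)"
  proof (rule integral_mono)
    fix x
    have "exp a * (1 + (f x - a)) \<le> exp a * exp (f x - a)" by (intro mult_left_mono exp_ge_add_one_self) auto
    also have "\<dots> = exp (f x)" by (simp flip: exp_add)
    finally have "w x * (exp a * (1 + (f x - a))) \<le> w x * exp (f x)" using w0 by (rule mult_left_mono)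
    then show "exp a * ((1 - a) * w x + w x * f x) \<le> w x * exp (f x)" by (simp add: algebra_simps)
  qed (use wi wf fin in auto)
  finally show ?thesis using w0 by (simp add: a_def nn_integral_eq_integral[OF fin] ennreal_leI)
qed simp

lemma mollify_has_derivative:
  fixes W :: "'a \<Rightarrow> 'b::{banach, second_countable_topology}" and \<tau> :: "'a \<Rightarrow> real ^ 'n::finite"
  assumes W: "integrable M W" and [measurable]: "\<tau> \<in> borel_measurable M" "\<rho> \<in> borel_measurable borel" "D \<in> borel_measurable borel"
    and ex: "expandable \<rho> D B"
  shows "((\<lambda>y. \<integral>\<omega>. \<rho> (y - \<tau> \<omega>) *\<^sub>R W \<omega> \<partial>M) has_derivative (\<lambda>h. \<integral>\<omega>. (D (y - \<tau> \<omega>) \<bullet> h) *\<^sub>R W \<omega> \<partial>M)) (at y)"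
proof -
  have B: "\<bar>\<rho> x\<bar> \<le> B" "norm (D x) \<le> B" "\<bar>\<rho> (x + h) - \<rho> x - D x \<bullet> h\<bar> \<le> B * (norm h)\<^sup>2" for x h
    using ex by (auto simp: expandable_def)
  have i1: "integrable M (\<lambda>\<omega>. \<rho> (y - \<tau> \<omega>) *\<^sub>R W \<omega>)" for y
    by (rule integrable_bounded_scaleR[OF W, of _ B]) (use B in auto)
  have i2: "integrable M (\<lambda>\<omega>. (D (y - \<tau> \<omega>) \<bullet> h) *\<^sub>R W \<omega>)" for y h
  proof (rule integrable_bounded_scaleR[OF W, of _ "B * norm h"])
    fix \<omega> 
    show "\<bar>D (y - \<tau> \<omega>) \<bullet> h\<bar> \<le> B * norm h"
      by (rule order_trans[OF Cauchy_Schwarz_ineq2 mult_right_mono[OF B(2)]]) simp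
  qed measurable
  show ?thesis
  proof (rule has_derivative_quadratic)
    have "linear (\<lambda>h. \<integral>\<omega>. (D (y - \<tau> \<omega>) \<bullet> h) *\<^sub>R W \<omega> \<partial>M)"
      by (rule linearI) (use i2 in \<open>simp_all add: inner_add_right scaleR_add_left flip: scaleR_scaleR\<close>)
    then show "bounded_linear (\<lambda>h. \<integral>\<omega>. (D (y - \<tau> \<omega>) \<bullet> h) *\<^sub>R W \<omega> \<partial>M)"
      by (rule linear_conv_bounded_linear[THEN iffD1])
    fix h
    have "(\<integral>\<omega>. \<rho> (y + h - \<tau> \<omega>) *\<^sub>R W \<omega> \<partial>M) - (\<integral>\<omega>. \<rho> (y - \<tau> \<omega>) *\<^sub>R W \<omega> \<partial>M) - (\<integral>\<omega>. (D (y - \<tau> \<omega>) \<bullet> h) *\<^sub>R W \<omega> \<partial>M)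
      = (\<integral>\<omega>. \<rho> (y + h - \<tau> \<omega>) *\<^sub>R W \<omega> - \<rho> (y - \<tau> \<omega>) *\<^sub>R W \<omega> - (D (y - \<tau> \<omega>) \<bullet> h) *\<^sub>R W \<omega> \<partial>M)"
      using i1 i2 by simp
    also have "norm \<dots> \<le> (\<integral>\<omega>. (B * (norm h)\<^sup>2) * norm (W \<omega>) \<partial>M)"
    proof (rule integral_norm_le)
      fix \<omega>
      have "\<rho> (y + h - \<tau> \<omega>) *\<^sub>R W \<omega> - \<rho> (y - \<tau> \<omega>) *\<^sub>R W \<omega> - (D (y - \<tau> \<omega>) \<bullet> h) *\<^sub>R W \<omega>
        = (\<rho> ((y - \<tau> \<omega>) + h) - \<rho> (y - \<tau> \<omega>) - D (y - \<tau> \<omega>) \<bullet> h) *\<^sub>R W \<omega>"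
        by (simp add: algebra_simps)
      then show "norm (\<rho> (y + h - \<tau> \<omega>) *\<^sub>R W \<omega> - \<rho> (y - \<tau> \<omega>) *\<^sub>R W \<omega> - (D (y - \<tau> \<omega>) \<bullet> h) *\<^sub>R W \<omega>) \<le> (B * (norm h)\<^sup>2) * norm (W \<omega>)"
        using B(3)[of "y - \<tau> \<omega>" h] by (simp add: mult_right_mono)
    qed (use i1 i2 W in auto)
    also have "\<dots> = (B * (\<integral>\<omega>. norm (W \<omega>) \<partial>M)) * (norm h)\<^sup>2" by simp
    finally show "norm ((\<integral>\<omega>. \<rho> (y + h - \<tau> \<omega>) *\<^sub>R W \<omega> \<partial>M) - (\<integral>\<omega>. \<rho> (y - \<tau> \<omega>) *\<^sub>R W \<omega> \<partial>M) - (\<integral>\<omega>. (D (y - \<tau> \<omega>) \<bullet> h) *\<^sub>R W \<omega> \<partial>M))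
       \<le> (B * (\<integral>\<omega>. norm (W \<omega>) \<partial>M)) * (norm h)\<^sup>2" .
  qed
qed

lemma nn_integral_torus_kernel:
  fixes h :: "real ^ 'n::finite \<Rightarrow> ennreal"
  assumes [measurable]: "h \<in> borel_measurable borel" and per: "periodic h"
  shows "(\<integral>\<^sup>+p. h (y - cube_rep p) \<partial>torus_measure) = (\<integral>\<^sup>+x\<in>cube. h x \<partial>lborel)"
proof -
  have "(\<integral>\<^sup>+p. h (y - cube_rep p) \<partial>torus_measure) = (\<integral>\<^sup>+x\<in>cube. h (y - cube_rep (torus_proj x)) \<partial>lborel)"
    by (rule nn_integral_torus) measurable
  also have "\<dots> = (\<integral>\<^sup>+x\<in>cube. h (y - x) \<partial>lborel)"
    by (intro nn_integral_cong) (auto simp: indicator_def cube_rep_proj)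
  also have "\<dots> = (\<integral>\<^sup>+x\<in>cube. h x \<partial>lborel)" by (rule nn_integral_cube_reflect) fact+
  finally show ?thesis .
qed

text \<open>The kernel centred at y is an admissible test function of the torus variable, and differentiating
  it in that variable is minus differentiating it in y.\<close>

lemma weak_gradient_kernel:
  fixes \<rho> :: "real ^ 'n::finite \<Rightarrow> real"
  assumes wg: "weak_gradient v G" and \<rho>: "trig \<rho>" and D: "\<And>j. trig (\<lambda>x. D x $ j)" "expandable \<rho> D B"
  shows "(\<integral>p. v p $ i * (D (y - cube_rep p) $ j) \<partial>torus_measure) = (\<integral>p. G p $ i $ j * \<rho> (y - cube_rep p) \<partial>torus_measure)"
proof -
  let ?\<phi> = "\<lambda>p. \<rho> (y - cube_rep p)"
  have "- (z - cube_rep (torus_proj z)) \<in> int_lattice" for z :: "real ^ 'n"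
    by (rule int_lattice_minus) (simp flip: torus_proj_eq_iff)
  then have l: "y - z - (y - cube_rep (torus_proj z)) \<in> int_lattice" for z :: "real ^ 'n" by (simp add: algebra_simps)
  have "?\<phi> (torus_proj z) = \<rho> (y - z)" for z
    by (rule periodic_translate[OF trig_periodic[OF \<rho>] l, symmetric])
  then have eq: "?\<phi> \<circ> torus_proj = (\<lambda>z. \<rho> (y - z))" by auto
  have "torus_smooth ?\<phi>" unfolding torus_smooth_def eq using trig_C_k trig_reflect[OF \<rho>] by blast
  moreover have "torus_partial j ?\<phi> p = - (D (y - cube_rep p) $ j)" for p j
  proof -
    have "((\<lambda>z. \<rho> (y - z)) has_derivative (\<lambda>h. D (y - torus_rep p) \<bullet> (- h))) (at (torus_rep p))"
      by (rule has_derivative_compose[OF _ expandable_has_derivative[OF D(2)]]) (auto intro!: derivative_eq_intros)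
    then have "((\<lambda>z. \<rho> (y - z)) has_derivative (\<lambda>h. (- D (y - torus_rep p)) \<bullet> h)) (at (torus_rep p))" by simp
    then have "torus_partial j ?\<phi> p = (- D (y - torus_rep p)) $ j" unfolding torus_partial_def eq by (rule partial_eq)
    moreover have "D (y - torus_rep p) $ j = D (y - cube_rep p) $ j"
      using periodic_translate[OF trig_periodic[OF D(1)[of j]] l[of "torus_rep p"]] by simp
    ultimately show ?thesis by simp
  qed
  moreover have "torus_smooth ?\<phi> \<Longrightarrow> (\<integral>p. v p $ i * torus_partial j ?\<phi> p \<partial>torus_measure) = - (\<integral>p. G p $ i $ j * ?\<phi> p \<partial>torus_measure)"
    using wg unfolding weak_gradient_def by blast
  ultimately show ?thesis by simp
qed

text \<open>A family of fields b a is averaged over the parameter a with respect to the probability measure P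
  and mollified by \<rho>. With P uniform on a time interval this gives the velocity of one Euler step;
  with P a point mass it mollifies a single field.\<close>

locale averaged_field = prob_space P for P :: "'a measure" +
  fixes b :: "'a \<Rightarrow> 'n::finite torus \<Rightarrow> real ^ 'n" and Db :: "'a \<Rightarrow> 'n torus \<Rightarrow> real ^ 'n ^ 'n"
    and \<beta> K :: real and \<rho> :: "real ^ 'n \<Rightarrow> real"
  assumes b_meas[measurable]: "(\<lambda>(a, p). b a p) \<in> borel_measurable (P \<Otimes>\<^sub>M torus_measure)"
    and Db_meas[measurable]: "(\<lambda>(a, p). Db a p) \<in> borel_measurable (P \<Otimes>\<^sub>M torus_measure)"
    and wg: "\<And>a. a \<in> space P \<Longrightarrow> weak_gradient (b a) (Db a)"
    and b_int: "integrable (P \<Otimes>\<^sub>M torus_measure) (\<lambda>(a, p). b a p)"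
    and Db_exp: "\<And>a. a \<in> space P \<Longrightarrow> (\<integral>\<^sup>+p. ennreal (exp (\<beta> * norm (Db a p))) \<partial>torus_measure) \<le> ennreal K"
    and \<beta>: "\<beta> > 0" and K: "K \<ge> 1"
    and \<rho>: "trig \<rho>" "\<And>x. \<rho> x \<ge> 0" "(\<integral>\<^sup>+x\<in>cube. ennreal (\<rho> x) \<partial>lborel) = 1"
begin

abbreviation "M \<equiv> P \<Otimes>\<^sub>M (torus_measure :: 'n torus measure)"

abbreviation bp where "bp \<omega> \<equiv> b (fst \<omega>) (snd \<omega>)"
abbreviation Dbp where "Dbp \<omega> \<equiv> Db (fst \<omega>) (snd \<omega>)"
abbreviation ker where "ker y \<omega> \<equiv> \<rho> (y - cube_rep (snd \<omega>))"

definition field :: "real ^ 'n \<Rightarrow> real ^ 'n" where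
  "field y = (\<integral>\<omega>. ker y \<omega> *\<^sub>R bp \<omega> \<partial>M)"

definition grad :: "real ^ 'n \<Rightarrow> real ^ 'n ^ 'n" where
  "grad y = (\<integral>\<omega>. ker y \<omega> *\<^sub>R Dbp \<omega> \<partial>M)"

sublocale T: prob_space "torus_measure :: 'n torus measure" by (rule prob_space_torus)
sublocale pair_sigma_finite P "torus_measure :: 'n torus measure" ..
sublocale PT: pair_prob_space P "torus_measure :: 'n torus measure" ..

lemma \<rho>_measurable [measurable]: "\<rho> \<in> borel_measurable borel" by (rule trig_measurable[OF \<rho>(1)])

lemma b_meas' [measurable]: "(\<lambda>\<omega>. bp \<omega>) \<in> borel_measurable M"
  using b_meas by (simp add: case_prod_unfold)

lemma Db_meas' [measurable]: "(\<lambda>\<omega>. Dbp \<omega>) \<in> borel_measurable M"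
  using Db_meas by (simp add: case_prod_unfold)

lemma b_int': "integrable M (\<lambda>\<omega>. bp \<omega>)"
  using b_int by (simp add: case_prod_unfold)

lemma nn_integral_M:
  assumes "f \<in> borel_measurable M"
  shows "(\<integral>\<^sup>+\<omega>. f \<omega> \<partial>M) = (\<integral>\<^sup>+a. \<integral>\<^sup>+p. f (a, p) \<partial>torus_measure \<partial>P)"
  using T.nn_integral_fst[OF assms] by simp

lemma exp_M: "(\<integral>\<^sup>+\<omega>. ennreal (exp (\<beta> * norm (Dbp \<omega>))) \<partial>M) \<le> ennreal K"
proof -
  have "(\<integral>\<^sup>+\<omega>. ennreal (exp (\<beta> * norm (Dbp \<omega>))) \<partial>M) \<le> (\<integral>\<^sup>+a. ennreal K \<partial>P)"
    by (subst nn_integral_M, simp, simp only: fst_conv snd_conv, rule nn_integral_mono, rule Db_exp)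
  then show ?thesis by (simp add: emeasure_space_1)
qed

lemma Db_nn_integral: "(\<integral>\<^sup>+\<omega>. ennreal (norm (Dbp \<omega>)) \<partial>M) \<le> ennreal (K / \<beta>)"
proof -
  have "(\<integral>\<^sup>+\<omega>. ennreal (norm (Dbp \<omega>)) \<partial>M) \<le> (\<integral>\<^sup>+\<omega>. ennreal (1 / \<beta>) * ennreal (exp (\<beta> * norm (Dbp \<omega>))) \<partial>M)"
  proof (rule nn_integral_mono)
    fix \<omega>
    have "\<beta> * norm (Dbp \<omega>) \<le> exp (\<beta> * norm (Dbp \<omega>))"
      using exp_ge_add_one_self[of "\<beta> * norm (Dbp \<omega>)"] by linarith
    then show "ennreal (norm (Dbp \<omega>)) \<le> ennreal (1 / \<beta>) * ennreal (exp (\<beta> * norm (Dbp \<omega>)))"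
      using \<beta> by (simp add: ennreal_mult[symmetric] ennreal_leI field_simps)
  qed
  also have "\<dots> = ennreal (1 / \<beta>) * (\<integral>\<^sup>+\<omega>. ennreal (exp (\<beta> * norm (Dbp \<omega>))) \<partial>M)"
    by (rule nn_integral_cmult) measurable
  also have "\<dots> \<le> ennreal (1 / \<beta>) * ennreal K" by (intro mult_left_mono exp_M) auto
  finally show ?thesis using \<beta> K by (simp add: ennreal_mult[symmetric])
qed

lemma Db_int: "integrable M (\<lambda>\<omega>. Dbp \<omega>)"
  using Db_nn_integral by (intro integrableI_bounded) (auto intro: le_less_trans)

lemma kernel_M: "(\<integral>\<^sup>+\<omega>. ennreal (ker y \<omega>) \<partial>M) = 1"
proof -
  have "(\<integral>\<^sup>+p. ennreal (\<rho> (y - cube_rep p)) \<partial>torus_measure) = 1"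
    by (subst nn_integral_torus_kernel[where h = "\<lambda>x. ennreal (\<rho> x)"]) (use \<rho> trig_periodic[OF \<rho>(1)] in \<open>auto simp: periodic_def\<close>)
  then show ?thesis by (subst nn_integral_M) (simp_all add: emeasure_space_1)
qed

lemma expansion:
  obtains D B where "\<forall>j. trig (\<lambda>x. D x $ j)" "expandable \<rho> D B" "D \<in> borel_measurable borel"
proof -
  obtain D B where D: "\<And>j. trig (\<lambda>x. D x $ j)" "expandable \<rho> D B" using trig_expansion[OF \<rho>(1)] by blast
  have "continuous_on UNIV (\<lambda>x. \<chi> j. D x $ j)" by (intro continuous_on_vec_lambda trig_continuous D)
  then have "D \<in> borel_measurable borel" by (intro borel_measurable_continuous_onI) simp
  then show thesis using D by (intro that[of D B]) auto
qed

lemma field_has_derivative: "(field has_derivative (\<lambda>h. grad y *v h)) (at y)"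
proof -
  obtain D B where D: "\<forall>j. trig (\<lambda>x. D x $ j)" "expandable \<rho> D B" and [measurable]: "D \<in> borel_measurable borel" by (rule expansion) 
  let ?L = "\<lambda>h. \<integral>\<omega>. (D (y - cube_rep (snd \<omega>)) \<bullet> h) *\<^sub>R bp \<omega> \<partial>M"
  have B: "\<bar>\<rho> x\<bar> \<le> B" "norm (D x) \<le> B" for x using D(2) by (auto simp: expandable_def)
  have "(field has_derivative ?L) (at y)" unfolding field_def[abs_def]
    by (rule mollify_has_derivative[OF b_int' _ _ _ D(2)]) measurable
  moreover have "?L h = grad y *v h" for h
  proof -
    have ib: "integrable M (\<lambda>\<omega>. (D (y - cube_rep (snd \<omega>)) $ j) *\<^sub>R bp \<omega>)" for j
    proof (rule integrable_bounded_scaleR[OF b_int', of _ B])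
      show "(\<lambda>\<omega>. D (y - cube_rep (snd \<omega>)) $ j) \<in> borel_measurable M" by measurable
      show "\<bar>D (y - cube_rep (snd \<omega>)) $ j\<bar> \<le> B" for \<omega> by (rule order_trans[OF component_le_norm_cart B(2)])
    qed
    have iD: "integrable M (\<lambda>\<omega>. ker y \<omega> *\<^sub>R Dbp \<omega>)"
      by (rule integrable_bounded_scaleR[OF Db_int, of _ B]) (use B in auto)
    have ij: "integrable M (\<lambda>\<omega>. bp \<omega> $ i * (D (y - cube_rep (snd \<omega>)) $ j))" for i j
      using integrable_bounded_linear[OF bounded_linear_vec_nth ib[of j], of i] by (simp add: mult.commute)
    have iD': "integrable M (\<lambda>\<omega>. Dbp \<omega> $ i $ j * ker y \<omega>)" for i j
      using integrable_bounded_linear[OF bounded_linear_compose[OF bounded_linear_vec_nth bounded_linear_vec_nth] iD, of i j] by (simp add: mult.commute)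
    have key: "(\<integral>\<omega>. bp \<omega> $ i * (D (y - cube_rep (snd \<omega>)) $ j) \<partial>M) = grad y $ i $ j" for i j
    proof -
      have "(\<integral>\<omega>. bp \<omega> $ i * (D (y - cube_rep (snd \<omega>)) $ j) \<partial>M) =
         (\<integral>a. (\<integral>p. b a p $ i * (D (y - cube_rep p) $ j) \<partial>torus_measure) \<partial>P)"
        using integral_fst'[OF ij[of i j]] by simp
      also have "\<dots> = (\<integral>a. (\<integral>p. Db a p $ i $ j * \<rho> (y - cube_rep p) \<partial>torus_measure) \<partial>P)"
        by (intro Bochner_Integration.integral_cong refl weak_gradient_kernel[OF wg \<rho>(1) D(1)[rule_format] D(2)])
      also have "\<dots> = (\<integral>\<omega>. Dbp \<omega> $ i $ j * ker y \<omega> \<partial>M)"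
        using integral_fst'[OF iD'[of i j]] by simp
      also have "\<dots> = grad y $ i $ j"
        unfolding grad_def using integral_bounded_linear[OF bounded_linear_compose[OF bounded_linear_vec_nth bounded_linear_vec_nth] iD, of i j]
        by (simp add: mult.commute)
      finally show ?thesis .
    qed
    have "?L h = (\<integral>\<omega>. (\<Sum>j\<in>UNIV. h $ j *\<^sub>R ((D (y - cube_rep (snd \<omega>)) $ j) *\<^sub>R bp \<omega>)) \<partial>M)"
      by (intro Bochner_Integration.integral_cong refl) (simp add: inner_vec_def scaleR_sum_left mult.commute)
    also have "\<dots> = (\<Sum>j\<in>UNIV. h $ j *\<^sub>R (\<integral>\<omega>. (D (y - cube_rep (snd \<omega>)) $ j) *\<^sub>R bp \<omega> \<partial>M))"
      using ib by (subst Bochner_Integration.integral_sum) (simp_all del: scaleR_scaleR)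
    finally have L: "?L h = (\<Sum>j\<in>UNIV. h $ j *\<^sub>R (\<integral>\<omega>. (D (y - cube_rep (snd \<omega>)) $ j) *\<^sub>R bp \<omega> \<partial>M))" .
    show ?thesis
    proof (rule vec_eq_iff[THEN iffD2], rule allI)
      fix i
      have "(\<integral>\<omega>. (D (y - cube_rep (snd \<omega>)) $ j) *\<^sub>R bp \<omega> \<partial>M) $ i = grad y $ i $ j" for j
        using integral_bounded_linear[OF bounded_linear_vec_nth ib[of j], of i] key[of i j] by (simp add: mult.commute)
      then show "?L h $ i = (grad y *v h) $ i" unfolding L
        by (simp add: matrix_vector_mult_def mult.commute)
    qed
  qed
  ultimately show ?thesis by simp
qed

lemma grad_continuous: "continuous_on UNIV grad"
proof -
  obtain D B where D: "\<forall>j. trig (\<lambda>x. D x $ j)" "expandable \<rho> D B" and [measurable]: "D \<in> borel_measurable borel" by (rule expansion) 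
  have "(grad has_derivative (\<lambda>h. \<integral>\<omega>. (D (y - cube_rep (snd \<omega>)) \<bullet> h) *\<^sub>R Dbp \<omega> \<partial>M)) (at y)" for y
    unfolding grad_def[abs_def] by (rule mollify_has_derivative[OF Db_int _ _ _ D(2)]) measurable
  then show ?thesis by (blast intro: continuous_at_imp_continuous_on has_derivative_continuous)
qed

lemma kernel_shift: "k \<in> int_lattice \<Longrightarrow> \<rho> (y + k - z) = \<rho> (y - z)"
  using periodicD[OF trig_periodic[OF \<rho>(1)], of k "y - z"] by (simp add: algebra_simps)

lemma field_periodic: "periodic field" and grad_periodic: "periodic grad"
  by (auto simp: periodic_def field_def grad_def kernel_shift)

lemma kernel_integral: "integrable M (\<lambda>\<omega>. ker y \<omega>)" "(\<integral>\<omega>. ker y \<omega> \<partial>M) = 1"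
  using kernel_M[of y] \<rho>(2) by (auto intro!: integrableI_nonneg simp: integral_eq_nn_integral)

lemma kernel_integrable:
  fixes W :: "'a \<times> 'n torus \<Rightarrow> 'c::{banach, second_countable_topology}"
  assumes "integrable M W"
  shows "integrable M (\<lambda>\<omega>. ker y \<omega> *\<^sub>R W \<omega>)"
proof -
  obtain D B where "expandable \<rho> D B" by (rule expansion) 
  then have "\<bar>\<rho> x\<bar> \<le> B" for x by (auto simp: expandable_def)
  then show ?thesis by (intro integrable_bounded_scaleR[OF assms, of _ B]) auto
qed

lemma norm_grad_le: "norm (grad y) \<le> (\<integral>\<omega>. ker y \<omega> * norm (Dbp \<omega>) \<partial>M)"
  unfolding grad_def using kernel_integrable[OF Db_int, of y] kernel_integrable[OF integrable_norm[OF Db_int], of y] \<rho>(2)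
  by (intro integral_norm_le) auto

lemma grad_bounded:
  assumes B: "\<And>x. \<rho> x \<le> B"
  shows "norm (grad y) \<le> B * (K / \<beta>)"
proof -
  have "B \<ge> 0" using B[of 0] \<rho>(2)[of 0] by linarith
  have "(\<integral>\<omega>. ker y \<omega> * norm (Dbp \<omega>) \<partial>M) \<le> (\<integral>\<omega>. B * norm (Dbp \<omega>) \<partial>M)"
    using kernel_integrable[OF integrable_norm[OF Db_int], of y] Db_int B by (intro integral_mono) (auto intro: mult_right_mono)
  also have "\<dots> = B * (\<integral>\<omega>. norm (Dbp \<omega>) \<partial>M)" by simp
  also have "\<dots> \<le> B * (K / \<beta>)"
  proof (intro mult_left_mono \<open>B \<ge> 0\<close>)
    have "ennreal (\<integral>\<omega>. norm (Dbp \<omega>) \<partial>M) \<le> ennreal (K / \<beta>)"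
      using Db_nn_integral Db_int by (subst nn_integral_eq_integral[symmetric]) auto
    then show "(\<integral>\<omega>. norm (Dbp \<omega>) \<partial>M) \<le> K / \<beta>" using \<beta> K by simp
  qed
  finally show ?thesis using norm_grad_le[of y] by linarith
qed

text \<open>The gradient is an average of Db, so Jensen's inequality applies pointwise; integrating over the
  cube, each translate of \<rho> contributes total mass 1.\<close>

lemma exp_grad: "(\<integral>\<^sup>+y\<in>cube. ennreal (exp (\<beta> * norm (grad y))) \<partial>lborel) \<le> ennreal K"
proof -
  let ?E = "\<lambda>\<omega>. exp (\<beta> * norm (Dbp \<omega>))"
  have pw: "ennreal (exp (\<beta> * norm (grad y))) \<le> (\<integral>\<^sup>+\<omega>. ennreal (ker y \<omega> * ?E \<omega>) \<partial>M)" for y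
  proof -
    have i: "integrable M (\<lambda>\<omega>. ker y \<omega> * (\<beta> * norm (Dbp \<omega>)))"
      using kernel_integrable[OF integrable_mult_right[OF integrable_norm[OF Db_int]], of y \<beta>] by simp
    have "\<beta> * norm (grad y) \<le> (\<integral>\<omega>. ker y \<omega> * (\<beta> * norm (Dbp \<omega>)) \<partial>M)"
      using mult_left_mono[OF norm_grad_le[of y], of \<beta>] \<beta> by (simp add: mult.left_commute[of _ \<beta>])
    then have "ennreal (exp (\<beta> * norm (grad y))) \<le> ennreal (exp (\<integral>\<omega>. ker y \<omega> * (\<beta> * norm (Dbp \<omega>)) \<partial>M))"
      by (simp add: ennreal_leI)
    also have "\<dots> \<le> (\<integral>\<^sup>+\<omega>. ennreal (ker y \<omega> * ?E \<omega>) \<partial>M)"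
      by (rule Jensen_exp[OF _ _ _ kernel_M i]) (use \<rho>(2) in auto)
    finally show ?thesis .
  qed
  have "(\<integral>\<^sup>+y\<in>cube. ennreal (exp (\<beta> * norm (grad y))) \<partial>lborel) \<le> 
      (\<integral>\<^sup>+y. (\<integral>\<^sup>+\<omega>. ennreal (ker y \<omega> * ?E \<omega>) * indicator cube y \<partial>M) \<partial>lborel)"
  proof (rule nn_integral_mono)
    fix y
    show "ennreal (exp (\<beta> * norm (grad y))) * indicator cube y \<le> (\<integral>\<^sup>+\<omega>. ennreal (ker y \<omega> * ?E \<omega>) * indicator cube y \<partial>M)"
      using pw[of y] by (auto simp: indicator_def)
  qed
  also have "\<dots> = (\<integral>\<^sup>+\<omega>. (\<integral>\<^sup>+y. ennreal (ker y \<omega> * ?E \<omega>) * indicator cube y \<partial>lborel) \<partial>M)"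
  proof -
    interpret L: pair_sigma_finite M "lborel :: (real ^ 'n) measure" ..
    show ?thesis by (rule L.Fubini') measurable
  qed
  also have "\<dots> = (\<integral>\<^sup>+\<omega>. ennreal (?E \<omega>) \<partial>M)"
  proof (rule nn_integral_cong)
    fix \<omega>
    have "(\<integral>\<^sup>+y. ennreal (ker y \<omega> * ?E \<omega>) * indicator cube y \<partial>lborel) = 
      (\<integral>\<^sup>+y. ennreal (?E \<omega>) * (ennreal (ker y \<omega>) * indicator cube y) \<partial>lborel)"
      using \<rho>(2) by (intro nn_integral_cong) (simp add: ennreal_mult mult_ac)
    also have "\<dots> = ennreal (?E \<omega>) * (\<integral>\<^sup>+y\<in>cube. ennreal (ker y \<omega>) \<partial>lborel)"
      by (rule nn_integral_cmult) measurable
    also have "(\<integral>\<^sup>+y\<in>cube. ennreal (ker y \<omega>) \<partial>lborel) = 1"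
      by (subst nn_integral_cube_translate[where F = "\<lambda>x. ennreal (\<rho> x)"]) (use \<rho> trig_periodic[OF \<rho>(1)] in \<open>auto simp: periodic_def\<close>)
    finally show "(\<integral>\<^sup>+y. ennreal (ker y \<omega> * ?E \<omega>) * indicator cube y \<partial>lborel) = ennreal (?E \<omega>)" by simp
  qed
  also have "\<dots> \<le> ennreal K" by (rule exp_M)
  finally show ?thesis .
qed

lemma smooth_field: "smooth_field \<beta> K field grad"
  using field_periodic grad_periodic field_has_derivative grad_continuous exp_grad by (simp add: smooth_field_def)

lemma trace_grad:
  assumes L: "AE \<omega> in M. \<bar>trace (Dbp \<omega>)\<bar> \<le> L"
  shows "\<bar>trace (grad y)\<bar> \<le> L"
proof -
  have bl: "bounded_linear (trace :: real ^ 'n ^ 'n \<Rightarrow> real)"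
    by (rule linear_conv_bounded_linear[THEN iffD1], rule linearI) (simp_all add: trace_def sum.distrib sum_distrib_left)
  note i = kernel_integrable[OF Db_int, of y]
  have tr: "trace (c *\<^sub>R A) = c * trace A" for c and A :: "real ^ 'n ^ 'n" by (simp add: trace_def sum_distrib_left)
  have it: "integrable M (\<lambda>\<omega>. ker y \<omega> * trace (Dbp \<omega>))"
    using integrable_bounded_linear[OF bl i] by (simp add: tr)
  have "trace (grad y) = (\<integral>\<omega>. ker y \<omega> * trace (Dbp \<omega>) \<partial>M)"
    unfolding grad_def using integral_bounded_linear[OF bl i] by (simp add: tr)
  also have "norm \<dots> \<le> (\<integral>\<omega>. norm (ker y \<omega> * trace (Dbp \<omega>)) \<partial>M)"
    by (rule integral_norm_bound)
  also have "\<dots> \<le> (\<integral>\<omega>. ker y \<omega> * L \<partial>M)"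
  proof (rule integral_mono_AE)
    show "AE \<omega> in M. norm (ker y \<omega> * trace (Dbp \<omega>)) \<le> ker y \<omega> * L"
      using L by eventually_elim (use \<rho>(2) in \<open>auto simp: abs_mult intro: mult_left_mono\<close>)
  qed (use it kernel_integral(1) in auto)
  also have "\<dots> = L" using kernel_integral[of y] by simp
  finally show ?thesis by simp
qed

text \<open>Split the kernel into its part near the lattice, where b varies by at most \<epsilon>, and its tail of
  mass \<eta>, where b varies by at most S.\<close>

lemma field_approx:
  assumes near: "\<And>a p q. a \<in> space P \<Longrightarrow> dist p q < r \<Longrightarrow> norm (b a p - b a q) \<le> \<epsilon>"
    and all: "\<And>a p q. a \<in> space P \<Longrightarrow> norm (b a p - b a q) \<le> S"
    and tail: "(\<integral>\<^sup>+x\<in>cube. ennreal (\<rho> x) * indicator {x. far r x} x \<partial>lborel) \<le> ennreal \<eta>"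
    and pos: "\<epsilon> \<ge> 0" "S \<ge> 0" "\<eta> \<ge> 0"
    and bi: "integrable P (\<lambda>a. b a (torus_proj y))"
  shows "norm (field y - (\<integral>a. b a (torus_proj y) \<partial>P)) \<le> \<epsilon> + S * \<eta>"
proof -
  let ?q = "torus_proj y" and ?k = "\<lambda>\<omega>. ker y \<omega>"
  let ?far = "\<lambda>\<omega>. far r (y - cube_rep (snd \<omega>))"
  have perk: "periodic (\<lambda>x. ennreal (\<rho> x) * indicator {x. far r x} x)"
    using trig_periodic[OF \<rho>(1)] far_periodic[where 'n = 'n and r = r] by (auto simp: periodic_def indicator_def)
  have tailM: "(\<integral>\<^sup>+\<omega>. ennreal (?k \<omega>) * indicator {x. far r x} (y - cube_rep (snd \<omega>)) \<partial>M) \<le> ennreal \<eta>"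
  proof -
    have "(\<integral>\<^sup>+p. ennreal (\<rho> (y - cube_rep p)) * indicator {x. far r x} (y - cube_rep p) \<partial>torus_measure) \<le> ennreal \<eta>"
      using tail by (subst nn_integral_torus_kernel[OF _ perk]) auto
    then show ?thesis using nn_integral_mono[of P "\<lambda>a. \<integral>\<^sup>+p. ennreal (\<rho> (y - cube_rep p)) * indicator {x. far r x} (y - cube_rep p) \<partial>torus_measure" "\<lambda>_. ennreal \<eta>"]
      by (subst nn_integral_M) (simp_all add: emeasure_space_1)
  qed
  have iq: "integrable M (\<lambda>\<omega>. b (fst \<omega>) ?q)"
  proof (rule integrableI_bounded)
    have [measurable]: "(\<lambda>a. b a ?q) \<in> borel_measurable P" using bi by simp
    show "(\<lambda>\<omega>. b (fst \<omega>) ?q) \<in> borel_measurable M" by measurable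
    have "(\<integral>\<^sup>+\<omega>. ennreal (norm (b (fst \<omega>) ?q)) \<partial>M) = (\<integral>\<^sup>+a. ennreal (norm (b a ?q)) \<partial>P)"
      by (subst nn_integral_M) (simp_all add: T.emeasure_space_1[simplified])
    also have "\<dots> < \<infinity>" using bi by (simp add: integrable_iff_bounded)
    finally show "(\<integral>\<^sup>+\<omega>. ennreal (norm (b (fst \<omega>) ?q)) \<partial>M) < \<infinity>" .
  qed
  have "(\<integral>a. b a ?q \<partial>P) = (\<integral>\<omega>. ?k \<omega> *\<^sub>R b (fst \<omega>) ?q \<partial>M)"
  proof -
    have "(\<integral>\<omega>. ?k \<omega> *\<^sub>R b (fst \<omega>) ?q \<partial>M) = (\<integral>a. (\<integral>p. \<rho> (y - cube_rep p) *\<^sub>R b a ?q \<partial>torus_measure) \<partial>P)"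
      using integral_fst'[OF kernel_integrable[OF iq, of y]] by simp
    also have "\<dots> = (\<integral>a. b a ?q \<partial>P)"
    proof -
      have n1: "(\<integral>\<^sup>+p. ennreal (\<rho> (y - cube_rep p)) \<partial>torus_measure) = 1"
        by (subst nn_integral_torus_kernel[where h = "\<lambda>x. ennreal (\<rho> x)"]) (use \<rho> trig_periodic[OF \<rho>(1)] in \<open>auto simp: periodic_def\<close>)
      have "integrable torus_measure (\<lambda>p. \<rho> (y - cube_rep p))" "(\<integral>p. \<rho> (y - cube_rep p) \<partial>torus_measure) = 1"
        using n1 \<rho>(2) by (auto intro!: integrableI_nonneg simp: integral_eq_nn_integral)
      then show ?thesis by (simp add: integral_scaleR_left)
    qed
    finally show ?thesis by simp
  qed
  then have "field y - (\<integral>a. b a ?q \<partial>P) = (\<integral>\<omega>. ?k \<omega> *\<^sub>R bp \<omega> - ?k \<omega> *\<^sub>R b (fst \<omega>) ?q \<partial>M)"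
    unfolding field_def using kernel_integrable[OF b_int'] kernel_integrable[OF iq] by simp
  also have "ennreal (norm \<dots>) \<le> (\<integral>\<^sup>+\<omega>. ennreal (norm (?k \<omega> *\<^sub>R bp \<omega> - ?k \<omega> *\<^sub>R b (fst \<omega>) ?q)) \<partial>M)"
    by (rule integral_norm_bound_ennreal) (use kernel_integrable[OF b_int'] kernel_integrable[OF iq] in auto)
  also have "\<dots> \<le> (\<integral>\<^sup>+\<omega>. ennreal \<epsilon> * ennreal (?k \<omega>) + ennreal S * (ennreal (?k \<omega>) * indicator {x. far r x} (y - cube_rep (snd \<omega>))) \<partial>M)"
  proof (rule nn_integral_mono)
    fix \<omega> assume "\<omega> \<in> space M"
    then have a: "fst \<omega> \<in> space P" by (auto simp: space_pair_measure)
    have "norm (bp \<omega> - b (fst \<omega>) ?q) \<le> \<epsilon> + S * indicator {x. far r x} (y - cube_rep (snd \<omega>))"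
    proof (cases "?far \<omega>")
      case True
      then show ?thesis using all[OF a, of "snd \<omega>" ?q] pos by simp
    next
      case False
      then obtain k where k: "k \<in> int_lattice" "norm (y - cube_rep (snd \<omega>) - k) < r" by (auto simp: far_def)
      have "dist (snd \<omega>) ?q = dist (torus_proj (cube_rep (snd \<omega>) + k)) ?q" using k(1) by (simp add: torus_proj_add)
      also have "\<dots> \<le> dist (cube_rep (snd \<omega>) + k) y" by (rule dist_torus_proj_le)
      also have "\<dots> < r" using k(2) by (simp add: dist_norm norm_minus_commute algebra_simps)
      finally show ?thesis using near[OF a] False by simp
    qed
    then have "?k \<omega> * norm (bp \<omega> - b (fst \<omega>) ?q) \<le> ?k \<omega> * (\<epsilon> + S * indicator {x. far r x} (y - cube_rep (snd \<omega>)))"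
      using \<rho>(2) by (rule mult_left_mono)
    then have "ennreal (norm (?k \<omega> *\<^sub>R bp \<omega> - ?k \<omega> *\<^sub>R b (fst \<omega>) ?q)) \<le> ennreal (?k \<omega> * (\<epsilon> + S * indicator {x. far r x} (y - cube_rep (snd \<omega>))))"
      using \<rho>(2) by (intro ennreal_leI) (simp flip: scaleR_diff_right)
    also have "\<dots> = ennreal \<epsilon> * ennreal (?k \<omega>) + ennreal S * (ennreal (?k \<omega>) * indicator {x. far r x} (y - cube_rep (snd \<omega>)))"
      using \<rho>(2) pos by (simp add: indicator_def distrib_left ennreal_mult mult_ac)
    finally show "ennreal (norm (?k \<omega> *\<^sub>R bp \<omega> - ?k \<omega> *\<^sub>R b (fst \<omega>) ?q)) \<le>
       ennreal \<epsilon> * ennreal (?k \<omega>) + ennreal S * (ennreal (?k \<omega>) * indicator {x. far r x} (y - cube_rep (snd \<omega>)))" .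
  qed
  also have "\<dots> = ennreal \<epsilon> * 1 + ennreal S * (\<integral>\<^sup>+\<omega>. ennreal (?k \<omega>) * indicator {x. far r x} (y - cube_rep (snd \<omega>)) \<partial>M)"
    by (subst nn_integral_add) (simp_all add: nn_integral_cmult kernel_M)
  also have "\<dots> \<le> ennreal \<epsilon> * 1 + ennreal S * ennreal \<eta>" by (intro add_left_mono mult_left_mono tailM) auto
  also have "\<dots> = ennreal (\<epsilon> + S * \<eta>)" using pos by (simp add: ennreal_mult)
  finally show ?thesis using pos by (subst (asm) ennreal_le_iff) auto
qed

end


section \<open>Compression of measure by maps close to the identity\<close>

lemma prod_one_plus_bounds:
  fixes f :: "'a \<Rightarrow> real"
  assumes "finite S" "\<And>i. i \<in> S \<Longrightarrow> \<bar>f i\<bar> \<le> a" "a \<le> 1" "0 \<le> a"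
  shows "\<bar>\<Prod>i\<in>S. 1 + f i\<bar> \<le> 2 ^ card S" 
    "\<bar>(\<Prod>i\<in>S. 1 + f i) - 1\<bar> \<le> 2 ^ card S * a" 
    "\<bar>(\<Prod>i\<in>S. 1 + f i) - 1 - (\<Sum>i\<in>S. f i)\<bar> \<le> 4 ^ card S * a\<^sup>2"
proof -
  have "\<bar>\<Prod>i\<in>S. 1 + f i\<bar> \<le> 2 ^ card S \<and> \<bar>(\<Prod>i\<in>S. 1 + f i) - 1\<bar> \<le> 2 ^ card S * a \<and>
    \<bar>(\<Prod>i\<in>S. 1 + f i) - 1 - (\<Sum>i\<in>S. f i)\<bar> \<le> 4 ^ card S * a\<^sup>2"
    using assms(1,2)
  proof (induction S rule: finite_induct)
    case (insert j S)
    let ?p = "\<Prod>i\<in>S. 1 + f i" and ?s = "\<Sum>i\<in>S. f i" and ?n = "card S"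
    have IH: "\<bar>?p\<bar> \<le> 2 ^ ?n" "\<bar>?p - 1\<bar> \<le> 2 ^ ?n * a" "\<bar>?p - 1 - ?s\<bar> \<le> 4 ^ ?n * a\<^sup>2"
      using insert by auto
    have fj: "\<bar>f j\<bar> \<le> a" "\<bar>1 + f j\<bar> \<le> 2" using insert.prems[of j] assms(3) by auto
    have 1: "\<bar>(1 + f j) * ?p\<bar> \<le> 2 * 2 ^ ?n" unfolding abs_mult by (rule mult_mono[OF fj(2) IH(1)]) auto
    have "\<bar>f j * ?p\<bar> \<le> a * 2 ^ ?n" unfolding abs_mult by (rule mult_mono[OF fj(1) IH(1)]) (use assms(4) in auto)
    note t = order_trans[OF abs_triangle_ineq add_mono[OF IH(2) this]]
    have "(1 + f j) * ?p - 1 = (?p - 1) + f j * ?p" by (simp add: algebra_simps)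
    then have "\<bar>(1 + f j) * ?p - 1\<bar> \<le> 2 ^ ?n * a + a * 2 ^ ?n" using t by simp
    also have "\<dots> = 2 * 2 ^ ?n * a" by simp
    finally have 2: "\<bar>(1 + f j) * ?p - 1\<bar> \<le> 2 * 2 ^ ?n * a" .
    have "\<bar>f j * (?p - 1)\<bar> \<le> a * (2 ^ ?n * a)" unfolding abs_mult by (rule mult_mono[OF fj(1) IH(2)]) (use assms(4) in auto)
    also have "\<dots> \<le> 4 ^ ?n * a\<^sup>2"
      using mult_right_mono[OF power_mono[of 2 4 ?n], of "a\<^sup>2"] by (simp add: power2_eq_square mult_ac)
    finally have "\<bar>f j * (?p - 1)\<bar> \<le> 4 ^ ?n * a\<^sup>2" .
    note t = order_trans[OF abs_triangle_ineq add_mono[OF IH(3) this]]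
    have "(1 + f j) * ?p - 1 - (f j + ?s) = (?p - 1 - ?s) + f j * (?p - 1)" by (simp add: algebra_simps)
    then have "\<bar>(1 + f j) * ?p - 1 - (f j + ?s)\<bar> \<le> 4 ^ ?n * a\<^sup>2 + 4 ^ ?n * a\<^sup>2" using t by simp
    also have "\<dots> \<le> 4 * (4 ^ ?n * a\<^sup>2)" by simp
    finally have 3: "\<bar>(1 + f j) * ?p - 1 - (f j + ?s)\<bar> \<le> 4 * (4 ^ ?n * a\<^sup>2)" .
    show ?case unfolding prod.insert[OF insert.hyps] sum.insert[OF insert.hyps] card_insert_disjoint[OF insert.hyps] power_Suc
      using 1 2 3 unfolding mult.assoc by (intro conjI)
  next
    case empty
    show ?case using assms(4) by simp
  qed
  then show "\<bar>\<Prod>i\<in>S. 1 + f i\<bar> \<le> 2 ^ card S" "\<bar>(\<Prod>i\<in>S. 1 + f i) - 1\<bar> \<le> 2 ^ card S * a" 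
    "\<bar>(\<Prod>i\<in>S. 1 + f i) - 1 - (\<Sum>i\<in>S. f i)\<bar> \<le> 4 ^ card S * a\<^sup>2" by blast+
qed

definition det_const :: "nat \<Rightarrow> real" where
  "det_const n = 4 ^ n + fact n * 2 ^ n"

text \<open>In the Leibniz expansion the identity permutation contributes 1 + trace A up to a quadratic
  error, and every other permutation has two off-diagonal factors, each of size at most a.\<close>

lemma det_near_identity:
  fixes A :: "real ^ 'm::finite ^ 'm"
  assumes A: "\<And>i j. \<bar>A $ i $ j\<bar> \<le> a" and a: "a \<le> 1"
  shows "\<bar>det (mat 1 + A) - 1 - trace A\<bar> \<le> det_const CARD('m) * a\<^sup>2"
proof -
  let ?n = "CARD('m)"
  let ?P = "{p. p permutes (UNIV :: 'm set)}"
  let ?t = "\<lambda>p. of_int (sign p) * (\<Prod>i\<in>UNIV. (mat 1 + A) $ i $ p i)"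
  have a0: "a \<ge> 0" using A[of undefined undefined] by linarith
  have finP: "finite ?P" by (rule finite_permutations) simp
  have "det (mat 1 + A) = ?t id + (\<Sum>p\<in>?P - {id}. ?t p)"
    unfolding det_def by (rule sum.remove[OF finP]) (simp add: permutes_id)
  moreover have "?t id = (\<Prod>i\<in>UNIV. 1 + A $ i $ i)" by (simp add: sign_id mat_def)
  moreover have "\<bar>(\<Prod>i\<in>UNIV. 1 + A $ i $ i) - 1 - trace A\<bar> \<le> 4 ^ ?n * a\<^sup>2"
    unfolding trace_def using prod_one_plus_bounds(3)[of UNIV "\<lambda>i. A $ i $ i" a] A a a0 by auto
  moreover have "\<bar>\<Sum>p\<in>?P - {id}. ?t p\<bar> \<le> fact ?n * (2 ^ ?n * a\<^sup>2)"
  proof -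
    have "\<bar>\<Sum>p\<in>?P - {id}. ?t p\<bar> \<le> (\<Sum>p\<in>?P - {id}. \<bar>?t p\<bar>)" by (rule sum_abs)
    also have "\<dots> \<le> (\<Sum>p\<in>?P - {id}. 2 ^ ?n * a\<^sup>2)"
    proof (rule sum_mono)
      fix p assume p: "p \<in> ?P - {id}"
      then obtain i where i: "p i \<noteq> i" by (auto simp: fun_eq_iff)
      have inj: "inj p" using p permutes_inj by auto
      define j where "j = p i"
      have j: "j \<noteq> i" "p j \<noteq> j" using i inj by (auto simp: j_def inj_def)
      let ?f = "\<lambda>k. \<bar>(mat 1 + A) $ k $ p k\<bar>"
      have f2: "?f k \<le> 2" for k using A[of k "p k"] a by (auto simp: mat_def)
      have fi: "?f i \<le> a" "?f j \<le> a" using A[of i "p i"] A[of j "p j"] i j by (auto simp: mat_def)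
      have "\<bar>?t p\<bar> = (\<Prod>k\<in>UNIV. ?f k)" by (simp add: abs_mult abs_prod sign_def)
      also have "\<dots> = ?f i * (?f j * (\<Prod>k\<in>UNIV - {i} - {j}. ?f k))"
        using j by (subst prod.remove[of UNIV i], simp, simp, subst prod.remove[of "UNIV - {i}" j]) auto
      also have "\<dots> \<le> a * (a * 2 ^ ?n)"
      proof (intro mult_mono fi)
        have "(\<Prod>k\<in>UNIV - {i} - {j}. ?f k) \<le> (\<Prod>k\<in>UNIV - {i} - {j}. 2)" using f2 by (intro prod_mono) auto
        also have "\<dots> = 2 ^ card (UNIV - {i} - {j} :: 'm set)" by simp
        also have "\<dots> \<le> 2 ^ ?n" by (intro power_increasing card_mono) auto
        finally show "(\<Prod>k\<in>UNIV - {i} - {j}. ?f k) \<le> 2 ^ ?n" .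
      qed (auto intro!: mult_nonneg_nonneg prod_nonneg a0)
      also have "\<dots> = 2 ^ ?n * a\<^sup>2" by (simp add: power2_eq_square mult_ac)
      finally show "\<bar>?t p\<bar> \<le> 2 ^ ?n * a\<^sup>2" .
    qed
    also have "\<dots> = real (card (?P - {id})) * (2 ^ ?n * a\<^sup>2)" by simp
    also have "\<dots> \<le> fact ?n * (2 ^ ?n * a\<^sup>2)"
    proof (intro mult_right_mono)
      have "card (?P - {id}) \<le> card ?P" using finP by (intro card_mono) auto
      also have "card ?P = fact ?n" by (rule card_permutations) auto
      finally show "real (card (?P - {id})) \<le> fact ?n" by (metis of_nat_fact of_nat_le_iff)
    qed auto
    finally show ?thesis .
  qed
  ultimately have "\<bar>det (mat 1 + A) - 1 - trace A\<bar> \<le> 4 ^ ?n * a\<^sup>2 + fact ?n * (2 ^ ?n * a\<^sup>2)" by linarith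
  then show ?thesis by (simp add: det_const_def algebra_simps)
qed

text \<open>The change of variables theorem concerns vectors indexed by a well-ordered type. The type idx is
  a well-ordered copy of a finite type, and reindexing preserves Lebesgue measure.\<close>

typedef 'n idx = "UNIV :: 'n set" morphisms of_idx to_idx ..

lemma of_to_idx [simp]: "of_idx (to_idx i) = i" by (simp add: to_idx_inverse)
lemma to_of_idx [simp]: "to_idx (of_idx i) = i" by (rule of_idx_inverse)

lemma bij_to_idx: "bij to_idx" and bij_of_idx: "bij of_idx"
  by (rule bij_betw_byWitness[where f' = of_idx], auto) (rule bij_betw_byWitness[where f' = to_idx], auto)

instance idx :: (finite) finite
proof
  have "finite (to_idx ` (UNIV :: 'a set))" by (intro finite_imageI finite_class.finite_UNIV)
  then show "finite (UNIV :: 'a idx set)" unfolding bij_is_surj[OF bij_to_idx] .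
qed

definition idx_rank :: "'n::finite idx \<Rightarrow> nat" where
  "idx_rank i = (SOME f. inj f) (of_idx i)"

lemma idx_rank_inj: "idx_rank (i :: 'a::finite idx) = idx_rank j \<longleftrightarrow> i = j"
proof -
  have "\<exists>f :: 'a \<Rightarrow> nat. inj f" using finite_imp_inj_to_nat_seg[of "UNIV :: 'a set"] by auto
  then have "inj (SOME f :: 'a \<Rightarrow> nat. inj f)" by (rule someI_ex)
  then show ?thesis unfolding idx_rank_def by (simp only: inj_eq of_idx_inject)
qed

instantiation idx :: (finite) wellorder
begin
definition less_eq_idx :: "'a idx \<Rightarrow> 'a idx \<Rightarrow> bool" where "less_eq_idx i j \<longleftrightarrow> idx_rank i \<le> idx_rank j"
definition less_idx :: "'a idx \<Rightarrow> 'a idx \<Rightarrow> bool" where "less_idx i j \<longleftrightarrow> idx_rank i < idx_rank j"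
instance
proof
  fix P :: "'a idx \<Rightarrow> bool" and a assume step: "\<And>x. (\<And>y. y < x \<Longrightarrow> P y) \<Longrightarrow> P x"
  show "P a"
  proof (induction a rule: measure_induct_rule[where f = idx_rank])
    case (less x)
    show ?case by (rule step, rule less.IH) (simp add: less_idx_def)
  qed
qed (auto simp: less_eq_idx_def less_idx_def idx_rank_inj)
end

lemma CARD_idx: "CARD('n idx) = CARD('n::finite)"
  using bij_betw_same_card[OF bij_of_idx] by simp

definition to_vec_idx :: "real ^ 'n \<Rightarrow> real ^ 'n idx" where "to_vec_idx x = (\<chi> i. x $ of_idx i)"
definition of_vec_idx :: "real ^ 'n idx \<Rightarrow> real ^ 'n" where "of_vec_idx x = (\<chi> i. x $ to_idx i)"

lemma vec_idx_inverse [simp]: "of_vec_idx (to_vec_idx x) = x" "to_vec_idx (of_vec_idx y) = y"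
  by (simp_all add: to_vec_idx_def of_vec_idx_def vec_eq_iff)

lemma linear_vec_idx: "linear (to_vec_idx :: real ^ 'n::finite \<Rightarrow> _)" "linear (of_vec_idx :: _ \<Rightarrow> real ^ 'n::finite)"
  by (auto intro!: linearI simp: to_vec_idx_def of_vec_idx_def vec_eq_iff)

lemma prod_Basis_vec: "(\<Prod>b\<in>Basis. (x :: real ^ 'n::finite) \<bullet> b) = (\<Prod>i\<in>UNIV. x $ i)"
proof -
  have B: "(Basis :: (real ^ 'n) set) = (\<lambda>i. axis i 1) ` UNIV" by (auto simp: Basis_vec_def)
  show ?thesis unfolding B by (subst prod.reindex) (auto simp: inj_on_def axis_eq_axis inner_axis)
qed

lemma to_vec_idx_measurable [measurable]: "(to_vec_idx :: real ^ 'n::finite \<Rightarrow> _) \<in> borel_measurable borel"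
  and of_vec_idx_measurable [measurable]: "(of_vec_idx :: _ \<Rightarrow> real ^ 'n::finite) \<in> borel_measurable borel"
  by (intro borel_measurable_continuous_onI linear_continuous_on linear_conv_bounded_linear[THEN iffD1] linear_vec_idx)+

lemma distr_to_vec_idx: "distr lborel borel (to_vec_idx :: real ^ 'n::finite \<Rightarrow> _) = lborel"
proof (rule lborel_eqI[symmetric])
  fix l u :: "real ^ 'n idx" assume lu: "\<And>b. b \<in> Basis \<Longrightarrow> l \<bullet> b \<le> u \<bullet> b"
  have all: "(\<forall>i :: 'n idx. Q (of_idx i)) \<longleftrightarrow> (\<forall>i. Q i)" for Q by (metis of_to_idx)
  have lu': "l $ i \<le> u $ i" for i using lu[of "axis i 1"] by (simp add: inner_axis axis_in_Basis_iff)
  have "to_vec_idx -` box l u = box (of_vec_idx l) (of_vec_idx u :: real ^ 'n)"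
    using all[of "\<lambda>i. l $ to_idx i < _ $ i \<and> _ $ i < u $ to_idx i"] 
    by (auto simp: mem_box_cart to_vec_idx_def of_vec_idx_def)
  then have "emeasure (distr lborel borel (to_vec_idx :: real ^ 'n \<Rightarrow> _)) (box l u) = emeasure lborel (box (of_vec_idx l) (of_vec_idx u :: real ^ 'n))"
    by (subst emeasure_distr) auto
  also have "\<dots> = ennreal (\<Prod>b\<in>Basis. (of_vec_idx u - of_vec_idx l :: real ^ 'n) \<bullet> b)"
    by (rule emeasure_lborel_box) (auto simp: Basis_vec_def inner_axis of_vec_idx_def lu')
  also have "(\<Prod>b\<in>Basis. (of_vec_idx u - of_vec_idx l :: real ^ 'n) \<bullet> b) = (\<Prod>i\<in>UNIV. u $ to_idx i - l $ to_idx i)"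
    unfolding prod_Basis_vec by (simp add: of_vec_idx_def)
  also have "\<dots> = (\<Prod>i\<in>UNIV. u $ i - l $ i)" 
    by (rule prod.reindex_bij_betw[OF bij_to_idx])
  also have "\<dots> = (\<Prod>b\<in>Basis. (u - l) \<bullet> b)" unfolding prod_Basis_vec by simp
  finally show "emeasure (distr lborel borel (to_vec_idx :: real ^ 'n \<Rightarrow> _)) (box l u) = ennreal (\<Prod>b\<in>Basis. (u - l) \<bullet> b)" .
qed simp

lemma emeasure_to_vec_idx:
  assumes [measurable]: "S \<in> sets borel"
  shows "to_vec_idx ` (S :: (real ^ 'n::finite) set) \<in> sets borel" "emeasure lborel (to_vec_idx ` S) = emeasure lborel S"
proof -
  have im: "to_vec_idx ` S = of_vec_idx -` S \<inter> space borel"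
    by (auto intro!: image_eqI[of _ to_vec_idx "of_vec_idx _"])
  show b: "to_vec_idx ` S \<in> sets borel" unfolding im by measurable
  have "emeasure lborel (to_vec_idx ` S) = emeasure (distr lborel borel to_vec_idx) (to_vec_idx ` S)"
    by (simp only: distr_to_vec_idx)
  also have "\<dots> = emeasure lborel (to_vec_idx -` to_vec_idx ` S)" using b by (subst emeasure_distr) auto
  also have "to_vec_idx -` to_vec_idx ` S = S" by (auto dest: arg_cong[where f = of_vec_idx])
  finally show "emeasure lborel (to_vec_idx ` S) = emeasure lborel S" .
qed

lemma measure_image_near_identity:
  fixes f :: "real ^ 'm::{finite,wellorder} \<Rightarrow> real ^ 'm::_"
  assumes der: "\<And>x. (f has_derivative (\<lambda>h. h + A x *v h)) (at x)" and inj: "inj f"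
    and A: "\<And>x i j. \<bar>A x $ i $ j\<bar> \<le> a" and a: "a \<le> 1" and tr: "\<And>x. \<bar>trace (A x)\<bar> \<le> \<tau>"
    and S: "S \<in> lmeasurable"
  defines "\<kappa> \<equiv> \<tau> + det_const CARD('m) * a\<^sup>2"
  shows "f ` S \<in> lmeasurable" "measure lebesgue (f ` S) \<le> (1 + \<kappa>) * measure lebesgue S"
    "(1 - \<kappa>) * measure lebesgue S \<le> measure lebesgue (f ` S)"
proof -
  let ?f' = "\<lambda>x h. h + A x *v h"
  have mat: "matrix (?f' x) = mat 1 + A x" for x
  proof -
    have "?f' x = (\<lambda>h. (mat 1 + A x) *v h)" by (simp add: matrix_vector_mult_add_rdistrib)
    then show ?thesis by (simp add: matrix_of_matrix_vector_mul)
  qed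
  have det: "\<bar>det (matrix (?f' x))\<bar> \<le> 1 + \<kappa>" "1 - \<kappa> \<le> \<bar>det (matrix (?f' x))\<bar>" for x
    using det_near_identity[of "A x" a] A a tr[of x] unfolding mat \<kappa>_def by (smt (verit))+
  have der': "(f has_derivative ?f' x) (at x within S)" for x using der by (rule has_derivative_at_withinI)
  have Sl: "S \<in> sets lebesgue" using S by auto
  have injS: "inj_on f S" using inj inj_on_subset by blast
  have int: "(\<lambda>x. \<bar>det (matrix (?f' x))\<bar>) integrable_on S"
  proof (rule measurable_bounded_by_integrable_imp_integrable[OF _ _ _ Sl])
    have "(\<lambda>x. det (matrix (?f' x))) \<in> borel_measurable (lebesgue_on S)"
      by (rule borel_measurable_det_Jacobian[OF Sl der'])
    then show "(\<lambda>x. \<bar>det (matrix (?f' x))\<bar>) \<in> borel_measurable (lebesgue_on S)" by measurable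
    show "(\<lambda>x. 1 + \<kappa>) integrable_on S" using S by (rule integrable_on_const)
    show "norm \<bar>det (matrix (?f' x))\<bar> \<le> 1 + \<kappa>" for x using det(1) by simp
  qed
  show fS: "f ` S \<in> lmeasurable"
    using measurable_bounded_differentiable_image[OF S der' int det(1)] by simp
  show "measure lebesgue (f ` S) \<le> (1 + \<kappa>) * measure lebesgue S"
    using measure_bounded_differentiable_image[OF S der' int det(1)] by simp
  have "(1 - \<kappa>) * measure lebesgue S = integral S (\<lambda>x. (1 - \<kappa>) * 1)"
    unfolding integral_mult_right lmeasure_integral[OF S] ..
  also have "\<dots> = integral S (\<lambda>x. 1 - \<kappa>)" by simp
  also have "\<dots> \<le> integral S (\<lambda>x. \<bar>det (matrix (?f' x))\<bar>)"
    using S det(2) int by (intro integral_le) (auto simp: integrable_on_const)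
  also have "\<dots> = measure lebesgue (f ` S)"
    using measure_differentiable_image_eq[OF Sl der' injS int] by simp
  finally show "(1 - \<kappa>) * measure lebesgue S \<le> measure lebesgue (f ` S)" .
qed

text \<open>Transfer to arbitrary finite index types. The trace and the bound on the entries, unlike
  the determinant, transfer at once.\<close>

lemma emeasure_image_near_identity:
  fixes f g :: "real ^ 'n::finite \<Rightarrow> real ^ 'n"
  assumes der: "\<And>x. (f has_derivative (\<lambda>h. h + A x *v h)) (at x)" 
    and gf: "\<And>x. g (f x) = x" and fg: "\<And>y. f (g y) = y" and g[measurable]: "g \<in> borel_measurable borel"
    and A: "\<And>x i j. \<bar>A x $ i $ j\<bar> \<le> a" and a: "a \<le> 1" and tr: "\<And>x. \<bar>trace (A x)\<bar> \<le> \<tau>"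
    and S[measurable]: "S \<in> sets borel" and bd: "bounded S"
    and \<kappa>_def: "\<kappa> = \<tau> + det_const CARD('n) * a\<^sup>2" and \<kappa>: "\<kappa> < 1"
  shows "emeasure lborel (f ` S) \<le> ennreal (1 / (1 - \<kappa>)) * emeasure lborel S"
    "emeasure lborel S \<le> ennreal (1 / (1 - \<kappa>)) * emeasure lborel (f ` S)"
proof -
  let ?F = "\<lambda>y. to_vec_idx (f (of_vec_idx y))"
  let ?A = "\<lambda>y. (\<chi> i j. A (of_vec_idx y) $ of_idx i $ of_idx j) :: real ^ 'n idx ^ 'n idx"
  have bl: "bounded_linear (to_vec_idx :: real ^ 'n \<Rightarrow> _)" "bounded_linear (of_vec_idx :: _ \<Rightarrow> real ^ 'n)"
    by (intro linear_conv_bounded_linear[THEN iffD1] linear_vec_idx)+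
  have "0 \<le> \<bar>A 0 $ undefined $ undefined\<bar>" by simp
  then have a0: "0 \<le> a" using A order_trans by blast
  have \<tau>0: "0 \<le> \<tau>" using tr[of 0] by linarith
  have "det_const CARD('n) \<ge> 0" by (simp add: det_const_def)
  then have \<kappa>0: "0 \<le> \<kappa>" using \<tau>0 by (simp add: \<kappa>_def)
  have Av: "to_vec_idx (of_vec_idx h + A (of_vec_idx y) *v of_vec_idx h) = h + ?A y *v h" for y h :: "real ^ 'n idx"
  proof (rule vec_eq_iff[THEN iffD2], rule allI)
    fix i
    have "(\<Sum>j\<in>UNIV. A (of_vec_idx y) $ of_idx i $ of_idx j * h $ j) = (\<Sum>j\<in>UNIV. A (of_vec_idx y) $ of_idx i $ j * h $ to_idx j)"
      using sum.reindex_bij_betw[OF bij_of_idx, of "\<lambda>j. A (of_vec_idx y) $ of_idx i $ j * h $ to_idx j"] by simp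
    then show "to_vec_idx (of_vec_idx h + A (of_vec_idx y) *v of_vec_idx h) $ i = (h + ?A y *v h) $ i"
      by (simp add: to_vec_idx_def of_vec_idx_def matrix_vector_mult_def)
  qed
  have derF: "(?F has_derivative (\<lambda>h. h + ?A y *v h)) (at y)" for y
  proof -
    have "((\<lambda>y. f (of_vec_idx y)) has_derivative (\<lambda>h. of_vec_idx h + A (of_vec_idx y) *v of_vec_idx h)) (at y)"
      by (rule has_derivative_compose[OF bounded_linear_imp_has_derivative[OF bl(2)] der])
    then have "(?F has_derivative (\<lambda>h. to_vec_idx (of_vec_idx h + A (of_vec_idx y) *v of_vec_idx h))) (at y)"
      by (rule bounded_linear.has_derivative[OF bl(1)])
    then show ?thesis by (simp only: Av)
  qed
  have inj: "inj ?F" 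
    by (rule injI) (metis gf vec_idx_inverse)
  have trF: "trace (?A y) = trace (A (of_vec_idx y))" for y
    unfolding trace_def using sum.reindex_bij_betw[OF bij_of_idx, of "\<lambda>j. A (of_vec_idx y) $ j $ j"] by simp
  have fS: "f ` S = g -` S \<inter> space borel" using gf fg by (auto intro!: image_eqI[of _ f "g _"])
  have fSb[measurable]: "f ` S \<in> sets borel" unfolding fS by measurable
  let ?S = "to_vec_idx ` S"
  have FS: "?F ` ?S = to_vec_idx ` (f ` S)" by (auto simp: image_image)
  have fin: "emeasure lborel S < \<infinity>" using emeasure_bounded_finite[OF bd] by simp
  have Sl: "?S \<in> lmeasurable"
    by (rule fmeasurableI) (use emeasure_to_vec_idx[OF S] fin in \<open>auto simp: emeasure_completion\<close>)
  have \<kappa>': "\<tau> + det_const CARD('n idx) * a\<^sup>2 = \<kappa>" by (simp add: CARD_idx \<kappa>_def)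
  note est = measure_image_near_identity[where f = ?F and A = ?A, OF derF inj _ a _ Sl, of \<tau>, unfolded \<kappa>' trF]
  have est: "?F ` ?S \<in> lmeasurable" "measure lebesgue (?F ` ?S) \<le> (1 + \<kappa>) * measure lebesgue ?S"
    "(1 - \<kappa>) * measure lebesgue ?S \<le> measure lebesgue (?F ` ?S)"
    by (rule est; use A tr in simp)+
  have e1: "emeasure lborel S = ennreal (measure lebesgue ?S)"
    using emeasure_eq_measure2[OF Sl] emeasure_to_vec_idx[OF S] by (simp add: emeasure_completion)
  have e2: "emeasure lborel (f ` S) = ennreal (measure lebesgue (?F ` ?S))"
    using emeasure_eq_measure2[OF est(1)] emeasure_to_vec_idx[OF fSb] unfolding FS by (simp add: emeasure_completion)
  have "1 + \<kappa> \<le> 1 / (1 - \<kappa>)" using \<kappa> \<kappa>0 by (simp add: field_simps)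
  then have "(1 + \<kappa>) * measure lebesgue ?S \<le> 1 / (1 - \<kappa>) * measure lebesgue ?S" by (rule mult_right_mono) simp
  then have "measure lebesgue (?F ` ?S) \<le> 1 / (1 - \<kappa>) * measure lebesgue ?S" using est(2) by linarith
  then show "emeasure lborel (f ` S) \<le> ennreal (1 / (1 - \<kappa>)) * emeasure lborel S"
    unfolding e1 e2 using \<kappa> by (simp add: ennreal_mult[symmetric] ennreal_leI)
  have "measure lebesgue ?S \<le> 1 / (1 - \<kappa>) * measure lebesgue (?F ` ?S)"
    using est(3) \<kappa> by (simp add: field_simps)
  then show "emeasure lborel S \<le> ennreal (1 / (1 - \<kappa>)) * emeasure lborel (f ` S)"
    unfolding e1 e2 using \<kappa> by (simp add: ennreal_mult[symmetric] ennreal_leI)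
qed

text \<open>Lifts of torus maps whose push-forward of the Haar measure is at most J times the Haar measure.\<close>

definition compresses :: "real \<Rightarrow> (real ^ 'n::finite \<Rightarrow> real ^ 'n) \<Rightarrow> bool" where
  "compresses J \<Psi> \<longleftrightarrow> \<Psi> \<in> borel_measurable borel \<and> (\<forall>x. \<forall>k\<in>int_lattice. \<Psi> (x + k) = \<Psi> x + k) \<and>
     (\<forall>F. F \<in> borel_measurable borel \<longrightarrow> periodic F \<longrightarrow>
        (\<integral>\<^sup>+x\<in>cube. F (\<Psi> x) \<partial>lborel) \<le> ennreal J * (\<integral>\<^sup>+x\<in>cube. F x \<partial>lborel))"

lemma compresses_id: "compresses 1 (\<lambda>x. x)"
  by (simp add: compresses_def)

lemma compresses_comp:
  assumes "compresses J \<Psi>" "compresses J' \<Theta>" "J \<ge> 0" "J' \<ge> 0"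
  shows "compresses (J * J') (\<lambda>x. \<Psi> (\<Theta> x))"
  unfolding compresses_def
proof (intro conjI allI impI ballI)
  have [measurable]: "\<Psi> \<in> borel_measurable borel" "\<Theta> \<in> borel_measurable borel" using assms by (auto simp: compresses_def)
  show "(\<lambda>x. \<Psi> (\<Theta> x)) \<in> borel_measurable borel" by measurable
  show "\<Psi> (\<Theta> (x + k)) = \<Psi> (\<Theta> x) + k" if "k \<in> int_lattice" for x k using assms that by (auto simp: compresses_def)
  fix F :: "real ^ 'a \<Rightarrow> ennreal" assume F[measurable]: "F \<in> borel_measurable borel" and per: "periodic F"
  have "periodic (\<lambda>x. F (\<Psi> x))" using assms per by (auto simp: compresses_def periodic_def)
  then have "(\<integral>\<^sup>+x\<in>cube. F (\<Psi> (\<Theta> x)) \<partial>lborel) \<le> ennreal J' * (\<integral>\<^sup>+x\<in>cube. F (\<Psi> x) \<partial>lborel)"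
    using assms(2) unfolding compresses_def by (elim conjE allE[of _ "\<lambda>x. F (\<Psi> x)"]) auto
  also have "\<dots> \<le> ennreal J' * (ennreal J * (\<integral>\<^sup>+x\<in>cube. F x \<partial>lborel))"
    using assms(1) F per by (intro mult_left_mono) (auto simp: compresses_def)
  finally show "(\<integral>\<^sup>+x\<in>cube. F (\<Psi> (\<Theta> x)) \<partial>lborel) \<le> ennreal (J * J') * (\<integral>\<^sup>+x\<in>cube. F x \<partial>lborel)"
    using assms by (simp add: ennreal_mult mult_ac)
qed

text \<open>Both the cube and its image are fundamental domains, so the estimate reduces to comparing the
  measures of subsets of the cube with those of their images.\<close>

lemma compressesI:
  fixes \<Psi> \<Theta> :: "real ^ 'n::finite \<Rightarrow> real ^ 'n"
  assumes [measurable]: "\<Psi> \<in> borel_measurable borel" "\<Theta> \<in> borel_measurable borel"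
    and inv: "\<And>x. \<Theta> (\<Psi> x) = x" "\<And>y. \<Psi> (\<Theta> y) = y"
    and eqv: "\<And>x k. k \<in> int_lattice \<Longrightarrow> \<Psi> (x + k) = \<Psi> x + k"
    and ms: "\<And>A. A \<in> sets borel \<Longrightarrow> emeasure lborel (\<Psi> -` A \<inter> cube) \<le> ennreal J * emeasure lborel (A \<inter> \<Psi> ` cube)"
  shows "compresses J \<Psi>"
  unfolding compresses_def
proof (intro conjI allI impI ballI)
  fix F :: "real ^ 'n \<Rightarrow> ennreal" assume F[measurable]: "F \<in> borel_measurable borel" and per: "periodic F"
  have eqv': "\<Theta> (y + k) = \<Theta> y + k" if "k \<in> int_lattice" for y k
    using eqv[OF that, of "\<Theta> y"] inv(1)[of "\<Theta> y + k"] inv(2)[of y] by simp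
  have im: "\<Psi> ` cube = \<Theta> -` cube \<inter> space borel" using inv by (auto intro!: image_eqI[of _ \<Psi> "\<Theta> _"])
  have imb[measurable]: "\<Psi> ` cube \<in> sets borel" unfolding im by measurable
  have fund: "fundamental (\<Psi> ` cube)"
    unfolding fundamental_def
  proof
    fix x
    have "\<exists>!k. k \<in> int_lattice \<and> \<Theta> x - k \<in> cube" using fundamental_cube by (auto simp: fundamental_def)
    moreover have "\<Theta> x - k \<in> cube \<longleftrightarrow> x - k \<in> \<Psi> ` cube" if "k \<in> int_lattice" for k
      using eqv'[OF int_lattice_minus[OF that], of x] by (simp add: im)
    ultimately show "\<exists>!k. k \<in> int_lattice \<and> x - k \<in> \<Psi> ` cube" by (simp cong: conj_cong)
  qed
  define N1 where "N1 = distr (restrict_space lborel (cube :: (real ^ 'n) set)) borel \<Psi>"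
  define N2 where "N2 = density lborel (\<lambda>x. ennreal J * indicator (\<Psi> ` cube) x)"
  have [measurable]: "\<Psi> \<in> borel_measurable (restrict_space lborel cube)" by (rule measurable_restrict_space1) simp
  have "N1 \<le> N2"
  proof (rule le_measure[THEN iffD2])
    show "sets N1 = sets N2" by (simp add: N1_def N2_def)
    show "\<forall>A\<in>sets N1. emeasure N1 A \<le> emeasure N2 A"
    proof
      fix A assume "A \<in> sets N1"
      then have A[measurable]: "A \<in> sets borel" by (simp add: N1_def)
      have "emeasure N1 A = emeasure lborel (\<Psi> -` A \<inter> cube)"
        unfolding N1_def by (subst emeasure_distr) (auto simp: emeasure_restrict_space space_restrict_space)
      also have "\<dots> \<le> ennreal J * emeasure lborel (A \<inter> \<Psi> ` cube)" by (rule ms[OF A])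
      also have "\<dots> = (\<integral>\<^sup>+x. ennreal J * indicator (A \<inter> \<Psi> ` cube) x \<partial>lborel)" by (simp add: nn_integral_cmult_indicator)
      also have "\<dots> = emeasure N2 A" unfolding N2_def
        by (subst emeasure_density) (auto intro!: nn_integral_cong simp: indicator_def)
      finally show "emeasure N1 A \<le> emeasure N2 A" .
    qed
  qed
  then have le: "nn_integral N1 F \<le> nn_integral N2 F" by (intro nn_integral_mono_measure) (simp_all add: N1_def N2_def)
  have "(\<integral>\<^sup>+x\<in>cube. F (\<Psi> x) \<partial>lborel) = nn_integral N1 F"
    unfolding N1_def by (subst nn_integral_distr) (auto simp: nn_integral_restrict_space)
  also note le
  also have "nn_integral N2 F = ennreal J * (\<integral>\<^sup>+x\<in>\<Psi> ` cube. F x \<partial>lborel)"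
    unfolding N2_def by (subst nn_integral_density) (auto simp: nn_integral_cmult[symmetric] mult_ac intro!: nn_integral_cong)
  also have "(\<integral>\<^sup>+x\<in>\<Psi> ` cube. F x \<partial>lborel) = (\<integral>\<^sup>+x\<in>cube. F x \<partial>lborel)"
    by (rule nn_integral_fundamental[OF F imb per fund])
  finally show "(\<integral>\<^sup>+x\<in>cube. F (\<Psi> x) \<partial>lborel) \<le> ennreal J * (\<integral>\<^sup>+x\<in>cube. F x \<partial>lborel)" .
qed (use assms in auto)

lemma Lipschitz_continuous_on:
  fixes f :: "'a::real_normed_vector \<Rightarrow> 'b::real_normed_vector"
  assumes "\<And>x y. norm (f x - f y) \<le> C * norm (x - y)"
  shows "continuous_on S f"
proof -
  have "(max C 0)-lipschitz_on S f"
  proof (rule lipschitz_onI)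
    fix x y :: 'a
    have "C * norm (x - y) \<le> max C 0 * norm (x - y)" by (rule mult_right_mono) auto
    then show "dist (f x) (f y) \<le> max C 0 * dist x y" using assms[of x y] by (simp add: dist_norm)
  qed simp
  then show ?thesis by (rule lipschitz_on_continuous_on)
qed

text \<open>The map x + \<delta> v x is the identity plus a contraction, hence bijective by Banach's fixed point theorem.
  Its Jacobian differs from 1 by at most \<kappa>, and 1 + \<kappa> \<le> 1 / (1 - \<kappa>) gives the same constant
  for both directions.\<close>

lemma step_map:
  fixes v :: "real ^ 'n::finite \<Rightarrow> real ^ 'n"
  assumes der: "\<And>x. (v has_derivative (\<lambda>h. G x *v h)) (at x)" and per: "periodic v"
    and C: "\<And>x. norm (G x) \<le> C" and tr: "\<And>x. \<bar>trace (G x)\<bar> \<le> L" 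
    and \<delta>: "\<delta> > 0" "\<delta> * C \<le> 1/2" and \<kappa>_def: "\<kappa> = \<delta> * L + det_const CARD('n) * (\<delta> * C)\<^sup>2" and \<kappa>: "\<kappa> < 1"
  obtains \<Theta> where "\<And>x. \<Theta> (x + \<delta> *\<^sub>R v x) = x" "\<And>y. \<Theta> y + \<delta> *\<^sub>R v (\<Theta> y) = y"
    "compresses (1 / (1 - \<kappa>)) (\<lambda>x. x + \<delta> *\<^sub>R v x)" "compresses (1 / (1 - \<kappa>)) \<Theta>"
proof -
  let ?\<Phi> = "\<lambda>x. x + \<delta> *\<^sub>R v x"
  have lip: "norm (v x - v y) \<le> C * norm (x - y)" for x y by (rule field_Lipschitz[OF der C])
  have C0: "C \<ge> 0" using C[of 0] norm_ge_zero order_trans by blast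
  have contr: "norm (\<delta> *\<^sub>R v x - \<delta> *\<^sub>R v y) \<le> 1/2 * norm (x - y)" for x y
  proof -
    have "norm (\<delta> *\<^sub>R v x - \<delta> *\<^sub>R v y) = \<delta> * norm (v x - v y)" using \<delta>(1) by (simp flip: scaleR_diff_right)
    also have "\<dots> \<le> \<delta> * (C * norm (x - y))" using lip \<delta>(1) by (intro mult_left_mono) auto
    also have "\<dots> = (\<delta> * C) * norm (x - y)" by simp
    also have "\<dots> \<le> 1/2 * norm (x - y)" by (intro mult_right_mono \<delta>) auto
    finally show ?thesis .
  qed
  have lower: "norm (x - y) \<le> 2 * norm (?\<Phi> x - ?\<Phi> y)" for x y
  proof -
    have "x - y = (?\<Phi> x - ?\<Phi> y) - (\<delta> *\<^sub>R v x - \<delta> *\<^sub>R v y)" by simp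
    then have "norm (x - y) \<le> norm (?\<Phi> x - ?\<Phi> y) + norm (\<delta> *\<^sub>R v x - \<delta> *\<^sub>R v y)" by (metis norm_triangle_ineq4)
    then show ?thesis using contr[of x y] by linarith
  qed
  have surj: "\<exists>x. ?\<Phi> x = y" for y
  proof -
    have "\<exists>!x\<in>UNIV. y - \<delta> *\<^sub>R v x = x"
    proof (rule Banach_fix[of UNIV "1/2"])
      show "dist (y - \<delta> *\<^sub>R v x) (y - \<delta> *\<^sub>R v z) \<le> 1/2 * dist x z" for x z
        using contr[of z x] by (simp add: dist_norm norm_minus_commute)
    qed (auto simp: complete_UNIV)
    then obtain x where "y - \<delta> *\<^sub>R v x = x" by auto
    then show ?thesis by (intro exI[of _ x]) (simp add: algebra_simps)
  qed
  define \<Theta> where "\<Theta> = (\<lambda>y. SOME x. ?\<Phi> x = y)"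
  have inv2: "?\<Phi> (\<Theta> y) = y" for y unfolding \<Theta>_def using someI_ex[OF surj[of y]] .
  have inv1: "\<Theta> (?\<Phi> x) = x" for x using lower[of "\<Theta> (?\<Phi> x)" x] inv2[of "?\<Phi> x"] by simp
  have "norm (\<Theta> x - \<Theta> y) \<le> 2 * norm (x - y)" for x y using lower[of "\<Theta> x" "\<Theta> y"] by (simp only: inv2)
  then have \<Theta>m[measurable]: "\<Theta> \<in> borel_measurable borel"
    by (intro borel_measurable_continuous_onI Lipschitz_continuous_on)
  have \<Phi>m[measurable]: "?\<Phi> \<in> borel_measurable borel"
    using lip by (intro borel_measurable_continuous_onI continuous_intros Lipschitz_continuous_on)
  have eqv: "?\<Phi> (x + k) = ?\<Phi> x + k" if "k \<in> int_lattice" for x k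
    using periodicD[OF per that] by simp
  have eqv': "\<Theta> (y + k) = \<Theta> y + k" if "k \<in> int_lattice" for y k
  proof -
    have "?\<Phi> (\<Theta> y + k) = y + k" using eqv[OF that, of "\<Theta> y"] unfolding inv2 .
    then show ?thesis using inv1[of "\<Theta> y + k"] by (simp only:)
  qed
  have derP: "(?\<Phi> has_derivative (\<lambda>h. h + (\<delta> *\<^sub>R G x) *v h)) (at x)" for x
  proof -
    have "(?\<Phi> has_derivative (\<lambda>h. h + \<delta> *\<^sub>R (G x *v h))) (at x)"
      by (intro has_derivative_add has_derivative_ident has_derivative_scaleR_right der)
    then show ?thesis by (simp add: scaleR_matrix_vector_assoc)
  qed
  have A: "\<bar>(\<delta> *\<^sub>R G x) $ i $ j\<bar> \<le> \<delta> * C" for x i j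
  proof -
    have "\<bar>G x $ i $ j\<bar> \<le> norm (G x $ i)" by (rule component_le_norm_cart)
    also have "\<dots> \<le> norm (G x)" by (rule Finite_Cartesian_Product.norm_nth_le)
    also have "\<dots> \<le> C" by (rule C)
    finally show ?thesis using \<delta>(1) by (simp add: abs_mult mult_left_mono)
  qed
  have tr': "\<bar>trace (\<delta> *\<^sub>R G x)\<bar> \<le> \<delta> * L" for x
  proof -
    have "trace (\<delta> *\<^sub>R G x) = \<delta> * trace (G x)" by (simp add: trace_def sum_distrib_left)
    then show ?thesis using tr[of x] \<delta>(1) by (simp add: abs_mult mult_left_mono)
  qed
  have a1: "\<delta> * C \<le> 1" using \<delta>(2) by simp
  note est = emeasure_image_near_identity[OF derP inv1 inv2 \<Theta>m A a1 tr' _ _ \<kappa>_def \<kappa>]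
  have bcube: "bounded (cube :: (real ^ 'n) set)" using norm_cube by (auto simp: bounded_iff)
  have c1: "compresses (1 / (1 - \<kappa>)) ?\<Phi>"
  proof (rule compressesI[OF \<Phi>m \<Theta>m inv1 inv2 eqv])
    fix S :: "(real ^ 'n) set" assume S[measurable]: "S \<in> sets borel"
    have im: "?\<Phi> ` (?\<Phi> -` S \<inter> cube) = S \<inter> ?\<Phi> ` cube" by auto
    have "emeasure lborel (?\<Phi> -` S \<inter> cube) \<le> ennreal (1 / (1 - \<kappa>)) * emeasure lborel (?\<Phi> ` (?\<Phi> -` S \<inter> cube))"
    proof (rule est(2))
      have "?\<Phi> -` S \<inter> space borel \<in> sets borel" by (rule measurable_sets[OF \<Phi>m S])
      then show "?\<Phi> -` S \<inter> cube \<in> sets borel" by simp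
      show "bounded (?\<Phi> -` S \<inter> cube)" using bcube by (rule bounded_subset) auto
    qed
    then show "emeasure lborel (?\<Phi> -` S \<inter> cube) \<le> ennreal (1 / (1 - \<kappa>)) * emeasure lborel (S \<inter> ?\<Phi> ` cube)" by (simp only: im)
  qed auto
  have c2: "compresses (1 / (1 - \<kappa>)) \<Theta>"
  proof (rule compressesI[OF \<Theta>m \<Phi>m inv2 inv1 eqv'])
    fix S :: "(real ^ 'n) set" assume S[measurable]: "S \<in> sets borel"
    have im: "?\<Phi> ` (S \<inter> \<Theta> ` cube) = \<Theta> -` S \<inter> cube" 
    proof safe
      fix y assume y: "\<Theta> y \<in> S" "y \<in> cube"
      show "y \<in> ?\<Phi> ` (S \<inter> \<Theta> ` cube)" by (rule image_eqI[of _ _ "\<Theta> y"]) (use y inv2[of y] in auto)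
    qed (use inv1 inv2 in auto)
    have "\<Theta> ` cube = ?\<Phi> -` cube \<inter> space borel" using inv1 inv2 by (auto intro!: image_eqI[of _ \<Theta> "?\<Phi> _"])
    also have "\<dots> \<in> sets borel" by (rule measurable_sets[OF \<Phi>m cube_borel])
    finally have b: "\<Theta> ` cube \<in> sets borel" .
    have "bounded (\<Theta> ` cube)"
    proof -
      have "norm (\<Theta> x) \<le> norm (\<Theta> 0) + 2 * real CARD('n)" if "x \<in> cube" for x
        using \<open>\<And>x y. norm (\<Theta> x - \<Theta> y) \<le> 2 * norm (x - y)\<close>[of x 0] norm_cube[OF that] norm_triangle_ineq2[of "\<Theta> x" "\<Theta> 0"] by simp
      then show ?thesis by (auto simp: bounded_iff)
    qed
    then have "bounded (S \<inter> \<Theta> ` cube)" by (rule bounded_subset) auto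
    then have "emeasure lborel (?\<Phi> ` (S \<inter> \<Theta> ` cube)) \<le> ennreal (1 / (1 - \<kappa>)) * emeasure lborel (S \<inter> \<Theta> ` cube)"
      using b S by (intro est(1)) auto
    then show "emeasure lborel (\<Theta> -` S \<inter> cube) \<le> ennreal (1 / (1 - \<kappa>)) * emeasure lborel (S \<inter> \<Theta> ` cube)" by (simp only: im)
  qed auto
  show thesis by (rule that[OF inv1 inv2 c1 c2])
qed


section \<open>A discrete Osgood inequality\<close>

lemma one_minus_ge_exp: 
  fixes y :: real assumes "0 \<le> y" "y \<le> 1/2" shows "exp (- 2 * y) \<le> 1 - y"
proof -
  have "(1 - y) * (1 + 2 * y) = 1 + y * (1 - 2 * y)" by (simp add: algebra_simps)
  moreover have "0 \<le> y * (1 - 2 * y)" using assms by (intro mult_nonneg_nonneg) auto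
  ultimately have "1 \<le> (1 - y) * (1 + 2 * y)" by linarith
  also have "\<dots> \<le> (1 - y) * exp (2 * y)" using assms by (intro mult_left_mono exp_ge_add_one_self) auto
  finally have "exp (- (2 * y)) * 1 \<le> exp (- (2 * y)) * ((1 - y) * exp (2 * y))" by (intro mult_left_mono) auto
  also have "\<dots> = 1 - y" by (simp add: exp_minus)
  finally show ?thesis by simp
qed

text \<open>For p = max 0 (-ln E) one has -ln D \<le> p + exp (-p) / D, the tangent line bound of the logarithm,
  and exp (-p) \<le> E.\<close>

lemma modulus_le:
  assumes a: "a \<ge> 0" "A \<ge> 0" and D: "0 \<le> D" "D \<le> E" and E: "E > 0"
  shows "modulus a A D \<le> E * (a + A + A * max 0 (- ln E))"
proof -
  let ?p = "max 0 (- ln E)"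
  have "D * max 0 (- ln D) \<le> E * ?p + E"
  proof (cases "D > 0 \<and> - ln D \<ge> 0")
    case False
    then have "D * max 0 (- ln D) = 0" using D by (cases "D = 0") (auto simp: max_def)
    moreover have "0 \<le> E * ?p + E" using E by (intro add_nonneg_nonneg mult_nonneg_nonneg) auto
    ultimately show ?thesis by linarith
  next
    case True
    have ep: "exp (- ?p) \<le> E" using E by (cases "ln E \<le> 0") (auto simp: max_def)
    have "ln (exp (- ?p) / D) \<le> exp (- ?p) / D - 1" using True by (intro ln_le_minus_one) auto
    moreover have "ln (exp (- ?p) / D) = - ?p - ln D" using True by (subst ln_div) auto
    ultimately have "- ln D \<le> ?p + exp (- ?p) / D" by linarith
    then have "D * (- ln D) \<le> D * (?p + exp (- ?p) / D)" using D by (intro mult_left_mono) auto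
    also have "\<dots> = D * ?p + exp (- ?p)" using True by (simp add: algebra_simps)
    also have "\<dots> \<le> E * ?p + E" using D ep by (intro add_mono mult_right_mono) auto
    finally show ?thesis using True by (simp add: max_def)
  qed
  then have "A * (D * max 0 (- ln D)) \<le> A * (E * ?p + E)" using a by (intro mult_left_mono) auto
  moreover have "D * a \<le> E * a" using D a by (intro mult_right_mono) auto
  ultimately show ?thesis by (simp add: modulus_def algebra_simps)
qed

text \<open>Put E = max D e0 and p = max 0 (-ln E). One step multiplies E by at most
  1 + \<delta> (c + A p), so p satisfies the linear recursion p (k+1) \<ge> (1 - \<delta> A) p k - \<delta> c. Hence p n
  is large if p 0 = -ln e0 is, for a fixed total time t = n \<delta>. The logarithm thus gives a bound on all
  of [0,t] at once.\<close>

lemma discrete_Osgood: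
  fixes a A t \<epsilon> :: real
  assumes a: "a \<ge> 0" and A: "A \<ge> 0" and t: "t \<ge> 0" and \<epsilon>: "\<epsilon> > 0"
  obtains e0 where "e0 > 0"
    "\<And>D n \<delta>. \<lbrakk>D 0 = 0; \<And>k. D k \<ge> 0; \<And>k. k < n \<Longrightarrow> D (Suc k) \<le> D k + \<delta> * (e0 + modulus a A (D k)); 
       \<delta> \<ge> 0; real n * \<delta> = t; \<delta> * A \<le> 1/2\<rbrakk> \<Longrightarrow> D n \<le> \<epsilon>"
proof -
  define c where "c = 1 + a + A"
  \<comment> \<open>chosen so that \<open>exp (- 2 A t) l - t c\<close>, the final lower bound for \<open>p\<close>, exceeds \<open>- ln \<epsilon>\<close>\<close>
  define l where "l = exp (2 * A * t) * (t * c + \<bar>ln \<epsilon>\<bar> + 1)"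
  define e0 where "e0 = exp (- l)"
  have c0: "c \<ge> 0" using a A by (simp add: c_def)
  have l0: "l \<ge> 0" unfolding l_def using t c0 by (intro mult_nonneg_nonneg add_nonneg_nonneg) auto
  have main: "D n \<le> \<epsilon>" if D0: "D 0 = 0" and Dpos: "\<And>k. D k \<ge> 0"
     and step: "\<And>k. k < n \<Longrightarrow> D (Suc k) \<le> D k + \<delta> * (e0 + modulus a A (D k))"
     and \<delta>: "\<delta> \<ge> 0" "real n * \<delta> = t" "\<delta> * A \<le> 1/2" for D :: "nat \<Rightarrow> real" and n \<delta>
  proof -
    define E where "E = (\<lambda>k. max (D k) e0)"
    define p where "p = (\<lambda>k. max 0 (- ln (E k)))"
    have E: "E k > 0" "D k \<le> E k" "e0 \<le> E k" for k by (auto simp: E_def e0_def less_max_iff_disj)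
    have p0: "p 0 = l" using l0 by (simp add: p_def E_def D0 e0_def max_def)
    have Estep: "E (Suc k) \<le> E k * (1 + \<delta> * (c + A * p k))" if k: "k < n" for k
    proof -
      have "modulus a A (D k) \<le> E k * (a + A + A * p k)"
        unfolding p_def by (rule modulus_le[OF a A Dpos E(2) E(1)])
      then have "e0 + modulus a A (D k) \<le> E k * (c + A * p k)" using E(3)[of k] by (simp add: c_def algebra_simps)
      then have "\<delta> * (e0 + modulus a A (D k)) \<le> \<delta> * (E k * (c + A * p k))" using \<delta>(1) by (rule mult_left_mono)
      then have 1: "D (Suc k) \<le> E k * (1 + \<delta> * (c + A * p k))" using step[OF k] E(2)[of k] by (simp add: algebra_simps)
      have "0 \<le> \<delta> * (c + A * p k)" using \<delta>(1) c0 A by (intro mult_nonneg_nonneg add_nonneg_nonneg) (auto simp: p_def)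
      then have "E k * 1 \<le> E k * (1 + \<delta> * (c + A * p k))" using E(1)[of k] by (intro mult_left_mono) auto
      then have "e0 \<le> E k * (1 + \<delta> * (c + A * p k))" using E(3)[of k] by linarith
      then show ?thesis using 1 by (simp add: E_def)
    qed
    have pstep: "p (Suc k) \<ge> (1 - \<delta> * A) * p k - \<delta> * c" if k: "k < n" for k
    proof (cases "p k = 0")
      case True
      have "0 \<le> p (Suc k)" by (simp add: p_def)
      moreover have "0 \<le> \<delta> * c" using \<delta>(1) c0 by simp
      ultimately show ?thesis using True by (simp add: order_trans[of _ 0])
    next
      case False
      let ?y = "\<delta> * (c + A * p k)"
      have y: "0 \<le> ?y" using \<delta>(1) c0 A by (intro mult_nonneg_nonneg add_nonneg_nonneg) (auto simp: p_def)
      have pk: "p k = - ln (E k)" using False by (auto simp: p_def max_def split: if_splits)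
      have "ln (E (Suc k)) \<le> ln (E k * (1 + ?y))" using Estep[OF k] E(1)[of "Suc k"] by simp
      also have "\<dots> = ln (E k) + ln (1 + ?y)" using E(1)[of k] y by (subst ln_mult) auto
      also have "ln (1 + ?y) \<le> ?y" using y by (rule ln_add_one_self_le_self)
      finally have "- ln (E (Suc k)) \<ge> p k - ?y" using pk by linarith
      then have "p (Suc k) \<ge> p k - ?y" by (simp add: p_def)
      then show ?thesis by (simp add: algebra_simps)
    qed
    have dA: "0 \<le> 1 - \<delta> * A" "1 - \<delta> * A \<le> 1" "0 \<le> \<delta> * A" using \<delta> A by (auto simp: mult_nonneg_nonneg)
    have iter: "p k \<ge> (1 - \<delta> * A) ^ k * l - real k * (\<delta> * c)" if "k \<le> n" for k
      using that
    proof (induction k)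
      case 0
      then show ?case by (simp add: p0)
    next
      case (Suc k)
      have dc: "0 \<le> \<delta> * c" using \<delta>(1) c0 by simp
      have "(1 - \<delta> * A) * ((1 - \<delta> * A) ^ k * l - real k * (\<delta> * c)) \<le> (1 - \<delta> * A) * p k"
        using Suc dA by (intro mult_left_mono) auto
      moreover have "(1 - \<delta> * A) * (real k * (\<delta> * c)) \<le> 1 * (real k * (\<delta> * c))"
        using dA dc by (intro mult_right_mono) auto
      moreover have "(1 - \<delta> * A) * ((1 - \<delta> * A) ^ k * l - real k * (\<delta> * c)) = (1 - \<delta> * A) ^ Suc k * l - (1 - \<delta> * A) * (real k * (\<delta> * c))"
        by (simp add: right_diff_distrib)
      moreover have "real (Suc k) * (\<delta> * c) = real k * (\<delta> * c) + \<delta> * c" by (simp add: distrib_right)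
      ultimately show ?case using pstep[of k] Suc.prems by linarith
    qed
    have "exp (- 2 * (\<delta> * A)) ^ n \<le> (1 - \<delta> * A) ^ n"
      using one_minus_ge_exp[OF dA(3) \<delta>(3)] by (intro power_mono) auto
    also have "exp (- 2 * (\<delta> * A)) ^ n = exp (- (2 * A * t))"
      using \<delta>(2) by (simp add: exp_of_nat_mult[symmetric] mult_ac)
    finally have "exp (- (2 * A * t)) * l \<le> (1 - \<delta> * A) ^ n * l" using l0 by (rule mult_right_mono)
    moreover have "exp (- (2 * A * t)) * l = t * c + \<bar>ln \<epsilon>\<bar> + 1" by (simp add: l_def exp_minus)
    moreover have "real n * (\<delta> * c) = t * c" using \<delta>(2) by simp
    ultimately have pn: "p n \<ge> \<bar>ln \<epsilon>\<bar> + 1" using iter[of n] by linarith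
    then have "p n = - ln (E n)" by (auto simp: p_def max_def split: if_splits)
    then have "ln (E n) \<le> ln \<epsilon>" using pn by linarith
    then have "E n \<le> \<epsilon>" using E(1)[of n] \<epsilon> by simp
    then show ?thesis using E(2)[of n] by linarith
  qed
  show thesis by (rule that[of e0]) (simp add: e0_def, rule main)
qed


section \<open>Euler schemes\<close>

lemma compresses_mono: "compresses J \<Psi> \<Longrightarrow> J \<le> J' \<Longrightarrow> compresses J' \<Psi>"
  unfolding compresses_def by (meson ennreal_leI mult_right_mono order_trans zero_le)

primrec euler :: "real \<Rightarrow> (nat \<Rightarrow> real ^ 'n \<Rightarrow> real ^ 'n) \<Rightarrow> nat \<Rightarrow> real ^ 'n \<Rightarrow> real ^ 'n" where
  "euler \<delta> v 0 x = x"
| "euler \<delta> v (Suc k) x = euler \<delta> v k x + \<delta> *\<^sub>R v k (euler \<delta> v k x)"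

locale euler_scheme =
  fixes v :: "nat \<Rightarrow> real ^ 'n::finite \<Rightarrow> real ^ 'n" and G :: "nat \<Rightarrow> real ^ 'n \<Rightarrow> real ^ 'n ^ 'n"
    and \<beta> K C L \<delta> \<kappa> :: real and n :: nat
  assumes v: "\<And>k. k < n \<Longrightarrow> smooth_field \<beta> K (v k) (G k)"
    and C: "\<And>k x. k < n \<Longrightarrow> norm (G k x) \<le> C" and tr: "\<And>k x. k < n \<Longrightarrow> \<bar>trace (G k x)\<bar> \<le> L"
    and \<delta>: "\<delta> > 0" "\<delta> * C \<le> 1/2" and L: "L \<ge> 0"
    and \<kappa>_def: "\<kappa> = \<delta> * L + det_const CARD('n) * (\<delta> * C)\<^sup>2" and \<kappa>: "\<kappa> < 1"
    and \<beta>: "\<beta> > 0" and K: "K \<ge> 1" and n: "n > 0" and C0: "C \<ge> 0"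
begin

text \<open>Bound for the compression of a single step and of its inverse.\<close>

definition J :: real where "J = 1 / (1 - \<kappa>)"

abbreviation Y where "Y \<equiv> euler \<delta> v"

lemma J1: "J \<ge> 1"
proof -
  have "\<kappa> \<ge> 0" unfolding \<kappa>_def using \<delta> L by (intro add_nonneg_nonneg mult_nonneg_nonneg) (auto simp: det_const_def)
  then show ?thesis using \<kappa> by (simp add: J_def field_simps)
qed

lemma vD:
  assumes "k < n"
  shows "(v k has_derivative (\<lambda>h. G k x *v h)) (at x)" "periodic (v k)"
  using v[OF assms] by (auto simp: smooth_field_def)

lemma v_Lipschitz: "k < n \<Longrightarrow> norm (v k x - v k y) \<le> C * norm (x - y)"
  by (rule field_Lipschitz[OF vD(1) C])

lemma step_inverse:
  "\<exists>\<Theta>. \<forall>k<n. (\<forall>x. \<Theta> k (x + \<delta> *\<^sub>R v k x) = x) \<and> (\<forall>y. \<Theta> k y + \<delta> *\<^sub>R v k (\<Theta> k y) = y) \<and>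
    compresses J (\<lambda>x. x + \<delta> *\<^sub>R v k x) \<and> compresses J (\<Theta> k)"
proof -
  have "\<exists>\<Theta>. k < n \<longrightarrow> (\<forall>x. \<Theta> (x + \<delta> *\<^sub>R v k x) = x) \<and> (\<forall>y. \<Theta> y + \<delta> *\<^sub>R v k (\<Theta> y) = y) \<and>
    compresses J (\<lambda>x. x + \<delta> *\<^sub>R v k x) \<and> compresses J \<Theta>" for k
  proof (cases "k < n")
    case True
    obtain \<Theta> where "\<And>x. \<Theta> (x + \<delta> *\<^sub>R v k x) = x" "\<And>y. \<Theta> y + \<delta> *\<^sub>R v k (\<Theta> y) = y"
      "compresses (1 / (1 - \<kappa>)) (\<lambda>x. x + \<delta> *\<^sub>R v k x)" "compresses (1 / (1 - \<kappa>)) \<Theta>"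
      using step_map[OF vD(1)[OF True] vD(2)[OF True] C[OF True] tr[OF True] \<delta> \<kappa>_def \<kappa>] by blast
    then show ?thesis unfolding J_def by blast
  qed simp
  then have "\<exists>\<Theta>. \<forall>k. k < n \<longrightarrow> (\<forall>x. \<Theta> k (x + \<delta> *\<^sub>R v k x) = x) \<and> (\<forall>y. \<Theta> k y + \<delta> *\<^sub>R v k (\<Theta> k y) = y) \<and>
    compresses J (\<lambda>x. x + \<delta> *\<^sub>R v k x) \<and> compresses J (\<Theta> k)" by (intro choice allI)
  then show ?thesis .
qed

definition \<Theta> where "\<Theta> = (SOME \<Theta>. \<forall>k<n. (\<forall>x. \<Theta> k (x + \<delta> *\<^sub>R v k x) = x) \<and> (\<forall>y. \<Theta> k y + \<delta> *\<^sub>R v k (\<Theta> k y) = y) \<and>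
    compresses J (\<lambda>x. x + \<delta> *\<^sub>R v k x) \<and> compresses J (\<Theta> k))"

lemma \<Theta>:
  assumes "k < n"
  shows "\<Theta> k (x + \<delta> *\<^sub>R v k x) = x" "\<Theta> k y + \<delta> *\<^sub>R v k (\<Theta> k y) = y"
    "compresses J (\<lambda>x. x + \<delta> *\<^sub>R v k x)" "compresses J (\<Theta> k)"
  using someI_ex[OF step_inverse] assms unfolding \<Theta>_def[symmetric] by blast+

primrec Zk :: "nat \<Rightarrow> real ^ 'n \<Rightarrow> real ^ 'n" where
  "Zk 0 u = u"
| "Zk (Suc k) u = Zk k (\<Theta> k u)"

abbreviation Z where "Z \<equiv> Zk n"

lemma YZ: "k \<le> n \<Longrightarrow> Y k (Zk k u) = u"
  by (induction k arbitrary: u) (simp_all add: \<Theta>(2))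

lemma Y_compresses: "k \<le> n \<Longrightarrow> compresses (J ^ k) (Y k)"
proof (induction k)
  case 0
  then show ?case using compresses_id by simp
next
  case (Suc k)
  then show ?case using compresses_comp[OF \<Theta>(3)[of k] Suc.IH] J1 by simp
qed

lemma YZ_step: "k < n \<Longrightarrow> Y k (Z u) = \<Theta> k (Y (Suc k) (Z u))"
  by (simp add: \<Theta>(1))

text \<open>After the inverse of the whole scheme, the first k steps leave the inverses of the steps
  n - 1, ..., k, each of which compresses by at most J.\<close>

lemma YZ_compresses: "k \<le> n \<Longrightarrow> compresses (J ^ (n - k)) (\<lambda>u. Y k (Z u))"
proof (induction rule: inc_induct)
  case base
  then show ?case using compresses_id by (simp add: YZ)
next
  case (step k)
  have "compresses (J * J ^ (n - Suc k)) (\<lambda>u. \<Theta> k (Y (Suc k) (Z u)))"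
    using compresses_comp[OF \<Theta>(4)[OF step.hyps(2)] step.IH] J1 by simp
  then show ?case using step.hyps by (simp only: YZ_step[symmetric] power_Suc[symmetric] Suc_diff_Suc)
qed

text \<open>Logarithm of a bound for the expansion and the contraction of the scheme at x. The
  factor 2 comes from contraction: 1 / (1 - h) \<le> exp (2 h) for 0 \<le> h \<le> 1/2.\<close>

definition growth :: "real ^ 'n \<Rightarrow> real" where
  "growth x = (\<Sum>k<n. 2 * \<delta> * lip_at (v k) (Y k x))"

lemma lip_at_C: "k < n \<Longrightarrow> lip_at (v k) x \<le> C"
  using lip_at_le[OF v_Lipschitz, of k x] C0 by simp

lemma step_expand:
  assumes k: "k < n"
  shows "norm (Y (Suc k) x - Y (Suc k) y) \<le> exp (2 * \<delta> * lip_at (v k) (Y k x)) * norm (Y k x - Y k y)"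
    "norm (Y k x - Y k y) \<le> exp (2 * \<delta> * lip_at (v k) (Y k x)) * norm (Y (Suc k) x - Y (Suc k) y)"
proof -
  let ?h = "lip_at (v k) (Y k x)" and ?x = "Y k x" and ?y = "Y k y"
  have h: "0 \<le> \<delta> * ?h" using lip_at_nonneg[OF v_Lipschitz[OF k]] \<delta>(1) by simp
  have "\<delta> * ?h \<le> \<delta> * C" using lip_at_C[OF k, of ?x] \<delta>(1) by (intro mult_left_mono) auto
  with h \<delta>(2) have h: "0 \<le> \<delta> * ?h" "\<delta> * ?h \<le> 1/2" by linarith+
  have dv: "norm (\<delta> *\<^sub>R (v k ?x - v k ?y)) \<le> \<delta> * ?h * norm (?x - ?y)"
    using mult_left_mono[OF lip_at_bound[OF v_Lipschitz[OF k], of ?x ?y], of \<delta>] \<delta>(1) by (simp add: mult.assoc)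
  have eq: "Y (Suc k) x - Y (Suc k) y = (?x - ?y) + \<delta> *\<^sub>R (v k ?x - v k ?y)" by (simp add: algebra_simps)
  have "norm (Y (Suc k) x - Y (Suc k) y) \<le> norm (?x - ?y) + \<delta> * ?h * norm (?x - ?y)"
    unfolding eq by (rule order_trans[OF norm_triangle_ineq]) (use dv in simp)
  also have "\<dots> = (1 + \<delta> * ?h) * norm (?x - ?y)" by (simp add: algebra_simps)
  also have "\<dots> \<le> exp (2 * \<delta> * ?h) * norm (?x - ?y)"
  proof (rule mult_right_mono)
    have e: "2 * \<delta> * ?h = 2 * (\<delta> * ?h)" by simp
    show "1 + \<delta> * ?h \<le> exp (2 * \<delta> * ?h)" unfolding e using exp_ge_add_one_self[of "2 * (\<delta> * ?h)"] h by linarith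
  qed simp
  finally show "norm (Y (Suc k) x - Y (Suc k) y) \<le> exp (2 * \<delta> * ?h) * norm (?x - ?y)" .
  have "norm (?x - ?y) - norm (\<delta> *\<^sub>R (v k ?x - v k ?y)) \<le> norm (Y (Suc k) x - Y (Suc k) y)"
    unfolding eq using norm_diff_ineq by blast
  then have "(1 - \<delta> * ?h) * norm (?x - ?y) \<le> norm (Y (Suc k) x - Y (Suc k) y)" using dv by (simp add: algebra_simps)
  moreover have "exp (- 2 * (\<delta> * ?h)) * norm (?x - ?y) \<le> (1 - \<delta> * ?h) * norm (?x - ?y)"
    by (intro mult_right_mono one_minus_ge_exp h) simp
  ultimately have "exp (- 2 * (\<delta> * ?h)) * norm (?x - ?y) \<le> norm (Y (Suc k) x - Y (Suc k) y)" by linarith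
  then have "exp (2 * \<delta> * ?h) * (exp (- 2 * (\<delta> * ?h)) * norm (?x - ?y)) \<le> exp (2 * \<delta> * ?h) * norm (Y (Suc k) x - Y (Suc k) y)"
    by (rule mult_left_mono) simp
  then show "norm (?x - ?y) \<le> exp (2 * \<delta> * ?h) * norm (Y (Suc k) x - Y (Suc k) y)"
    by (simp add: exp_add[symmetric] mult.assoc[symmetric])
qed

lemma Y_expand: "norm (Y n x - Y n y) \<le> exp (growth x) * norm (x - y)"
  and Y_contract: "norm (x - y) \<le> exp (growth x) * norm (Y n x - Y n y)"
proof -
  let ?s = "\<lambda>m. \<Sum>k<m. 2 * \<delta> * lip_at (v k) (Y k x)"
  have "m \<le> n \<Longrightarrow> norm (Y m x - Y m y) \<le> exp (?s m) * norm (x - y)" for m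
  proof (induction m)
    case (Suc m)
    let ?e = "2 * \<delta> * lip_at (v m) (Y m x)"
    have "norm (Y (Suc m) x - Y (Suc m) y) \<le> exp ?e * norm (Y m x - Y m y)" using Suc.prems by (intro step_expand) auto
    also have "\<dots> \<le> exp ?e * (exp (?s m) * norm (x - y))" using Suc by (intro mult_left_mono) auto
    also have "\<dots> = exp (?s (Suc m)) * norm (x - y)" by (simp add: exp_add mult_ac)
    finally show ?case .
  qed simp
  then show "norm (Y n x - Y n y) \<le> exp (growth x) * norm (x - y)" by (simp add: growth_def)
  have "m \<le> n \<Longrightarrow> norm (x - y) \<le> exp (?s m) * norm (Y m x - Y m y)" for m
  proof (induction m)
    case (Suc m)
    let ?e = "2 * \<delta> * lip_at (v m) (Y m x)"
    have "norm (x - y) \<le> exp (?s m) * norm (Y m x - Y m y)" using Suc by simp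
    also have "\<dots> \<le> exp (?s m) * (exp ?e * norm (Y (Suc m) x - Y (Suc m) y))"
      using Suc.prems by (intro mult_left_mono step_expand(2)) auto
    also have "\<dots> = exp (?s (Suc m)) * norm (Y (Suc m) x - Y (Suc m) y)" by (simp add: exp_add mult_ac)
    finally show ?case .
  qed simp
  then show "norm (x - y) \<le> exp (growth x) * norm (Y n x - Y n y)" by (simp add: growth_def)
qed

lemma lip_at_v_measurable: "k < n \<Longrightarrow> lip_at (v k) \<in> borel_measurable borel"
  by (rule lip_at_measurable[OF v_Lipschitz])

lemma growth_measurable: "growth \<in> borel_measurable borel"
proof -
  have "(\<lambda>x. lip_at (v k) (Y k x)) \<in> borel_measurable borel" if "k < n" for k
    using measurable_compose[of "Y k" borel borel "lip_at (v k)" borel] lip_at_v_measurable[OF that] Y_compresses[of k] that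
    by (auto simp: compresses_def)
  then show ?thesis unfolding growth_def[abs_def] by (intro borel_measurable_sum borel_measurable_times) auto
qed

lemma Z_measurable: "Z \<in> borel_measurable borel"
  using YZ_compresses[of 0] by (simp add: compresses_def)

text \<open>With n \<delta> = t the exponent is the arithmetic mean over k of \<beta>/8 lip_at (v k) (W k x), so Jensen's
  inequality bounds the exponential by a mean of exponentials, each of which is controlled by the
  compression bound for W k.\<close>

lemma exp_growth_integral:
  assumes W: "\<And>k. k < n \<Longrightarrow> compresses (J ^ n) (W k)" and t: "t = real n * \<delta>"
  shows "(\<integral>\<^sup>+x\<in>cube. ennreal (exp (\<beta> / (16 * t) * (\<Sum>k<n. 2 * \<delta> * lip_at (v k) (W k x)))) \<partial>lborel)
     \<le> ennreal (J ^ n * (lip_const TYPE('n) * K))"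
proof -
  let ?e = "\<lambda>k x. exp (\<beta> / 8 * lip_at (v k) (W k x))"
  have t0: "t > 0" using t n \<delta> by simp
  have mW: "W k \<in> borel_measurable borel" if "k < n" for k using W[OF that] by (simp add: compresses_def)
  have m: "?e k \<in> borel_measurable borel" if "k < n" for k
    using measurable_compose[OF mW[OF that] lip_at_v_measurable[OF that]] by measurable
  have pw: "exp (\<beta> / (16 * t) * (\<Sum>k<n. 2 * \<delta> * lip_at (v k) (W k x))) \<le> (\<Sum>k<n. 1 / real n * ?e k x)" for x
  proof -
    have "\<beta> / (16 * t) * (\<Sum>k<n. 2 * \<delta> * lip_at (v k) (W k x)) = (\<Sum>k<n. (1 / real n) *\<^sub>R (\<beta> / 8 * lip_at (v k) (W k x)))"
      using \<delta> n by (simp add: sum_distrib_left t field_simps)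
    also have "exp \<dots> \<le> (\<Sum>k<n. 1 / real n * exp (\<beta> / 8 * lip_at (v k) (W k x)))"
      using n by (intro convex_on_sum[OF _ _ exp_convex]) auto
    finally show ?thesis .
  qed
  have "(\<integral>\<^sup>+x\<in>cube. ennreal (exp (\<beta> / (16 * t) * (\<Sum>k<n. 2 * \<delta> * lip_at (v k) (W k x)))) \<partial>lborel)
    \<le> (\<integral>\<^sup>+x. (\<Sum>k<n. ennreal (1 / real n) * (ennreal (?e k x) * indicator cube x)) \<partial>lborel)"
  proof (rule nn_integral_mono)
    fix x
    have "ennreal (exp (\<beta> / (16 * t) * (\<Sum>k<n. 2 * \<delta> * lip_at (v k) (W k x)))) \<le> ennreal (\<Sum>k<n. 1 / real n * ?e k x)"
      by (rule ennreal_leI[OF pw])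
    also have "\<dots> = (\<Sum>k<n. ennreal (1 / real n) * ennreal (?e k x))"
    proof -
      have "(\<Sum>k<n. ennreal (1 / real n) * ennreal (?e k x)) = (\<Sum>k<n. ennreal (1 / real n * ?e k x))"
        by (intro sum.cong refl ennreal_mult[symmetric]) auto
      also have "\<dots> = ennreal (\<Sum>k<n. 1 / real n * ?e k x)" by (rule sum_ennreal) auto
      finally show ?thesis by simp
    qed
    finally show "ennreal (exp (\<beta> / (16 * t) * (\<Sum>k<n. 2 * \<delta> * lip_at (v k) (W k x)))) * indicator cube x
      \<le> (\<Sum>k<n. ennreal (1 / real n) * (ennreal (?e k x) * indicator cube x))"
      by (auto simp: indicator_def)
  qed
  also have "\<dots> = (\<Sum>k<n. ennreal (1 / real n) * (\<integral>\<^sup>+x\<in>cube. ennreal (?e k x) \<partial>lborel))"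
    using m by (subst nn_integral_sum) (auto simp: nn_integral_cmult)
  also have "\<dots> \<le> (\<Sum>k<n. ennreal (1 / real n) * ennreal (J ^ n * (lip_const TYPE('n) * K)))"
  proof (intro sum_mono mult_left_mono)
    fix k assume "k \<in> {..<n}"
    then have k: "k < n" by simp
    let ?F = "\<lambda>x. ennreal (exp (\<beta> / 8 * lip_at (v k) x))"
    have [measurable]: "lip_at (v k) \<in> borel_measurable borel" by (rule lip_at_v_measurable[OF k])
    have F: "?F \<in> borel_measurable borel" by measurable
    have per: "periodic ?F" using lip_at_periodic[OF vD(2)[OF k]] by (auto simp: periodic_def)
    have "(\<integral>\<^sup>+x\<in>cube. ?F (W k x) \<partial>lborel) \<le> ennreal (J ^ n) * (\<integral>\<^sup>+x\<in>cube. ?F x \<partial>lborel)"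
      using W[OF k] F per unfolding compresses_def by blast
    also have "\<dots> \<le> ennreal (J ^ n) * ennreal (lip_const TYPE('n) * K)"
      by (intro mult_left_mono exp_lip_at_integral[OF v[OF k] C[OF k] \<beta> K]) auto
    also have "\<dots> = ennreal (J ^ n * (lip_const TYPE('n) * K))" using J1 lip_const_pos[where 'n = 'n] K
      by (intro ennreal_mult[symmetric]) (auto intro!: mult_nonneg_nonneg less_imp_le)
    finally show "(\<integral>\<^sup>+x\<in>cube. ?F (W k x) \<partial>lborel) \<le> ennreal (J ^ n * (lip_const TYPE('n) * K))" .
  qed auto
  also have "\<dots> = ennreal (J ^ n * (lip_const TYPE('n) * K))"
    using n by (simp add: mult.assoc[symmetric] ennreal_of_nat_eq_real_of_nat ennreal_mult[symmetric])
  finally show ?thesis .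
qed

text \<open>The second argument of the maximum is the growth at the starting point of the trajectory that ends
  at x, which controls the inverse at x.\<close>

definition growth2 :: "real ^ 'n \<Rightarrow> real" where "growth2 x = max (growth x) (growth (Z x))"

lemma growth2_measurable: "growth2 \<in> borel_measurable borel"
proof -
  have [measurable]: "growth \<in> borel_measurable borel" "Z \<in> borel_measurable borel" by (rule growth_measurable Z_measurable)+
  show ?thesis unfolding growth2_def[abs_def] by measurable
qed

lemma Y_bound: "norm (Y n x - Y n y) \<le> exp (growth2 x) * norm (x - y)"
  by (rule order_trans[OF Y_expand mult_right_mono]) (auto simp: growth2_def)

lemma Z_bound: "norm (Z x - Z y) \<le> exp (growth2 x) * norm (x - y)"
proof -
  have "norm (Z x - Z y) \<le> exp (growth (Z x)) * norm (x - y)" using Y_contract[of "Z x" "Z y"] by (simp add: YZ)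
  also have "\<dots> \<le> exp (growth2 x) * norm (x - y)" by (rule mult_right_mono) (auto simp: growth2_def)
  finally show ?thesis .
qed

lemma exp_growth2_integral:
  assumes t: "t = real n * \<delta>"
  shows "(\<integral>\<^sup>+x\<in>cube. ennreal (exp (\<beta> / (16 * t) * growth2 x)) \<partial>lborel) \<le> ennreal (2 * J ^ n * (lip_const TYPE('n) * K))"
proof -
  have [measurable]: "growth \<in> borel_measurable borel" "Z \<in> borel_measurable borel" by (rule growth_measurable Z_measurable)+
  have t0: "t > 0" using t n \<delta> by simp
  let ?q = "\<beta> / (16 * t)"
  have q: "?q \<ge> 0" using \<beta> t0 by simp
  have p: "J ^ m \<le> J ^ n" if "m \<le> n" for m using that J1 by (intro power_increasing) auto
  have 1: "(\<integral>\<^sup>+x\<in>cube. ennreal (exp (?q * growth x)) \<partial>lborel) \<le> ennreal (J ^ n * (lip_const TYPE('n) * K))"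
    unfolding growth_def by (rule exp_growth_integral[OF _ t]) (auto intro!: compresses_mono[OF Y_compresses] p)
  have 2: "(\<integral>\<^sup>+x\<in>cube. ennreal (exp (?q * growth (Z x))) \<partial>lborel) \<le> ennreal (J ^ n * (lip_const TYPE('n) * K))"
    unfolding growth_def by (rule exp_growth_integral[OF _ t]) (auto intro!: compresses_mono[OF YZ_compresses] p)
  have "(\<integral>\<^sup>+x\<in>cube. ennreal (exp (?q * growth2 x)) \<partial>lborel) \<le>
    (\<integral>\<^sup>+x. ennreal (exp (?q * growth x)) * indicator cube x + ennreal (exp (?q * growth (Z x))) * indicator cube x \<partial>lborel)"
  proof (rule nn_integral_mono)
    fix x
    have "exp (?q * growth2 x) \<le> exp (?q * growth x) + exp (?q * growth (Z x))"
      by (cases "growth x \<le> growth (Z x)") (auto simp: growth2_def max_def)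
    then show "ennreal (exp (?q * growth2 x)) * indicator cube x \<le> ennreal (exp (?q * growth x)) * indicator cube x + ennreal (exp (?q * growth (Z x))) * indicator cube x"
      by (auto simp: indicator_def simp flip: ennreal_plus intro!: ennreal_leI)
  qed
  also have "\<dots> = (\<integral>\<^sup>+x\<in>cube. ennreal (exp (?q * growth x)) \<partial>lborel) + (\<integral>\<^sup>+x\<in>cube. ennreal (exp (?q * growth (Z x))) \<partial>lborel)"
    by (rule nn_integral_add) measurable
  also have "\<dots> \<le> ennreal (J ^ n * (lip_const TYPE('n) * K)) + ennreal (J ^ n * (lip_const TYPE('n) * K))"
    by (intro add_mono 1 2)
  also have "\<dots> = ennreal (2 * J ^ n * (lip_const TYPE('n) * K))"
    using J1 lip_const_pos[where 'n = 'n] K by (subst ennreal_plus[symmetric]) (auto intro!: mult_nonneg_nonneg less_imp_le)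
  finally show ?thesis .
qed

end


section \<open>Flows of fields with exponentially integrable weak gradient\<close>

lemma compact_torus: "compact (UNIV :: 'n::finite torus set)"
proof -
  have "compact (torus_proj ` cbox 0 (1 :: real ^ 'n))"
    by (intro compact_continuous_image continuous_on_torus_proj compact_cbox)
  moreover have "p \<in> torus_proj ` cbox 0 (1 :: real ^ 'n)" for p
  proof (rule image_eqI)
    show "p = torus_proj (cube_rep p)" by simp
    show "cube_rep p \<in> cbox 0 1" using cube_rep_cube[of p] by (auto simp: cube_def mem_box_cart less_imp_le)
  qed
  then have "torus_proj ` cbox 0 (1 :: real ^ 'n) = UNIV" by blast
  ultimately show ?thesis by simp
qed

lemma torus_lift_dist:
  fixes u :: "real ^ 'n::finite"
  obtains w where "torus_proj w = q" "dist u w = dist (torus_proj u) q"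
proof -
  have ne: "torus_fibre q \<noteq> {}" using torus_proj_rep[of q] by blast
  obtain w where "w \<in> torus_fibre q" "infdist u (torus_fibre q) = dist u w"
    by (rule infdist_attains_inf[OF closed_torus_fibre ne])
  then show thesis using that dist_torus_infdist[of u q] by auto
qed

text \<open>For r \<le> 1 the modulus is at most (a + 2 A) sqrt r.\<close>

lemma modulus_small:
  assumes "a \<ge> 0" "A \<ge> 0" "\<epsilon> > 0"
  obtains r where "r > 0" "\<And>s. 0 \<le> s \<Longrightarrow> s \<le> r \<Longrightarrow> modulus a A s \<le> \<epsilon>"
proof -
  define c where "c = a + 2 * A + 1"
  have c: "c \<ge> 1" using assms by (simp add: c_def)
  define r where "r = min 1 ((\<epsilon> / c)\<^sup>2)"
  have r: "r > 0" "r \<le> 1" "r \<le> (\<epsilon> / c)\<^sup>2" using assms c by (auto simp: r_def)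
  have "modulus a A s \<le> \<epsilon>" if s: "0 \<le> s" "s \<le> r" for s
  proof (cases "s = 0")
    case False
    then have s0: "s > 0" "s \<le> 1" using s r by auto
    let ?q = "sqrt s"
    have q: "?q > 0" "?q \<le> 1" "?q * ?q = s" using s0 by auto
    have "s \<le> ?q" using mult_right_mono[OF q(2), of ?q] q by simp
    have "ln (1 / ?q) \<le> 1 / ?q - 1" using q by (intro ln_le_minus_one) auto
    then have "- ln s \<le> 2 / ?q" using s0 by (simp add: ln_div ln_sqrt)
    then have "max 0 (- ln s) \<le> 2 / ?q" using q by simp
    then have "s * max 0 (- ln s) \<le> s * (2 / ?q)" using s by (intro mult_left_mono) auto
    also have "\<dots> = 2 * ?q" using q by (metis mult.commute nonzero_eq_divide_eq less_irrefl times_divide_eq_right mult.left_commute)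
    finally have 1: "A * (s * max 0 (- ln s)) \<le> A * (2 * ?q)" using assms by (intro mult_left_mono)
    have "modulus a A s = s * a + A * (s * max 0 (- ln s))" by (simp add: modulus_def algebra_simps)
    also have "\<dots> \<le> ?q * a + A * (2 * ?q)" using 1 \<open>s \<le> ?q\<close> assms by (intro add_mono mult_right_mono) auto
    also have "\<dots> \<le> c * ?q" using q by (simp add: c_def algebra_simps)
    also have "\<dots> \<le> c * (\<epsilon> / c)"
    proof (rule mult_left_mono)
      have "?q \<le> sqrt ((\<epsilon> / c)\<^sup>2)" using s r by (intro real_sqrt_le_mono) auto
      then show "?q \<le> \<epsilon> / c" using assms c by simp
    qed (use c in auto)
    also have "\<dots> = \<epsilon>" using c by simp
    finally show ?thesis .
  qed (use assms in \<open>simp add: modulus_def\<close>)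
  then show thesis using r that by blast
qed

lemma trig_bounded:
  assumes "trig f" obtains B where "\<And>x. \<bar>f x\<bar> \<le> B"
  using trig_expansion[OF assms] unfolding expandable_def by blast

text \<open>The mollifications of u converge to u and have a common log-Lipschitz modulus.\<close>

lemma weak_field_log_Lipschitz:
  assumes \<beta>: "\<beta> > 0" and K: "K \<ge> 1"
  obtains a A where "a \<ge> 0" "A \<ge> 0"
    "\<And>(u :: 'n::finite torus \<Rightarrow> real ^ 'n) G x y. continuous_on UNIV u \<Longrightarrow> weak_gradient u G \<Longrightarrow>
        (\<integral>\<^sup>+p. ennreal (exp (\<beta> * norm (G p))) \<partial>torus_measure) \<le> ennreal K \<Longrightarrow>
        norm (u (torus_proj x) - u (torus_proj y)) \<le> modulus a A (norm (x - y))"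
proof -
  obtain a A where aA: "a \<ge> 0" "A \<ge> 0"
    and mod: "\<And>(v :: real ^ 'n \<Rightarrow> real ^ 'n) G x y. smooth_field \<beta> K v G \<Longrightarrow> norm (v x - v y) \<le> modulus a A (norm (x - y))"
    by (rule smooth_field_log_Lipschitz[OF \<beta> K]) blast
  have "norm (u (torus_proj x) - u (torus_proj y)) \<le> modulus a A (norm (x - y))"
    if u: "continuous_on UNIV u" and wg: "weak_gradient u G" and G: "(\<integral>\<^sup>+p. ennreal (exp (\<beta> * norm (G p))) \<partial>torus_measure) \<le> ennreal K"
    for u :: "'n torus \<Rightarrow> real ^ 'n" and G x y
  proof (rule field_le_epsilon)
    fix e :: real assume e: "e > 0"
    have um[measurable]: "u \<in> borel_measurable borel" using u by (rule borel_measurable_continuous_onI)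
    have Gm[measurable]: "G \<in> borel_measurable borel" using wg by (auto simp: weak_gradient_def cong: measurable_cong_sets)
    have "bounded (range u)" using compact_torus u compact_continuous_image compact_imp_bounded by blast
    then obtain B where B: "\<And>p. norm (u p) \<le> B" by (auto simp: bounded_iff)
    have B0: "B \<ge> 0" using B[of undefined] norm_ge_zero order_trans by blast
    have "uniformly_continuous_on UNIV u" by (rule compact_uniformly_continuous[OF u compact_torus])
    then obtain r where r: "r > 0" "\<And>p q. dist p q < r \<Longrightarrow> dist (u p) (u q) < e / 4"
      using e unfolding uniformly_continuous_on_def by (metis UNIV_I zero_less_divide_iff zero_less_numeral dist_commute)
    define \<eta> where "\<eta> = e / (4 * (2 * B + 1))"
    have \<eta>: "\<eta> > 0" "2 * B * \<eta> \<le> e / 4" using e B0 by (auto simp: \<eta>_def field_simps)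
    obtain \<rho> :: "real ^ 'n \<Rightarrow> real" where \<rho>: "trig \<rho>" "\<And>x. \<rho> x \<ge> 0" "(\<integral>\<^sup>+x\<in>cube. ennreal (\<rho> x) \<partial>lborel) = 1"
       "(\<integral>\<^sup>+x\<in>cube. ennreal (\<rho> x) * indicator {x. far r x} x \<partial>lborel) \<le> ennreal \<eta>"
      by (rule kernel_exists[OF r(1) \<eta>(1)]) blast
    interpret U: prob_space "return (count_space UNIV) ()" by (rule prob_space_return) simp
    interpret pair_prob_space "return (count_space UNIV) ()" "torus_measure :: 'n torus measure"
      by (intro pair_prob_space.intro pair_sigma_finite.intro U.sigma_finite_measure_axioms prob_space_imp_sigma_finite prob_space_torus U.prob_space_axioms)
    have ui: "integrable (return (count_space UNIV) () \<Otimes>\<^sub>M torus_measure) (\<lambda>(a, p). u p)"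
      by (rule integrable_const_bound[where B = B]) (auto simp: B case_prod_unfold)
    interpret A: averaged_field "return (count_space UNIV) ()" "\<lambda>_. u" "\<lambda>_. G" \<beta> K \<rho>
    proof
      show "(\<lambda>(a, p). u p) \<in> borel_measurable (return (count_space UNIV) () \<Otimes>\<^sub>M torus_measure)" by measurable
      show "(\<lambda>(a, p). G p) \<in> borel_measurable (return (count_space UNIV) () \<Otimes>\<^sub>M torus_measure)" by measurable
    qed (rule wg G \<beta> K \<rho> ui)+
    have app: "norm (A.field y - u (torus_proj y)) \<le> e / 4 + 2 * B * \<eta>" for y
    proof -
      have "norm (A.field y - (\<integral>a. u (torus_proj y) \<partial>return (count_space UNIV) ())) \<le> e / 4 + 2 * B * \<eta>"
      proof (rule A.field_approx[OF _ _ \<rho>(4)])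
        show "norm (u p - u q) \<le> e / 4" if "dist p q < r" for p q using r(2)[OF that] by (simp add: dist_norm)
        show "norm (u p - u q) \<le> 2 * B" for p q using norm_triangle_ineq4[of "u p" "u q"] B[of p] B[of q] by linarith
      qed (use e B0 \<eta> in auto)
      then show ?thesis by (simp add: U.prob_space[simplified])
    qed
    have "norm (A.field x - A.field y) \<le> modulus a A (norm (x - y))" by (rule mod[OF A.smooth_field])
    moreover have "u (torus_proj x) - u (torus_proj y) = (A.field x - A.field y) - (A.field x - u (torus_proj x)) + (A.field y - u (torus_proj y))" by simp
    then have "norm (u (torus_proj x) - u (torus_proj y)) \<le> norm (A.field x - A.field y) + norm (A.field x - u (torus_proj x)) + norm (A.field y - u (torus_proj y))"
    proof -
      have tri: "norm (p - q + s) \<le> norm p + norm q + norm s" for p q s :: "real ^ 'n"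
        using norm_triangle_ineq[of "p - q" s] norm_triangle_ineq4[of p q] by linarith
      show ?thesis unfolding \<open>u (torus_proj x) - u (torus_proj y) = _\<close> by (rule tri)
    qed
    ultimately show "norm (u (torus_proj x) - u (torus_proj y)) \<le> modulus a A (norm (x - y)) + e"
      using app[of x] app[of y] \<eta>(2) by linarith
  qed
  then show thesis using that[OF aA] by blast
qed

lemma uniform_integral:
  fixes f :: "real \<Rightarrow> 'b::euclidean_space"
  assumes s: "0 \<le> s" "s < s'" "s' \<le> T" and f: "integrable (lebesgue_on {0..T}) f"
  shows "integrable (uniform_measure (lebesgue_on {0..T}) {s..s'}) f"
    "(\<integral>x. f x \<partial>uniform_measure (lebesgue_on {0..T}) {s..s'}) = (1 / (s' - s)) *\<^sub>R integral {s..s'} f"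
proof -
  let ?M = "lebesgue_on {0..T}" and ?A = "{s..s'}" and ?c = "s' - s"
  have sub: "{s..s'} \<subseteq> {0..T}" using s by auto
  have A[measurable]: "?A \<in> sets ?M" using sub by (auto simp: sets_restrict_space_iff)
  have em: "emeasure ?M ?A = ennreal ?c" using sub s by (simp add: emeasure_restrict_space)
  have d: "indicator ?A x / ennreal ?c = ennreal (indicator ?A x / ?c)" for x
    using s by (auto simp: indicator_def divide_ennreal_def inverse_ennreal[symmetric] divide_inverse)
  have [measurable]: "f \<in> borel_measurable ?M" using f by simp
  have u: "uniform_measure ?M ?A = density ?M (\<lambda>x. ennreal (indicator ?A x / ?c))"
    unfolding uniform_measure_def em d ..
  have fi: "integrable ?M (\<lambda>x. (indicator ?A x / ?c) *\<^sub>R f x)"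
  proof (rule integrable_bounded_scaleR[OF f, of _ "1 / ?c"])
    show "(\<lambda>x. indicator ?A x / ?c) \<in> borel_measurable ?M" by measurable
    show "\<bar>indicator ?A x / ?c\<bar> \<le> 1 / ?c" for x using s by (auto simp: indicator_def)
  qed
  show "integrable (uniform_measure ?M ?A) f"
    unfolding u using fi s by (subst integrable_density) auto
  have "(\<integral>x. f x \<partial>uniform_measure ?M ?A) = (\<integral>x. (indicator ?A x / ?c) *\<^sub>R f x \<partial>?M)"
    unfolding u using s by (subst integral_density) auto
  also have "\<dots> = integral {0..T} (\<lambda>x. (indicator ?A x / ?c) *\<^sub>R f x)"
    by (rule lebesgue_integral_eq_integral[OF fi]) simp
  also have "\<dots> = integral {0..T} (\<lambda>x. if x \<in> ?A then (1 / ?c) *\<^sub>R f x else 0)"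
    by (intro Henstock_Kurzweil_Integration.integral_cong) (auto simp: indicator_def)
  also have "\<dots> = integral (?A \<inter> {0..T}) (\<lambda>x. (1 / ?c) *\<^sub>R f x)" by (rule integral_restrict_Int)
  also have "?A \<inter> {0..T} = ?A" using sub by blast
  finally show "(\<integral>x. f x \<partial>uniform_measure ?M ?A) = (1 / ?c) *\<^sub>R integral ?A f" by simp
qed

text \<open>The hypotheses of the theorem, with the supremum over times and the essential supremum over
  space-time unfolded.\<close>

locale flow_problem =
  fixes T :: real and b :: "real \<Rightarrow> 'n::finite torus \<Rightarrow> real ^ 'n" and Db :: "real \<Rightarrow> 'n torus \<Rightarrow> real ^ 'n ^ 'n"
    and \<beta> K L :: real and X :: "real \<Rightarrow> 'n torus \<Rightarrow> 'n torus"
  assumes T: "T > 0" and \<beta>: "\<beta> > 0" and K: "K \<ge> 1" and L: "L \<ge> 0"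
    and b_meas: "(\<lambda>(t, x). b t x) \<in> borel_measurable (space_time T)"
    and b_cont: "\<And>t. t \<in> {0..T} \<Longrightarrow> continuous_on UNIV (b t)"
    and Db_meas: "(\<lambda>(t, x). Db t x) \<in> borel_measurable (space_time T)"
    and wg: "\<And>t. t \<in> {0..T} \<Longrightarrow> weak_gradient (b t) (Db t)"
    and Db_exp: "\<And>t. t \<in> {0..T} \<Longrightarrow> (\<integral>\<^sup>+x. ennreal (exp (\<beta> * norm (Db t x))) \<partial>torus_measure) \<le> ennreal K"
    and trace_AE: "AE \<omega> in space_time T. \<bar>trace (Db (fst \<omega>) (snd \<omega>))\<bar> \<le> L"
    and flow: "is_flow T b X"
begin

abbreviation "\<Lambda> \<equiv> lebesgue_on {0..T}"

definition lift :: "real \<Rightarrow> real ^ 'n \<Rightarrow> real ^ 'n" where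
  "lift t u = u + integral {0..t} (\<lambda>s. b s (X s (torus_proj u)))"

lemma lift_proj: "t \<in> {0..T} \<Longrightarrow> torus_proj (lift t u) = X t (torus_proj u)"
proof -
  assume t: "t \<in> {0..T}"
  let ?x = "torus_proj u"
  obtain \<gamma> where \<gamma>: "\<And>t. t \<in> {0..T} \<Longrightarrow> torus_proj (\<gamma> t) = X t ?x \<and> \<gamma> t = \<gamma> 0 + integral {0..t} (\<lambda>s. b s (X s ?x))"
    using flow unfolding is_flow_def by blast
  have "X 0 ?x = ?x" using flow unfolding is_flow_def by blast
  then have "torus_proj (\<gamma> 0) = torus_proj u" using \<gamma>[of 0] T by auto
  then have l: "\<gamma> 0 - u \<in> int_lattice" by (simp add: torus_proj_eq_iff)
  have "\<gamma> t = lift t u + (\<gamma> 0 - u)" using \<gamma>[OF t] by (simp add: lift_def)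
  then have "torus_proj (lift t u) = torus_proj (\<gamma> t)" using torus_proj_add[OF l, of "lift t u"] by simp
  also have "torus_proj (\<gamma> t) = X t ?x" using \<gamma>[OF t] by (rule conjunct1)
  finally show ?thesis .
qed

lemma lift_0: "lift 0 u = u" by (simp add: lift_def)

lemma lift_add: "k \<in> int_lattice \<Longrightarrow> lift t (u + k) = lift t u + k"
  by (simp add: lift_def torus_proj_add)

lemma velocity_abs: "(\<lambda>s. b s (X s x)) absolutely_integrable_on {0..T}"
  using flow unfolding is_flow_def by blast

lemma velocity_integrable: "(\<lambda>s. b s (X s x)) integrable_on {0..T}"
  using velocity_abs by (rule set_lebesgue_integral_eq_integral(1))

lemma velocity_integrable_sub: "0 \<le> s \<Longrightarrow> s' \<le> T \<Longrightarrow> (\<lambda>s. b s (X s x)) integrable_on {s..s'}"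
  by (rule integrable_on_subinterval[OF velocity_integrable]) auto

lemma lift_diff:
  assumes "0 \<le> s" "s \<le> s'" "s' \<le> T"
  shows "lift s' u = lift s u + integral {s..s'} (\<lambda>r. b r (X r (torus_proj u)))"
proof -
  have "integral {0..s} (\<lambda>r. b r (X r (torus_proj u))) + integral {s..s'} (\<lambda>r. b r (X r (torus_proj u))) = integral {0..s'} (\<lambda>r. b r (X r (torus_proj u)))"
    using assms velocity_integrable_sub[of 0 s'] by (intro Henstock_Kurzweil_Integration.integral_combine) auto
  then show ?thesis by (simp add: lift_def)
qed

text \<open>Constants (a, A) of a modulus of continuity shared by all b t.\<close>

definition mod_pair :: "real \<times> real" where
  "mod_pair = (SOME (a, A). a \<ge> 0 \<and> A \<ge> 0 \<and> (\<forall>t\<in>{0..T}. \<forall>x y. norm (b t (torus_proj x) - b t (torus_proj y)) \<le> modulus a A (norm (x - y))))"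
definition "a0 = fst mod_pair"
definition "A0 = snd mod_pair"

lemma a0: "a0 \<ge> 0" and A0: "A0 \<ge> 0"
  and b_mod: "t \<in> {0..T} \<Longrightarrow> norm (b t (torus_proj x) - b t (torus_proj y)) \<le> modulus a0 A0 (norm (x - y))"
proof -
  obtain a A where aA: "a \<ge> 0" "A \<ge> 0" 
    and H: "\<And>(u :: 'n::finite torus \<Rightarrow> real ^ 'n) G x y. continuous_on UNIV u \<Longrightarrow> weak_gradient u G \<Longrightarrow>
        (\<integral>\<^sup>+p. ennreal (exp (\<beta> * norm (G p))) \<partial>torus_measure) \<le> ennreal K \<Longrightarrow>
        norm (u (torus_proj x) - u (torus_proj y)) \<le> modulus a A (norm (x - y))"
    by (rule weak_field_log_Lipschitz[OF \<beta> K]) blast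
  have "\<exists>p. case p of (a, A) \<Rightarrow> a \<ge> 0 \<and> A \<ge> 0 \<and> (\<forall>t\<in>{0..T}. \<forall>x y. norm (b t (torus_proj x) - b t (torus_proj y)) \<le> modulus a A (norm (x - y)))"
    unfolding case_prod_unfold
    by (intro exI[of _ "(a, A)"] conjI ballI allI; unfold fst_conv snd_conv) (rule aA, rule aA, rule H[OF b_cont wg Db_exp])
  then have "case mod_pair of (a, A) \<Rightarrow> a \<ge> 0 \<and> A \<ge> 0 \<and> (\<forall>t\<in>{0..T}. \<forall>x y. norm (b t (torus_proj x) - b t (torus_proj y)) \<le> modulus a A (norm (x - y)))"
    unfolding mod_pair_def by (rule someI_ex)
  then have "a0 \<ge> 0 \<and> A0 \<ge> 0 \<and> (\<forall>t\<in>{0..T}. \<forall>x y. norm (b t (torus_proj x) - b t (torus_proj y)) \<le> modulus a0 A0 (norm (x - y)))"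
    by (simp add: a0_def A0_def case_prod_unfold)
  then show "a0 \<ge> 0" "A0 \<ge> 0" "t \<in> {0..T} \<Longrightarrow> norm (b t (torus_proj x) - b t (torus_proj y)) \<le> modulus a0 A0 (norm (x - y))" by blast+
qed

text \<open>Any two points of the torus have representatives at distance at most 2 n, and
  r max 0 (-ln r) \<le> 1, so this bounds the spatial oscillation of b.\<close>

definition osc :: real where "osc = 2 * real CARD('n) * a0 + A0"

lemma osc_nonneg: "osc \<ge> 0" using a0 A0 by (simp add: osc_def)

lemma b_osc: "t \<in> {0..T} \<Longrightarrow> norm (b t p - b t q) \<le> osc"
proof -
  assume t: "t \<in> {0..T}"
  let ?r = "norm (cube_rep p - cube_rep q)"
  have r: "?r \<le> 2 * real CARD('n)"
    using norm_triangle_ineq4[of "cube_rep p" "cube_rep q"] norm_cube[OF cube_rep_cube[of p]] norm_cube[OF cube_rep_cube[of q]] by linarith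
  have "norm (b t p - b t q) \<le> modulus a0 A0 ?r" using b_mod[OF t, of "cube_rep p" "cube_rep q"] by simp
  also have "\<dots> = ?r * a0 + A0 * (?r * max 0 (- ln ?r))" by (simp add: modulus_def algebra_simps)
  also have "\<dots> \<le> 2 * real CARD('n) * a0 + A0 * 1"
    using r a0 A0 by (intro add_mono mult_right_mono mult_left_mono mult_max_ln_le_one) auto
  finally show ?thesis by (simp add: osc_def)
qed

text \<open>A time-integrable bound for b, uniform in space: the velocity of one trajectory is integrable by
  the definition of a flow, and the spatial oscillation is bounded. The point undefined is an
  arbitrary starting point.\<close>

definition speed :: "real \<Rightarrow> real" where "speed s = norm (b s (X s undefined)) + osc"

lemma b_le_speed: "t \<in> {0..T} \<Longrightarrow> norm (b t p) \<le> speed t"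
  using b_osc[of t p "X t undefined"] norm_triangle_ineq2[of "b t p" "b t (X t undefined)"] by (simp add: speed_def)

lemma speed_integrable: "integrable \<Lambda> speed"
proof -
  have "integrable \<Lambda> (\<lambda>s. b s (X s undefined))"
    by (rule absolutely_integrable_imp_integrable[OF velocity_abs]) simp
  moreover have "finite_measure \<Lambda>" by (rule finite_measure_lebesgue_on) simp
  ultimately show ?thesis unfolding speed_def[abs_def] 
    by (intro Bochner_Integration.integrable_add integrable_norm finite_measure.integrable_const)
qed

lemma speed_integrable_on: "0 \<le> s \<Longrightarrow> s' \<le> T \<Longrightarrow> speed integrable_on {s..s'}"
  by (rule integrable_on_subinterval[OF integrable_on_lebesgue_on[OF speed_integrable]]) auto

lemma speed_nonneg: "speed s \<ge> 0" using osc_nonneg by (simp add: speed_def)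

lemma speed_small:
  assumes "e > 0"
  obtains d where "d > 0" "\<And>s s'. 0 \<le> s \<Longrightarrow> s \<le> s' \<Longrightarrow> s' \<le> T \<Longrightarrow> s' - s < d \<Longrightarrow> integral {s..s'} speed < e"
proof -
  have "continuous_on {0..T} (\<lambda>s. integral {0..s} speed)"
    by (rule indefinite_integral_continuous_1) (rule speed_integrable_on, auto)
  then have "uniformly_continuous_on {0..T} (\<lambda>s. integral {0..s} speed)" by (rule compact_uniformly_continuous) simp
  then obtain d where d: "d > 0" "\<And>s s'. s \<in> {0..T} \<Longrightarrow> s' \<in> {0..T} \<Longrightarrow> dist s' s < d \<Longrightarrow> dist (integral {0..s'} speed) (integral {0..s} speed) < e"
    using assms unfolding uniformly_continuous_on_def by metis
  have "integral {s..s'} speed < e" if s: "0 \<le> s" "s \<le> s'" "s' \<le> T" "s' - s < d" for s s'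
  proof -
    have "integral {0..s} speed + integral {s..s'} speed = integral {0..s'} speed"
      using s speed_integrable_on[of 0 s'] by (intro Henstock_Kurzweil_Integration.integral_combine) auto
    moreover have "dist (integral {0..s'} speed) (integral {0..s} speed) < e" using s by (intro d(2)) (auto simp: dist_real_def)
    ultimately show ?thesis by (simp add: dist_real_def)
  qed
  then show thesis using d that by blast
qed

lemma b_measurable [measurable]: "(\<lambda>\<omega>. b (fst \<omega>) (snd \<omega>)) \<in> borel_measurable (\<Lambda> \<Otimes>\<^sub>M torus_measure)"
  using b_meas by (simp add: space_time_def case_prod_unfold)

lemma Db_measurable [measurable]: "(\<lambda>\<omega>. Db (fst \<omega>) (snd \<omega>)) \<in> borel_measurable (\<Lambda> \<Otimes>\<^sub>M torus_measure)"
  using Db_meas by (simp add: space_time_def case_prod_unfold)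

lemma b_section_integrable: "integrable \<Lambda> (\<lambda>s. b s p)"
proof (rule Bochner_Integration.integrable_bound[OF speed_integrable])
  have "(\<lambda>s. (s, p)) \<in> \<Lambda> \<rightarrow>\<^sub>M \<Lambda> \<Otimes>\<^sub>M torus_measure" by measurable
  from measurable_compose[OF this b_measurable] show "(\<lambda>s. b s p) \<in> borel_measurable \<Lambda>" by simp
  show "AE s in \<Lambda>. norm (b s p) \<le> norm (speed s)"
    using b_le_speed speed_nonneg by (intro AE_I2) (auto simp: space_restrict_space)
qed

lemma b_section_integrable_on: "0 \<le> s \<Longrightarrow> s' \<le> T \<Longrightarrow> (\<lambda>r. b r p) integrable_on {s..s'}"
  by (rule integrable_on_subinterval[OF integrable_on_lebesgue_on[OF b_section_integrable]]) auto

lemma lift_move: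
  assumes "0 \<le> s" "s \<le> s'" "s' \<le> T"
  shows "norm (lift s' u - lift s u) \<le> integral {s..s'} speed"
proof -
  have "norm (integral {s..s'} (\<lambda>r. b r (X r (torus_proj u)))) \<le> integral {s..s'} speed"
    using assms by (intro Henstock_Kurzweil_Integration.integral_norm_bound_integral velocity_integrable_sub speed_integrable_on b_le_speed) auto
  then show ?thesis by (simp add: lift_diff[OF assms])
qed

definition avg :: "real \<Rightarrow> real \<Rightarrow> real measure" where
  "avg s s' = uniform_measure \<Lambda> {s..s'}"

lemma averaged:
  assumes s: "0 \<le> s" "s < s'" "s' \<le> T" and \<rho>: "trig \<rho>" "\<And>x. \<rho> x \<ge> 0" "(\<integral>\<^sup>+x\<in>cube. ennreal (\<rho> x) \<partial>lborel) = 1"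
  shows "averaged_field (avg s s') b Db \<beta> K \<rho>"
    "AE \<omega> in avg s s' \<Otimes>\<^sub>M torus_measure. \<bar>trace (Db (fst \<omega>) (snd \<omega>))\<bar> \<le> L"
proof -
  have sub: "{s..s'} \<subseteq> {0..T}" using s by auto
  have A: "{s..s'} \<in> sets \<Lambda>" using sub by (auto simp: sets_restrict_space_iff)
  have em: "emeasure \<Lambda> {s..s'} = ennreal (s' - s)" using sub s by (simp add: emeasure_restrict_space)
  have prob: "prob_space (avg s s')" unfolding avg_def by (rule prob_space_uniform_measure) (use em s in auto)
  have sets: "sets (avg s s') = sets \<Lambda>" and space: "space (avg s s') = {0..T}" by (auto simp: avg_def space_restrict_space)
  have meas: "borel_measurable (avg s s' \<Otimes>\<^sub>M torus_measure) = borel_measurable (\<Lambda> \<Otimes>\<^sub>M (torus_measure :: 'n torus measure))"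
    by (intro measurable_cong_sets sets_pair_measure_cong sets refl)
  interpret P: prob_space "avg s s'" by (rule prob)
  interpret Q: prob_space "torus_measure :: 'n torus measure" by (rule prob_space_torus)
  interpret pair_sigma_finite "avg s s'" "torus_measure :: 'n torus measure" ..
  interpret F: finite_measure \<Lambda> by (rule finite_measure_lebesgue_on) simp
  interpret PL: pair_sigma_finite \<Lambda> "torus_measure :: 'n torus measure" ..
  have mi: "integrable (avg s s') speed" unfolding avg_def by (rule uniform_integral(1)[OF s speed_integrable])
  have bi: "integrable (avg s s' \<Otimes>\<^sub>M torus_measure) (\<lambda>\<omega>. b (fst \<omega>) (snd \<omega>))"
  proof (rule integrableI_bounded)
    show bm: "(\<lambda>\<omega>. b (fst \<omega>) (snd \<omega>)) \<in> borel_measurable (avg s s' \<Otimes>\<^sub>M torus_measure)" unfolding meas by measurable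
    have "(\<integral>\<^sup>+\<omega>. ennreal (norm (b (fst \<omega>) (snd \<omega>))) \<partial>(avg s s' \<Otimes>\<^sub>M torus_measure)) = (\<integral>\<^sup>+a. (\<integral>\<^sup>+p. ennreal (norm (b a p)) \<partial>torus_measure) \<partial>avg s s')"
      using bm by (subst Q.nn_integral_fst[symmetric]) auto
    also have "\<dots> \<le> (\<integral>\<^sup>+a. (\<integral>\<^sup>+p. ennreal (speed a) \<partial>(torus_measure :: 'n torus measure)) \<partial>avg s s')"
      by (intro nn_integral_mono ennreal_leI b_le_speed) (simp add: space)
    also have "\<dots> = (\<integral>\<^sup>+a. ennreal (speed a) \<partial>avg s s')" using Q.emeasure_space_1 by simp
    also have "\<dots> < \<infinity>" using mi speed_nonneg by (simp add: integrable_iff_bounded)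
    finally show "(\<integral>\<^sup>+\<omega>. ennreal (norm (b (fst \<omega>) (snd \<omega>))) \<partial>(avg s s' \<Otimes>\<^sub>M torus_measure)) < \<infinity>" .
  qed
  show "averaged_field (avg s s') b Db \<beta> K \<rho>"
  proof
    show "(\<lambda>(a, p). b a p) \<in> borel_measurable (avg s s' \<Otimes>\<^sub>M torus_measure)" unfolding meas case_prod_unfold by measurable
    show "(\<lambda>(a, p). Db a p) \<in> borel_measurable (avg s s' \<Otimes>\<^sub>M torus_measure)" unfolding meas case_prod_unfold by measurable
    show "integrable (avg s s' \<Otimes>\<^sub>M torus_measure) (\<lambda>(a, p). b a p)" using bi by (simp add: case_prod_unfold)
  qed (use wg Db_exp \<beta> K \<rho> space in auto)
  have "AE a in \<Lambda>. AE p in torus_measure. \<bar>trace (Db a p)\<bar> \<le> L"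
    using PL.AE_pair[OF trace_AE[unfolded space_time_def]] by simp
  then have ae: "AE a in avg s s'. AE p in torus_measure. \<bar>trace (Db a p)\<bar> \<le> L"
    unfolding avg_def by (intro AE_uniform_measureI A) auto
  have "(\<lambda>A. trace A) \<in> borel_measurable (borel :: (real ^ 'n ^ 'n) measure)"
    unfolding trace_def by (intro borel_measurable_continuous_onI continuous_intros)
  from measurable_compose[OF Db_measurable this]
  have [measurable]: "(\<lambda>\<omega>. trace (Db (fst \<omega>) (snd \<omega>))) \<in> borel_measurable (avg s s' \<Otimes>\<^sub>M torus_measure)" unfolding meas .
  show "AE \<omega> in avg s s' \<Otimes>\<^sub>M torus_measure. \<bar>trace (Db (fst \<omega>) (snd \<omega>))\<bar> \<le> L"
  proof (rule AE_pair_measure)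
    show "{\<omega> \<in> space (avg s s' \<Otimes>\<^sub>M torus_measure). \<bar>trace (Db (fst \<omega>) (snd \<omega>))\<bar> \<le> L} \<in> sets (avg s s' \<Otimes>\<^sub>M torus_measure)"
      by measurable
  qed (use ae in simp)
qed

end

lemma (in euler_scheme) Y_continuous: "k \<le> n \<Longrightarrow> continuous_on UNIV (Y k)"
proof (induction k)
  case (Suc k)
  have "continuous_on UNIV (v k)" by (rule Lipschitz_continuous_on[OF v_Lipschitz]) (use Suc.prems in simp)
  then have "continuous_on UNIV (\<lambda>x. v k (Y k x))" by (rule continuous_on_compose2) (use Suc in auto)
  then show ?case using Suc by (auto intro!: continuous_intros)
qed simp

lemma inverse_one_minus_le_exp:
  fixes x :: real assumes "0 \<le> x" "x \<le> 1/2" shows "1 / (1 - x) \<le> exp (x + 2 * x\<^sup>2)"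
proof -
  have "(1 + (x + 2 * x\<^sup>2)) * (1 - x) = 1 + x\<^sup>2 * (1 - 2 * x)" by (simp add: power2_eq_square algebra_simps)
  moreover have "0 \<le> x\<^sup>2 * (1 - 2 * x)" using assms by (intro mult_nonneg_nonneg) auto
  ultimately have "1 \<le> (1 + (x + 2 * x\<^sup>2)) * (1 - x)" by linarith
  then have "1 / (1 - x) \<le> 1 + (x + 2 * x\<^sup>2)" using assms by (simp add: pos_divide_le_eq)
  also have "\<dots> \<le> exp (x + 2 * x\<^sup>2)" by (rule exp_ge_add_one_self)
  finally show ?thesis .
qed

definition flow_const :: "'n::finite itself \<Rightarrow> real" where
  "flow_const _ = 2 * exp 1 * lip_const TYPE('n)"

context flow_problem
begin

lemma b_near:
  assumes r: "\<And>s. 0 \<le> s \<Longrightarrow> s \<le> r \<Longrightarrow> modulus a0 A0 s \<le> \<epsilon>" and t: "t \<in> {0..T}" and pq: "dist p q < r"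
  shows "norm (b t p - b t q) \<le> \<epsilon>"
proof -
  obtain w where w: "torus_proj w = q" "dist (cube_rep p) w = dist (torus_proj (cube_rep p)) q" by (rule torus_lift_dist)
  have "norm (b t p - b t q) \<le> modulus a0 A0 (norm (cube_rep p - w))"
    using b_mod[OF t, of "cube_rep p" w] w(1) by simp
  also have "\<dots> \<le> \<epsilon>" using w(2) pq by (intro r) (auto simp: dist_norm)
  finally show ?thesis .
qed

lemma averaged_step:
  assumes s: "0 \<le> s" "s < s'" "s' \<le> T" and \<rho>: "trig \<rho>" "\<And>x. \<rho> x \<ge> 0" "(\<integral>\<^sup>+x\<in>cube. ennreal (\<rho> x) \<partial>lborel) = 1"
    and tail: "(\<integral>\<^sup>+x\<in>cube. ennreal (\<rho> x) * indicator {x. far r x} x \<partial>lborel) \<le> ennreal \<eta>"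
    and r: "\<And>s. 0 \<le> s \<Longrightarrow> s \<le> r \<Longrightarrow> modulus a0 A0 s \<le> \<epsilon>" and pos: "\<epsilon> \<ge> 0" "\<eta> \<ge> 0"
  shows "norm ((s' - s) *\<^sub>R averaged_field.field (avg s s') b \<rho> y - integral {s..s'} (\<lambda>r. b r (torus_proj y))) \<le> (s' - s) * (\<epsilon> + osc * \<eta>)"
proof -
  interpret averaged_field "avg s s'" b Db \<beta> K \<rho> by (rule averaged(1)[OF s \<rho>])
  let ?I = "integral {s..s'} (\<lambda>r. b r (torus_proj y))"
  have sp: "space (avg s s') = {0..T}" by (simp add: avg_def space_restrict_space)
  have "norm (field y - (\<integral>a. b a (torus_proj y) \<partial>avg s s')) \<le> \<epsilon> + osc * \<eta>"
  proof (rule field_approx[OF _ _ tail pos(1) osc_nonneg pos(2)])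
    show "norm (b a p - b a q) \<le> \<epsilon>" if "a \<in> space (avg s s')" "dist p q < r" for a p q
      using b_near[OF r _ that(2)] that(1) sp by blast
    show "norm (b a p - b a q) \<le> osc" if "a \<in> space (avg s s')" for a p q
      using b_osc that sp by blast
    show "integrable (avg s s') (\<lambda>a. b a (torus_proj y))"
      unfolding avg_def by (rule uniform_integral(1)[OF s b_section_integrable])
  qed
  moreover have "(\<integral>a. b a (torus_proj y) \<partial>avg s s') = (1 / (s' - s)) *\<^sub>R ?I"
    unfolding avg_def by (rule uniform_integral(2)[OF s b_section_integrable])
  ultimately have "norm (field y - (1 / (s' - s)) *\<^sub>R ?I) \<le> \<epsilon> + osc * \<eta>" by simp
  then have "(s' - s) * norm (field y - (1 / (s' - s)) *\<^sub>R ?I) \<le> (s' - s) * (\<epsilon> + osc * \<eta>)" using s by (intro mult_left_mono) auto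
  moreover have "(s' - s) *\<^sub>R field y - ?I = (s' - s) *\<^sub>R (field y - (1 / (s' - s)) *\<^sub>R ?I)" using s by (simp add: scaleR_diff_right)
  ultimately show ?thesis using s by simp
qed

text \<open>Both inequalities compare the integral of b along the trajectory with that of b at the frozen
  point y. The forward one splits the difference at the left end point of the trajectory. The backward one
  splits it at the right end point and moves y to y', a distance of at most r, so that the modulus is
  evaluated at the distance of the right end points; hence the same Osgood lemma applies with time
  reversed.\<close>

lemma one_step_comparison:
  assumes s: "0 \<le> s" "s < s'" "s' \<le> T" 
    and r: "\<And>s. 0 \<le> s \<Longrightarrow> s \<le> r \<Longrightarrow> modulus a0 A0 s \<le> \<epsilon>"
    and small: "integral {s..s'} speed \<le> r / 2" "(s' - s) * \<epsilon> \<le> r / 2" and \<epsilon>: "\<epsilon> \<ge> 0"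
    and V: "norm ((s' - s) *\<^sub>R V - integral {s..s'} (\<lambda>r. b r (torus_proj y))) \<le> (s' - s) * \<epsilon>"
    and y': "y' = y + (s' - s) *\<^sub>R V"
  shows "norm (lift s' u - y') \<le> norm (lift s u - y) + (s' - s) * (4 * \<epsilon> + modulus a0 A0 (norm (lift s u - y)))"
    "norm (lift s u - y) \<le> norm (lift s' u - y') + (s' - s) * (4 * \<epsilon> + modulus a0 A0 (norm (lift s' u - y')))"
proof -
  let ?A1 = "integral {s..s'} (\<lambda>r. b r (X r (torus_proj u)))" and ?A2 = "integral {s..s'} (\<lambda>r. b r (torus_proj y))"
  let ?\<delta> = "s' - s"
  have "0 \<le> (s' - s) * \<epsilon>" using s \<epsilon> by (intro mult_nonneg_nonneg) auto
  then have r0: "r \<ge> 0" using small(2) by linarith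
  have i1: "(\<lambda>r. b r (X r (torus_proj u))) integrable_on {s..s'}" using s by (intro velocity_integrable_sub) auto
  have i2: "(\<lambda>r. b r (torus_proj y)) integrable_on {s..s'}" using s by (intro b_section_integrable_on) auto
  have mint: "speed integrable_on {s..s'}" using s by (intro speed_integrable_on) auto
  have msub: "integral {c..d} speed \<le> r / 2" if "s \<le> c" "c \<le> d" "d \<le> s'" for c d
  proof -
    have "integral {c..d} speed \<le> integral {s..s'} speed"
      using that s speed_nonneg by (intro integral_subset_le speed_integrable_on mint) auto
    then show ?thesis using small(1) by linarith
  qed
  have diff: "norm (?A1 - ?A2) \<le> ?\<delta> * c" if c: "\<And>q. q \<in> {s..s'} \<Longrightarrow> norm (b q (X q (torus_proj u)) - b q (torus_proj y)) \<le> c" for c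
  proof -
    have "?A1 - ?A2 = integral {s..s'} (\<lambda>q. b q (X q (torus_proj u)) - b q (torus_proj y))"
      using i1 i2 by (simp add: Henstock_Kurzweil_Integration.integral_diff)
    also have "norm \<dots> \<le> integral {s..s'} (\<lambda>q. c)"
      by (intro Henstock_Kurzweil_Integration.integral_norm_bound_integral Henstock_Kurzweil_Integration.integrable_diff i1 i2 c) auto
    also have "\<dots> = ?\<delta> * c" using s by simp
    finally show ?thesis .
  qed
  have lift': "lift s' u = lift s u + ?A1" using s by (intro lift_diff) auto
  have main: "lift s' u - y' = (lift s u - y) + ((?A1 - ?A2) - (?\<delta> *\<^sub>R V - ?A2))"
    unfolding lift' y' by (simp add: algebra_simps)
  have near: "norm (b q (torus_proj x) - b q (torus_proj z)) \<le> \<epsilon>" if "q \<in> {s..s'}" "norm (x - z) \<le> r" for q x z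
    using b_mod[of q x z] r[of "norm (x - z)"] that s by force
  have bq: "b q (X q (torus_proj u)) = b q (torus_proj (lift q u))" if "q \<in> {s..s'}" for q
    using lift_proj[of q u] that s by simp
  have tri: "norm (p - q) \<le> norm (p - x) + norm (x - q)" for p q x :: "real ^ 'n"
    using norm_triangle_ineq[of "p - x" "x - q"] by simp
  show "norm (lift s' u - y') \<le> norm (lift s u - y) + ?\<delta> * (4 * \<epsilon> + modulus a0 A0 (norm (lift s u - y)))"
  proof -
    let ?D = "norm (lift s u - y)"
    have "norm (?A1 - ?A2) \<le> ?\<delta> * (\<epsilon> + modulus a0 A0 ?D)"
    proof (rule diff)
      fix q assume q: "q \<in> {s..s'}"
      have "norm (lift q u - lift s u) \<le> integral {s..q} speed" using q s by (intro lift_move) auto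
      also have "\<dots> \<le> r / 2" using q by (intro msub) auto
      finally have "norm (b q (torus_proj (lift q u)) - b q (torus_proj (lift s u))) \<le> \<epsilon>" using r0 by (intro near[OF q]) simp
      moreover have "norm (b q (torus_proj (lift s u)) - b q (torus_proj y)) \<le> modulus a0 A0 ?D" using q s by (intro b_mod) auto
      ultimately show "norm (b q (X q (torus_proj u)) - b q (torus_proj y)) \<le> \<epsilon> + modulus a0 A0 ?D"
        unfolding bq[OF q] using tri[of "b q (torus_proj (lift q u))" "b q (torus_proj y)" "b q (torus_proj (lift s u))"] by linarith
    qed
    moreover have "norm (lift s' u - y') \<le> ?D + (norm (?A1 - ?A2) + norm (?\<delta> *\<^sub>R V - ?A2))"
      unfolding main by (intro order_trans[OF norm_triangle_ineq] add_left_mono norm_triangle_ineq4)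
    ultimately have "norm (lift s' u - y') \<le> ?D + (?\<delta> * (\<epsilon> + modulus a0 A0 ?D) + ?\<delta> * \<epsilon>)" using V by linarith
    also have "\<dots> \<le> ?D + ?\<delta> * (4 * \<epsilon> + modulus a0 A0 ?D)" using s \<epsilon> by (simp add: algebra_simps mult_left_mono)
    finally show ?thesis .
  qed
  show "norm (lift s u - y) \<le> norm (lift s' u - y') + ?\<delta> * (4 * \<epsilon> + modulus a0 A0 (norm (lift s' u - y')))"
  proof -
    let ?D = "norm (lift s' u - y')"
    have "norm ?A2 \<le> integral {s..s'} speed"
      using s by (intro Henstock_Kurzweil_Integration.integral_norm_bound_integral i2 mint b_le_speed) auto
    moreover have "norm (y' - y) \<le> norm (?\<delta> *\<^sub>R V - ?A2) + norm ?A2"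
      unfolding y' using norm_triangle_ineq[of "?\<delta> *\<^sub>R V - ?A2" ?A2] by simp
    ultimately have yy: "norm (y' - y) \<le> r" using V small by linarith
    have "norm (?A1 - ?A2) \<le> ?\<delta> * (2 * \<epsilon> + modulus a0 A0 ?D)"
    proof (rule diff)
      fix q assume q: "q \<in> {s..s'}"
      have "norm (lift s' u - lift q u) \<le> integral {q..s'} speed" using q s by (intro lift_move) auto
      also have "\<dots> \<le> r / 2" using q by (intro msub) auto
      finally have "norm (b q (torus_proj (lift q u)) - b q (torus_proj (lift s' u))) \<le> \<epsilon>" 
        using r0 by (intro near[OF q]) (simp add: norm_minus_commute)
      moreover have "norm (b q (torus_proj (lift s' u)) - b q (torus_proj y')) \<le> modulus a0 A0 ?D" using q s by (intro b_mod) auto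
      moreover have "norm (b q (torus_proj y') - b q (torus_proj y)) \<le> \<epsilon>" by (rule near[OF q yy])
      ultimately show "norm (b q (X q (torus_proj u)) - b q (torus_proj y)) \<le> 2 * \<epsilon> + modulus a0 A0 ?D"
        unfolding bq[OF q] using tri[of "b q (torus_proj (lift q u))" "b q (torus_proj y)" "b q (torus_proj (lift s' u))"]
          tri[of "b q (torus_proj (lift s' u))" "b q (torus_proj y)" "b q (torus_proj y')"] by linarith
    qed
    moreover have "norm (lift s u - y) \<le> ?D + (norm (?A1 - ?A2) + norm (?\<delta> *\<^sub>R V - ?A2))"
    proof -
      have "lift s u - y = (lift s' u - y') - ((?A1 - ?A2) - (?\<delta> *\<^sub>R V - ?A2))" unfolding main by simp
      then show ?thesis by (metis (no_types) add_left_mono norm_triangle_ineq4 order_trans)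
    qed
    ultimately have "norm (lift s u - y) \<le> ?D + (?\<delta> * (2 * \<epsilon> + modulus a0 A0 ?D) + ?\<delta> * \<epsilon>)" using V by linarith
    also have "\<dots> \<le> ?D + ?\<delta> * (4 * \<epsilon> + modulus a0 A0 ?D)" using s \<epsilon> by (simp add: algebra_simps mult_left_mono)
    finally show ?thesis .
  qed
qed

text \<open>The constants are chosen in this order: the tolerance e0 of the Osgood lemma, then the radius and
  the tail of the kernel, which fix \<rho> and with it a bound C for the gradients of the averaged
  fields, and finally the number n of steps, so large that \<delta> C and the quadratic Jacobian errors, of total size
  n (\<delta> C)^2, are negligible. The total compression is then at most exp (t L + 1).\<close>

lemma approximation:
  assumes t: "0 < t" "t \<le> T" and \<epsilon>: "\<epsilon> > 0"
  obtains Y Z a where "\<And>u. norm (Y u - lift t u) \<le> \<epsilon>" "\<And>u. norm (Z (lift t u) - u) \<le> \<epsilon>" "\<And>u. Y (Z u) = u" 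
    "continuous_on UNIV Y"
    "\<And>x y. norm (Y x - Y y) \<le> exp (a x) * norm (x - y)" "\<And>x y. norm (Z x - Z y) \<le> exp (a x) * norm (x - y)"
    "a \<in> borel_measurable borel"
    "(\<integral>\<^sup>+x\<in>cube. ennreal (exp (\<beta> / (16 * t) * a x)) \<partial>lborel) \<le> ennreal (flow_const TYPE('n) * exp (t * L) * K)"
proof -
  obtain e0 where e0: "e0 > 0" and Osgood: 
    "\<And>D n \<delta>. \<lbrakk>D 0 = 0; \<And>k. D k \<ge> 0; \<And>k. k < n \<Longrightarrow> D (Suc k) \<le> D k + \<delta> * (e0 + modulus a0 A0 (D k)); 
       \<delta> \<ge> 0; real n * \<delta> = t; \<delta> * A0 \<le> 1/2\<rbrakk> \<Longrightarrow> D n \<le> \<epsilon>"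
    by (rule discrete_Osgood[OF a0 A0 less_imp_le[OF t(1)] \<epsilon>]) blast
  define e1 where "e1 = e0 / 4"
  have e1: "e1 > 0" "e1 / 2 > 0" "e0 = 4 * e1" using e0 by (auto simp: e1_def)
  obtain r2 where r2: "r2 > 0" "\<And>s. 0 \<le> s \<Longrightarrow> s \<le> r2 \<Longrightarrow> modulus a0 A0 s \<le> e1" by (rule modulus_small[OF a0 A0 e1(1)]) blast
  obtain r1 where r1: "r1 > 0" "\<And>s. 0 \<le> s \<Longrightarrow> s \<le> r1 \<Longrightarrow> modulus a0 A0 s \<le> e1 / 2" by (rule modulus_small[OF a0 A0 e1(2)]) blast
  \<comment> \<open>the mass of the kernel away from the lattice, where \<open>b\<close> may vary by \<open>osc\<close>\<close>
  define \<eta> where "\<eta> = e1 / (2 * (osc + 1))"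
  have \<eta>: "\<eta> > 0" "e1 / 2 + osc * \<eta> \<le> e1" using e1 osc_nonneg by (auto simp: \<eta>_def field_simps)
  obtain \<rho> :: "real ^ 'n \<Rightarrow> real" where \<rho>: "trig \<rho>" "\<And>x. \<rho> x \<ge> 0" "(\<integral>\<^sup>+x\<in>cube. ennreal (\<rho> x) \<partial>lborel) = 1"
     and tail: "(\<integral>\<^sup>+x\<in>cube. ennreal (\<rho> x) * indicator {x. far r1 x} x \<partial>lborel) \<le> ennreal \<eta>"
    by (rule kernel_exists[OF r1(1) \<eta>(1)]) blast
  obtain B where B: "\<And>x. \<bar>\<rho> x\<bar> \<le> B" by (rule trig_bounded[OF \<rho>(1)]) blast
  have B': "\<And>x. \<rho> x \<le> B" using B abs_le_D1 by blast
  define C where "C = B * (K / \<beta>)"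
  have C0: "C \<ge> 0" using B[of 0] K \<beta> by (auto simp: C_def intro!: mult_nonneg_nonneg)
  define c where "c = det_const CARD('n)"
  have c0: "c \<ge> 0" by (simp add: c_def det_const_def)
  obtain d where d: "d > 0" "\<And>s s'. 0 \<le> s \<Longrightarrow> s \<le> s' \<Longrightarrow> s' \<le> T \<Longrightarrow> s' - s < d \<Longrightarrow> integral {s..s'} speed < r2 / 2"
    by (rule speed_small[of "r2 / 2"]) (use r2 in auto)
  let ?\<delta> = "\<lambda>n. t / real n"
  have lim: "?\<delta> \<longlonglongrightarrow> 0" by (rule lim_const_over_n)
  have ev: "\<forall>\<^sub>F n in sequentially. f (?\<delta> n) < y" if "isCont f 0" "f 0 < y" for f :: "real \<Rightarrow> real" and y
    using isCont_tendsto_compose[OF that(1) lim] that(2) by (rule order_tendstoD(2))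
  \<comment> \<open>each condition compares a continuous function of the step size with a number above its value at 0\<close>
  have "\<forall>\<^sub>F n in sequentially. ?\<delta> n * A0 < 1/2 \<and> ?\<delta> n * C < 1/2 \<and> ?\<delta> n * L + c * (?\<delta> n * C)\<^sup>2 < 1/2 \<and>
     t * (L + c * ?\<delta> n * C\<^sup>2 + 2 * ?\<delta> n * (L + c * ?\<delta> n * C\<^sup>2)\<^sup>2) < t * L + 1 \<and> ?\<delta> n < d \<and> ?\<delta> n * e1 < r2 / 2 \<and> 0 < n"
    using d(1) r2(1) by (intro eventually_conj ev[where f = "\<lambda>\<delta>. \<delta> * A0"] ev[where f = "\<lambda>\<delta>. \<delta> * C"]
      ev[where f = "\<lambda>\<delta>. \<delta> * L + c * (\<delta> * C)\<^sup>2"] ev[where f = "\<lambda>\<delta>. t * (L + c * \<delta> * C\<^sup>2 + 2 * \<delta> * (L + c * \<delta> * C\<^sup>2)\<^sup>2)"]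
      ev[where f = "\<lambda>\<delta>. \<delta>"] ev[where f = "\<lambda>\<delta>. \<delta> * e1"] eventually_gt_at_top) (auto intro!: continuous_intros)
  then obtain n where n: "?\<delta> n * A0 < 1/2" "?\<delta> n * C < 1/2" "?\<delta> n * L + c * (?\<delta> n * C)\<^sup>2 < 1/2"
     "t * (L + c * ?\<delta> n * C\<^sup>2 + 2 * ?\<delta> n * (L + c * ?\<delta> n * C\<^sup>2)\<^sup>2) < t * L + 1" "?\<delta> n < d" "?\<delta> n * e1 < r2 / 2" "0 < n"
    unfolding eventually_sequentially by blast
  define \<delta> where "\<delta> = t / real n"
  have \<delta>: "\<delta> > 0" "real n * \<delta> = t" using t n(7) by (auto simp: \<delta>_def)
  define s where "s = (\<lambda>k::nat. real k * \<delta>)"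
  have sS: "s (Suc k) - s k = \<delta>" for k by (simp add: s_def algebra_simps)
  have s: "0 \<le> s k" "s k < s (Suc k)" "s (Suc k) \<le> T" if "k < n" for k
  proof -
    have "real (Suc k) * \<delta> \<le> real n * \<delta>" using that \<delta>(1) by (intro mult_right_mono) auto
    then show "s (Suc k) \<le> T" using \<delta>(2) t by (simp add: s_def)
    show "0 \<le> s k" using \<delta>(1) by (simp add: s_def)
    show "s k < s (Suc k)" using sS[of k] \<delta>(1) by linarith
  qed
  have s0: "s 0 = 0" and sn: "s n = t" using \<delta>(2) by (auto simp: s_def)
  define v where "v = (\<lambda>k. averaged_field.field (avg (s k) (s (Suc k))) b \<rho>)"
  define G where "G = (\<lambda>k. averaged_field.grad (avg (s k) (s (Suc k))) Db \<rho>)"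
  define \<kappa> where "\<kappa> = \<delta> * L + det_const CARD('n) * (\<delta> * C)\<^sup>2"
  have \<kappa>: "0 \<le> \<kappa>" "\<kappa> \<le> 1/2" using n(3) \<delta>(1) L c0 by (auto simp: \<kappa>_def c_def \<delta>_def[symmetric])
  interpret E: euler_scheme v G \<beta> K C L \<delta> \<kappa> n
  proof
    fix k assume k: "k < n"
    interpret A: averaged_field "avg (s k) (s (Suc k))" b Db \<beta> K \<rho> by (rule averaged(1)[OF s[OF k] \<rho>])
    show "smooth_field \<beta> K (v k) (G k)" unfolding v_def G_def by (rule A.smooth_field)
    show "norm (G k x) \<le> C" for x unfolding G_def C_def by (rule A.grad_bounded[OF B'])
    show "\<bar>trace (G k x)\<bar> \<le> L" for x unfolding G_def by (rule A.trace_grad[OF averaged(2)[OF s[OF k] \<rho>]])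
  next
    show "\<kappa> = \<delta> * L + det_const CARD('n) * (\<delta> * C)\<^sup>2" by (rule \<kappa>_def)
    show "\<kappa> < 1" using \<kappa> by linarith
    show "\<delta> * C \<le> 1/2" using n(2) by (simp add: \<delta>_def)
  qed (rule \<delta> L \<beta> K n(7) C0)+
  have step: "norm (lift (s (Suc k)) u - y') \<le> norm (lift (s k) u - y) + \<delta> * (e0 + modulus a0 A0 (norm (lift (s k) u - y)))"
    "norm (lift (s k) u - y) \<le> norm (lift (s (Suc k)) u - y') + \<delta> * (e0 + modulus a0 A0 (norm (lift (s (Suc k)) u - y')))"
    if k: "k < n" and y': "y' = y + \<delta> *\<^sub>R v k y" for k u y y'
  proof -
    have V: "norm ((s (Suc k) - s k) *\<^sub>R v k y - integral {s k..s (Suc k)} (\<lambda>r. b r (torus_proj y))) \<le> (s (Suc k) - s k) * e1"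
    proof -
      have "norm ((s (Suc k) - s k) *\<^sub>R v k y - integral {s k..s (Suc k)} (\<lambda>r. b r (torus_proj y))) \<le> (s (Suc k) - s k) * (e1 / 2 + osc * \<eta>)"
        unfolding v_def by (rule averaged_step[OF s[OF k] \<rho> tail r1(2)]) (use e1 \<eta> in auto)
      also have "\<dots> \<le> (s (Suc k) - s k) * e1" using s(2)[OF k] \<eta>(2) by (intro mult_left_mono) auto
      finally show ?thesis .
    qed
    have small: "integral {s k..s (Suc k)} speed \<le> r2 / 2" "(s (Suc k) - s k) * e1 \<le> r2 / 2"
      using d(2)[of "s k" "s (Suc k)"] s[OF k] n(5,6) unfolding sS \<delta>_def[symmetric] by auto
    show "norm (lift (s (Suc k)) u - y') \<le> norm (lift (s k) u - y) + \<delta> * (e0 + modulus a0 A0 (norm (lift (s k) u - y)))"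
      "norm (lift (s k) u - y) \<le> norm (lift (s (Suc k)) u - y') + \<delta> * (e0 + modulus a0 A0 (norm (lift (s (Suc k)) u - y')))"
      using one_step_comparison[OF s[OF k] r2(2) small less_imp_le[OF e1(1)] V, of y' u] y' unfolding sS e1(3) by auto
  qed
  have dA: "\<delta> * A0 \<le> 1/2" using n(1) by (simp add: \<delta>_def)
  show thesis
  proof (rule that[of "E.Y n" E.Z E.growth2])
    fix u
    have "norm (lift (s n) u - E.Y n u) \<le> \<epsilon>"
      by (rule Osgood[where D = "\<lambda>k. norm (lift (s k) u - E.Y k u)" and \<delta> = \<delta>, OF _ _ step(1) less_imp_le[OF \<delta>(1)] \<delta>(2) dA])
         (auto simp: s0 lift_0)
    then show "norm (E.Y n u - lift t u) \<le> \<epsilon>" by (simp add: sn norm_minus_commute)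
    \<comment> \<open>the scheme that ends at \<open>lift t u\<close>, read backwards from its common end point with the trajectory\<close>
    let ?w = "lift t u"
    let ?D = "\<lambda>k. norm (lift (s (n - k)) u - E.Y (n - k) (E.Z ?w))"
    have "?D n \<le> \<epsilon>"
    proof (rule Osgood[where D = ?D, OF _ _ _ less_imp_le[OF \<delta>(1)] \<delta>(2) dA])
      show "?D 0 = 0" by (simp add: sn E.YZ)
      fix k assume k: "k < n"
      then have j: "n - Suc k < n" "Suc (n - Suc k) = n - k" by auto
      show "?D (Suc k) \<le> ?D k + \<delta> * (e0 + modulus a0 A0 (?D k))"
        using step(2)[OF j(1) refl, of u "E.Y (n - Suc k) (E.Z ?w)"] unfolding euler.simps(2)[symmetric] j(2) .
    qed simp
    then show "norm (E.Z ?w - u) \<le> \<epsilon>" by (simp add: s0 lift_0 norm_minus_commute)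
    show "E.Y n (E.Z u) = u" by (rule E.YZ) simp
  next
    show "continuous_on UNIV (E.Y n)" by (rule E.Y_continuous) simp
    show "norm (E.Y n x - E.Y n y) \<le> exp (E.growth2 x) * norm (x - y)" for x y by (rule E.Y_bound)
    show "norm (E.Z x - E.Z y) \<le> exp (E.growth2 x) * norm (x - y)" for x y by (rule E.Z_bound)
    show "E.growth2 \<in> borel_measurable borel" by (rule E.growth2_measurable)
    have "E.J ^ n \<le> exp (\<kappa> + 2 * \<kappa>\<^sup>2) ^ n"
      unfolding E.J_def using \<kappa> by (intro power_mono inverse_one_minus_le_exp) auto
    also have "\<dots> = exp (real n * (\<kappa> + 2 * \<kappa>\<^sup>2))" by (simp only: exp_of_nat_mult)
    also have "real n * (\<kappa> + 2 * \<kappa>\<^sup>2) = t * (L + c * \<delta> * C\<^sup>2 + 2 * \<delta> * (L + c * \<delta> * C\<^sup>2)\<^sup>2)"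
    proof -
      have k: "\<kappa> = \<delta> * (L + c * \<delta> * C\<^sup>2)" by (simp add: \<kappa>_def c_def power2_eq_square algebra_simps)
      have "real n * (\<delta> * w + 2 * (\<delta> * w)\<^sup>2) = (real n * \<delta>) * (w + 2 * \<delta> * w\<^sup>2)" for w
        by (simp add: power2_eq_square algebra_simps)
      then show ?thesis unfolding k \<delta>(2) .
    qed
    also have "\<dots> \<le> t * L + 1" using n(4) by (simp add: \<delta>_def)
    finally have J: "E.J ^ n \<le> exp (t * L + 1)" by simp
    have "(\<integral>\<^sup>+x\<in>cube. ennreal (exp (\<beta> / (16 * t) * E.growth2 x)) \<partial>lborel) \<le> ennreal (2 * E.J ^ n * (lip_const TYPE('n) * K))"
      by (rule E.exp_growth2_integral[OF \<delta>(2)[symmetric]])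
    also have "\<dots> \<le> ennreal (flow_const TYPE('n) * exp (t * L) * K)"
    proof (rule ennreal_leI)
      have "2 * E.J ^ n * (lip_const TYPE('n) * K) \<le> 2 * exp (t * L + 1) * (lip_const TYPE('n) * K)"
        using J lip_const_pos[where 'n = 'n] K by (intro mult_right_mono mult_left_mono) (auto intro!: mult_nonneg_nonneg less_imp_le)
      also have "\<dots> = flow_const TYPE('n) * exp (t * L) * K" by (simp add: flow_const_def exp_add)
      finally show "2 * E.J ^ n * (lip_const TYPE('n) * K) \<le> flow_const TYPE('n) * exp (t * L) * K" .
    qed
    finally show "(\<integral>\<^sup>+x\<in>cube. ennreal (exp (\<beta> / (16 * t) * E.growth2 x)) \<partial>lborel) \<le> ennreal (flow_const TYPE('n) * exp (t * L) * K)" .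
  qed
qed

end


section \<open>The Lipschitz constant of the flow\<close>

lemma ennreal_powr_inverse:
  assumes "q > 0" shows "ennreal_powr (ennreal_powr l (1 / q)) q = l"
proof (cases l)
  case (real r)
  then show ?thesis using assms by (simp add: ennreal_powr_def powr_powr)
qed (simp add: ennreal_powr_def)

lemma ennreal_powr_mono:
  assumes "l \<le> ennreal c" "0 \<le> c" "0 \<le> p" shows "ennreal_powr l p \<le> ennreal (c powr p)"
proof -
  obtain r where r: "l = ennreal r" "0 \<le> r" using assms(1) by (cases l) (auto simp: top_unique)
  then have "r \<le> c" using assms by simp
  then show ?thesis using r assms by (simp add: ennreal_powr_def ennreal_leI powr_mono2)
qed

lemma ennreal_powr_measurable [measurable]: "(\<lambda>l. ennreal_powr l p) \<in> borel_measurable borel"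
  unfolding ennreal_powr_def by measurable

text \<open>For every c above the lower limit, exp (q a j) < c for infinitely many j, and for these
  A j \<le> c^(1/q) r; since A converges, its limit obeys the same bound.\<close>

lemma liminf_Lipschitz:
  fixes D r q :: real
  assumes lim: "A \<longlonglongrightarrow> D" and bd: "\<And>j. A j \<le> exp (a j) * r" and r: "r \<ge> 0" and q: "q > 0"
  shows "ennreal D \<le> ennreal_powr (liminf (\<lambda>j. ennreal (exp (q * a j)))) (1 / q) * ennreal r"
proof (cases "liminf (\<lambda>j. ennreal (exp (q * a j)))")
  case top
  show ?thesis
  proof (cases "r = 0")
    case True
    then have "A j \<le> 0" for j using bd[of j] by simp
    then have "D \<le> 0" using LIMSEQ_le_const2[OF lim, of 0] by auto
    then show ?thesis by (simp add: ennreal_neg)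
  next
    case False
    then show ?thesis using r top by (simp add: ennreal_powr_def ennreal_top_mult)
  qed
next
  case (real l)
  have le: "D \<le> c powr (1 / q) * r" if c: "c > l" for c
  proof (rule ccontr)
    assume "\<not> D \<le> c powr (1 / q) * r"
    then have ev: "\<forall>\<^sub>F j in sequentially. c powr (1 / q) * r < A j" using lim by (intro order_tendstoD(1)) auto
    have "\<forall>\<^sub>F j in sequentially. ennreal c \<le> ennreal (exp (q * a j))"
      using ev
    proof eventually_elim
      case (elim j)
      have "c \<le> exp (q * a j)"
      proof (rule ccontr)
        assume "\<not> c \<le> exp (q * a j)"
        then have "exp (q * a j) powr (1 / q) \<le> c powr (1 / q)" using q by (intro powr_mono2) auto
        then have "exp (a j) \<le> c powr (1 / q)" using q by (simp add: powr_def)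
        then have "exp (a j) * r \<le> c powr (1 / q) * r" using r by (rule mult_right_mono)
        then show False using bd[of j] elim by linarith
      qed
      then show ?case by (rule ennreal_leI)
    qed
    then have "ennreal c \<le> liminf (\<lambda>j. ennreal (exp (q * a j)))" by (rule Liminf_bounded)
    then show False using real c by simp
  qed
  have "((\<lambda>c. c powr (1 / q) * r) \<longlongrightarrow> l powr (1 / q) * r) (at_right l)"
  proof (intro tendsto_mult tendsto_const tendsto_powr' tendsto_ident_at)
    show "l \<noteq> 0 \<or> (0 < 1 / q \<and> (\<forall>\<^sub>F c in at_right l. 0 \<le> c))"
      using real q by (auto simp: eventually_at_right_less intro: eventually_mono[OF eventually_at_right_less])
  qed
  then have "D \<le> l powr (1 / q) * r"
    by (rule tendsto_lowerbound) (auto simp: le intro: eventually_mono[OF eventually_at_right_less])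
  then show ?thesis using real r by (simp add: ennreal_powr_def ennreal_mult[symmetric] ennreal_leI)
qed

context flow_problem
begin

text \<open>The flow map is the uniform limit of the continuous schemes, hence continuous. It is injective
  because the inverse schemes recover the starting point. It is surjective because the preimages
  of w under the schemes are bounded and any limit point of them is mapped to w. The estimates pass to the limit by
  liminf_Lipschitz and the integral bound by Fatou's lemma.\<close>

lemma flow_regularity:
  assumes t: "0 < t" "t \<le> T"
  obtains g where "g \<in> borel_measurable torus_measure"
    "\<And>x y. ennreal (dist (X t x) (X t y)) \<le> g x * ennreal (dist x y)"
    "\<And>x y. ennreal (dist (inv (X t) x) (inv (X t) y)) \<le> g x * ennreal (dist x y)"
    "Lq_norm torus_measure (ereal (\<beta> / (16 * t))) g
       \<le> ennreal ((flow_const TYPE('n) * exp (t * L) * K) powr (16 * t / \<beta>))"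
proof -
  have tT: "t \<in> {0..T}" using t by auto
  define q where "q = \<beta> / (16 * t)"
  have q: "q > 0" "1 / q = 16 * t / \<beta>" using t \<beta> by (auto simp: q_def)
  let ?Kc = "flow_const TYPE('n) * exp (t * L) * K"
  have fc: "flow_const TYPE('n) > 0" using lip_const_pos[where 'n = 'n] by (simp add: flow_const_def)
  have Kc: "?Kc \<ge> 0" using fc K by simp
  let ?\<epsilon> = "\<lambda>j. 1 / real (Suc j)"
  define good where "good = (\<lambda>j (Y :: real ^ 'n \<Rightarrow> real ^ 'n, Z, a).
     (\<forall>u. norm (Y u - lift t u) \<le> ?\<epsilon> j) \<and> (\<forall>u. norm (Z (lift t u) - u) \<le> ?\<epsilon> j) \<and> (\<forall>u. Y (Z u) = u) \<and> continuous_on UNIV Y \<and>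
     (\<forall>x y. norm (Y x - Y y) \<le> exp (a x) * norm (x - y)) \<and> (\<forall>x y. norm (Z x - Z y) \<le> exp (a x) * norm (x - y)) \<and>
     a \<in> borel_measurable borel \<and> (\<integral>\<^sup>+x\<in>cube. ennreal (exp (q * a x)) \<partial>lborel) \<le> ennreal ?Kc)"
  have "\<exists>p. good j p" for j
  proof -
    have \<epsilon>: "?\<epsilon> j > 0" by simp
    show ?thesis
    proof (rule approximation[OF t \<epsilon>])
      fix Y Z a
      assume "\<And>u. norm (Y u - lift t u) \<le> ?\<epsilon> j" "\<And>u. norm (Z (lift t u) - u) \<le> ?\<epsilon> j" "\<And>u. Y (Z u) = u" 
        "continuous_on UNIV Y"
        "\<And>x y. norm (Y x - Y y) \<le> exp (a x) * norm (x - y)" "\<And>x y. norm (Z x - Z y) \<le> exp (a x) * norm (x - y)"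
        "a \<in> borel_measurable borel"
        "(\<integral>\<^sup>+x\<in>cube. ennreal (exp (\<beta> / (16 * t) * a x)) \<partial>lborel) \<le> ennreal (flow_const TYPE('n) * exp (t * L) * K)"
      then have "good j (Y, Z, a)" unfolding good_def q_def by blast
      then show "\<exists>p. good j p" ..
    qed
  qed
  then obtain p where p: "\<And>j. good j (p j)" by metis
  define Y where "Y = (\<lambda>j. fst (p j))"
  define Z where "Z = (\<lambda>j. fst (snd (p j)))"
  define a where "a = (\<lambda>j. snd (snd (p j)))"
  have Y: "norm (Y j u - lift t u) \<le> ?\<epsilon> j" and Z: "norm (Z j (lift t u) - u) \<le> ?\<epsilon> j" and YZ: "Y j (Z j u) = u"
    and Yc: "continuous_on UNIV (Y j)" and Yb: "norm (Y j x - Y j y) \<le> exp (a j x) * norm (x - y)"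
    and Zb: "norm (Z j x - Z j y) \<le> exp (a j x) * norm (x - y)" and am: "a j \<in> borel_measurable borel"
    and ai: "(\<integral>\<^sup>+x\<in>cube. ennreal (exp (q * a j x)) \<partial>lborel) \<le> ennreal ?Kc" for j u x y
    using p[of j] unfolding good_def Y_def Z_def a_def by (auto simp: case_prod_unfold)
  have \<epsilon>0: "?\<epsilon> \<longlonglongrightarrow> 0" by (rule LIMSEQ_Suc[OF lim_1_over_n])
  have null: "f \<longlonglongrightarrow> l" if "\<And>j. norm (f j - l) \<le> ?\<epsilon> j" for f :: "nat \<Rightarrow> real ^ 'n" and l
    by (rule LIM_zero_cancel, rule Lim_null_comparison[OF _ \<epsilon>0]) (use that in auto)
  have Ylim: "(\<lambda>j. Y j u) \<longlonglongrightarrow> lift t u" for u by (rule null[OF Y])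
  have Zlim: "(\<lambda>j. Z j (lift t u)) \<longlonglongrightarrow> u" for u by (rule null[OF Z])
  have contl: "continuous_on UNIV (lift t)"
  proof (rule uniform_limit_theorem[where F = sequentially and f = Y])
    show "\<forall>\<^sub>F j in sequentially. continuous_on UNIV (Y j)" using Yc by simp
    show "uniform_limit UNIV Y (lift t) sequentially"
    proof (rule uniform_limitI)
      fix e :: real assume "e > 0"
      then have "\<forall>\<^sub>F j in sequentially. ?\<epsilon> j < e" using \<epsilon>0 by (intro order_tendstoD(2))
      then show "\<forall>\<^sub>F j in sequentially. \<forall>u\<in>UNIV. dist (Y j u) (lift t u) < e"
        by eventually_elim (auto simp: dist_norm intro: le_less_trans[OF Y])
    qed
  qed simp
  have inj: "u = u'" if "lift t u = lift t u'" for u u'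
    using LIMSEQ_unique[OF Zlim[of u], of u'] Zlim[of u'] that by simp
  have surj: "\<exists>u. lift t u = w" for w
  proof -
    define N where "N = integral {0..t} speed + 1"
    have "Z j w \<in> cball w N" for j
    proof -
      have "norm (lift t (Z j w) - Z j w) \<le> integral {0..t} speed" using lift_move[of 0 t "Z j w"] t by (simp add: lift_0)
      moreover have "norm (w - lift t (Z j w)) \<le> 1" using Y[of j "Z j w"] by (simp add: YZ) (smt (verit) divide_le_eq_1_pos of_nat_0_le_iff)
      ultimately have "norm (w - Z j w) \<le> N" using norm_triangle_ineq[of "w - lift t (Z j w)" "lift t (Z j w) - Z j w"] by (simp add: N_def)
      then show ?thesis by (simp add: dist_norm)
    qed
    then obtain u r where u: "strict_mono r" "(\<lambda>j. Z (r j) w) \<longlonglongrightarrow> u"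
      using compact_imp_seq_compact[OF compact_cball[of w N]] unfolding seq_compact_def by (force simp: comp_def)
    have "(\<lambda>j. lift t (Z (r j) w)) \<longlonglongrightarrow> lift t u"
      using contl u(2) by (intro continuous_on_tendsto_compose[OF contl]) auto
    moreover have "(\<lambda>j. lift t (Z j w)) \<longlonglongrightarrow> w"
    proof (rule null)
      fix j
      show "norm (lift t (Z j w) - w) \<le> ?\<epsilon> j" using Y[of j "Z j w"] by (simp add: YZ norm_minus_commute)
    qed
    then have "(\<lambda>j. lift t (Z (r j) w)) \<longlonglongrightarrow> w" using LIMSEQ_subseq_LIMSEQ[OF _ u(1)] by (auto simp: comp_def)
    ultimately show ?thesis using LIMSEQ_unique by blast
  qed
  define G where "G = (\<lambda>u. liminf (\<lambda>j. ennreal (exp (q * a j u))))"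
  have Gm[measurable]: "G \<in> borel_measurable borel"
  proof -
    have [measurable]: "a j \<in> borel_measurable borel" for j by (rule am)
    show ?thesis unfolding G_def by measurable
  qed
  have Gi: "(\<integral>\<^sup>+x\<in>cube. G x \<partial>lborel) \<le> ennreal ?Kc"
  proof -
    have [measurable]: "a j \<in> borel_measurable borel" for j by (rule am)
    have "(\<integral>\<^sup>+x\<in>cube. G x \<partial>lborel) = (\<integral>\<^sup>+x. liminf (\<lambda>j. ennreal (exp (q * a j x)) * indicator cube x) \<partial>lborel)"
      unfolding G_def by (intro nn_integral_cong) (auto simp: indicator_def Liminf_const)
    also have "\<dots> \<le> liminf (\<lambda>j. \<integral>\<^sup>+x. ennreal (exp (q * a j x)) * indicator cube x \<partial>lborel)"
      by (rule nn_integral_liminf) measurable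
    also have "\<dots> \<le> liminf (\<lambda>j. ennreal ?Kc)" by (intro Liminf_mono always_eventually allI ai)
    also have "\<dots> = ennreal ?Kc" by (rule Liminf_const) simp
    finally show ?thesis .
  qed
  define g where "g = (\<lambda>x. ennreal_powr (G (cube_rep x)) (1 / q))"
  have forw: "ennreal (norm (lift t u - lift t w)) \<le> ennreal_powr (G u) (1 / q) * ennreal (norm (u - w))" for u w
    unfolding G_def by (rule liminf_Lipschitz[OF _ Yb _ q(1)]) (auto intro!: tendsto_norm tendsto_diff Ylim)
  have backw: "ennreal (norm (u - w)) \<le> ennreal_powr (G (lift t u)) (1 / q) * ennreal (norm (lift t u - lift t w))" for u w
    unfolding G_def by (rule liminf_Lipschitz[OF _ Zb _ q(1)]) (auto intro!: tendsto_norm tendsto_diff Zlim)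
  have X_inj: "inj (X t)"
  proof (rule injI)
    fix x y assume "X t x = X t y"
    then have "torus_proj (lift t (cube_rep x)) = torus_proj (lift t (cube_rep y))" using lift_proj[OF tT] by simp
    then have k: "lift t (cube_rep x) - lift t (cube_rep y) \<in> int_lattice" by (simp add: torus_proj_eq_iff)
    have "lift t (cube_rep x) = lift t (cube_rep y + (lift t (cube_rep x) - lift t (cube_rep y)))"
      using lift_add[OF k, of t "cube_rep y"] by simp
    then have "cube_rep x = cube_rep y + (lift t (cube_rep x) - lift t (cube_rep y))" by (rule inj)
    then have "torus_proj (cube_rep x) = torus_proj (cube_rep y)" using torus_proj_add[OF k, of "cube_rep y"] by simp
    then show "x = y" by simp
  qed
  have inv: "inv (X t) (torus_proj (lift t u)) = torus_proj u" for u
    by (rule inv_f_eq[OF X_inj]) (simp add: lift_proj[OF tT])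
  show thesis
  proof (rule that[of g])
    show "g \<in> borel_measurable torus_measure" unfolding g_def by measurable
    fix x y :: "'n torus"
    obtain w where w: "torus_proj w = y" "dist (cube_rep x) w = dist x y"
      using torus_lift_dist[of y "cube_rep x"] by auto
    have "dist (X t x) (X t y) \<le> norm (lift t (cube_rep x) - lift t w)"
      using dist_torus_proj_le[of "lift t (cube_rep x)" "lift t w"] lift_proj[OF tT] w(1) by (simp add: dist_norm)
    then have "ennreal (dist (X t x) (X t y)) \<le> ennreal (norm (lift t (cube_rep x) - lift t w))" by (rule ennreal_leI)
    also have "\<dots> \<le> g x * ennreal (dist x y)" using forw[of "cube_rep x" w] w(2) by (simp add: g_def dist_norm)
    finally show "ennreal (dist (X t x) (X t y)) \<le> g x * ennreal (dist x y)" .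
    obtain u where u: "lift t u = cube_rep x" using surj by blast
    obtain u' where u': "lift t u' = w" using surj by blast
    have "inv (X t) x = torus_proj u" "inv (X t) y = torus_proj u'" using inv[of u] inv[of u'] u u' w(1) by simp_all
    then have "dist (inv (X t) x) (inv (X t) y) \<le> norm (u - u')" using dist_torus_proj_le[of u u'] by (simp add: dist_norm)
    then have "ennreal (dist (inv (X t) x) (inv (X t) y)) \<le> ennreal (norm (u - u'))" by (rule ennreal_leI)
    also have "\<dots> \<le> g x * ennreal (dist x y)" using backw[of u u'] w(2) by (simp add: g_def dist_norm u u')
    finally show "ennreal (dist (inv (X t) x) (inv (X t) y)) \<le> g x * ennreal (dist x y)" .
  next
    have "(\<integral>\<^sup>+x. ennreal_powr (g x) q \<partial>torus_measure) = (\<integral>\<^sup>+x. G (cube_rep x) \<partial>torus_measure)"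
      unfolding g_def by (simp add: ennreal_powr_inverse[OF q(1)])
    also have "\<dots> = (\<integral>\<^sup>+x\<in>cube. G (cube_rep (torus_proj x)) \<partial>lborel)" by (rule nn_integral_torus) measurable
    also have "\<dots> = (\<integral>\<^sup>+x\<in>cube. G x \<partial>lborel)" by (intro nn_integral_cong) (auto simp: indicator_def cube_rep_proj)
    also note Gi
    finally have "ennreal_powr (\<integral>\<^sup>+x. ennreal_powr (g x) q \<partial>torus_measure) (1 / q) \<le> ennreal (?Kc powr (1 / q))"
      using Kc q(1) by (intro ennreal_powr_mono) auto
    then show "Lq_norm torus_measure (ereal (\<beta> / (16 * t))) g \<le> ennreal (?Kc powr (16 * t / \<beta>))"
      unfolding q(2)[symmetric] q_def[symmetric] by (simp add: Lq_norm_def)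
  qed
qed

end

theorem theorem0p1:
  shows "\<exists>C1>0. \<exists>C2>0.
    \<forall>(T::real) (b :: real \<Rightarrow> 'n::finite torus \<Rightarrow> real ^ 'n)
      (Db :: real \<Rightarrow> 'n torus \<Rightarrow> real ^ 'n ^ 'n) (\<beta>::real) (K::real) (L::real)
      (X :: real \<Rightarrow> 'n torus \<Rightarrow> 'n torus).
      T > 0 \<longrightarrow> \<beta> > 0 \<longrightarrow> K \<ge> 0 \<longrightarrow> L \<ge> 0 \<longrightarrow>
      (\<lambda>(t, x). b t x) \<in> borel_measurable (space_time T) \<longrightarrow>
      (\<forall>t\<in>{0..T}. continuous_on UNIV (b t)) \<longrightarrow>
      (\<lambda>(t, x). Db t x) \<in> borel_measurable (space_time T) \<longrightarrow>
      (\<forall>t\<in>{0..T}. weak_gradient (b t) (Db t)) \<longrightarrow>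
      (SUP t\<in>{0..T}. \<integral>\<^sup>+ x. ennreal (exp (\<beta> * norm (Db t x))) \<partial>torus_measure) = ennreal K \<longrightarrow>
      Lq_norm (space_time T) \<infinity> (\<lambda>(t, x). ennreal \<bar>trace (Db t x)\<bar>) = ennreal L \<longrightarrow>
      is_flow T b X \<longrightarrow>
      (\<forall>t\<in>{0..T}. \<exists>g :: 'n torus \<Rightarrow> ennreal.
         g \<in> borel_measurable torus_measure \<and>
         (\<forall>x y. ennreal (dist (X t x) (X t y)) \<le> g x * ennreal (dist x y) \<and>
                ennreal (dist (inv (X t) x) (inv (X t) y)) \<le> g x * ennreal (dist x y)) \<and>
         Lq_norm torus_measure (if t = 0 then \<infinity> else ereal (\<beta> / (C1 * t))) g
           \<le> ennreal (exp (t\<^sup>2 * L * C1 / \<beta>) * (C2 * K) powr (t * C1 / \<beta>)))"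
proof (rule exI[of _ "16 :: real"], rule conjI, simp, rule exI[of _ "flow_const TYPE('n)"], intro conjI allI impI ballI)
  show fc: "flow_const TYPE('n) > 0" using lip_const_pos[where 'n = 'n] by (simp add: flow_const_def)
  fix T :: real and b :: "real \<Rightarrow> 'n torus \<Rightarrow> real ^ 'n" and Db :: "real \<Rightarrow> 'n torus \<Rightarrow> real ^ 'n ^ 'n"
    and \<beta> K L :: real and X :: "real \<Rightarrow> 'n torus \<Rightarrow> 'n torus" and t :: real
  assume T: "T > 0" and \<beta>: "\<beta> > 0" and K0: "K \<ge> 0" and L: "L \<ge> 0"
    and bm: "(\<lambda>(t, x). b t x) \<in> borel_measurable (space_time T)"
    and bc: "\<forall>t\<in>{0..T}. continuous_on UNIV (b t)"
    and Dm: "(\<lambda>(t, x). Db t x) \<in> borel_measurable (space_time T)"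
    and wg: "\<forall>t\<in>{0..T}. weak_gradient (b t) (Db t)"
    and SUP: "(SUP t\<in>{0..T}. \<integral>\<^sup>+ x. ennreal (exp (\<beta> * norm (Db t x))) \<partial>torus_measure) = ennreal K"
    and div: "Lq_norm (space_time T) \<infinity> (\<lambda>(t, x). ennreal \<bar>trace (Db t x)\<bar>) = ennreal L"
    and fl: "is_flow T b X" and t: "t \<in> {0..T}"
  interpret Q: prob_space "torus_measure :: 'n torus measure" by (rule prob_space_torus)
  have Db_exp: "(\<integral>\<^sup>+ x. ennreal (exp (\<beta> * norm (Db t x))) \<partial>torus_measure) \<le> ennreal K" if "t \<in> {0..T}" for t
    unfolding SUP[symmetric] using that by (rule SUP_upper)
  have K: "K \<ge> 1"
  proof -
    have "1 = (\<integral>\<^sup>+ x. 1 \<partial>(torus_measure :: 'n torus measure))" using Q.emeasure_space_1 by simp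
    also have "\<dots> \<le> (\<integral>\<^sup>+ x. ennreal (exp (\<beta> * norm (Db 0 x))) \<partial>torus_measure)"
      using \<beta> by (intro nn_integral_mono) (simp flip: ennreal_1 add: ennreal_leI)
    also have "\<dots> \<le> ennreal K" using T by (intro Db_exp) auto
    finally show ?thesis using K0 by (simp flip: ennreal_1)
  qed
  have tr: "AE \<omega> in space_time T. \<bar>trace (Db (fst \<omega>) (snd \<omega>))\<bar> \<le> L"
  proof -
    have "AE \<omega> in space_time T. (\<lambda>(t, x). ennreal \<bar>trace (Db t x)\<bar>) \<omega> \<le> ennreal L"
      using esssup_AE[of "\<lambda>(t, x). ennreal \<bar>trace (Db t x)\<bar>" "space_time T"] div by (simp add: Lq_norm_def)
    then show ?thesis using L by (auto simp: case_prod_unfold)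
  qed
  interpret flow_problem T b Db \<beta> K L X
    by unfold_locales (use T \<beta> K L bm bc Dm wg Db_exp tr fl in auto)
  show "\<exists>g :: 'n torus \<Rightarrow> ennreal. g \<in> borel_measurable torus_measure \<and>
         (\<forall>x y. ennreal (dist (X t x) (X t y)) \<le> g x * ennreal (dist x y) \<and>
                ennreal (dist (inv (X t) x) (inv (X t) y)) \<le> g x * ennreal (dist x y)) \<and>
         Lq_norm torus_measure (if t = 0 then \<infinity> else ereal (\<beta> / (16 * t))) g
           \<le> ennreal (exp (t\<^sup>2 * L * 16 / \<beta>) * (flow_const TYPE('n) * K) powr (t * 16 / \<beta>))"
  proof (cases "t = 0")
    case True
    have "X 0 x = x" for x using fl unfolding is_flow_def by blast
    then have X0: "X 0 = id" by auto
    have "esssup (torus_measure :: 'n torus measure) (\<lambda>_. 1 :: ennreal) = 1"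
      using Q.emeasure_space_1 by (intro esssup_const) auto
    then show ?thesis using True fc K by (intro exI[of _ "\<lambda>_. 1"]) (simp add: X0 Lq_norm_def)
  next
    case False
    then have t': "0 < t" "t \<le> T" using t by auto
    obtain g where g: "g \<in> borel_measurable torus_measure"
      "\<And>x y. ennreal (dist (X t x) (X t y)) \<le> g x * ennreal (dist x y)"
      "\<And>x y. ennreal (dist (inv (X t) x) (inv (X t) y)) \<le> g x * ennreal (dist x y)"
      "Lq_norm torus_measure (ereal (\<beta> / (16 * t))) g
         \<le> ennreal ((flow_const TYPE('n) * exp (t * L) * K) powr (16 * t / \<beta>))"
      by (rule flow_regularity[OF t']) blast
    have "(flow_const TYPE('n) * exp (t * L) * K) powr (16 * t / \<beta>) = exp (t * L) powr (16 * t / \<beta>) * (flow_const TYPE('n) * K) powr (16 * t / \<beta>)"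
      using fc K by (simp add: powr_mult[symmetric] mult_ac)
    also have "exp (t * L) powr (16 * t / \<beta>) = exp (t\<^sup>2 * L * 16 / \<beta>)" by (simp add: powr_def power2_eq_square mult_ac)
    finally show ?thesis using g False by (intro exI[of _ g]) (simp add: mult.commute)
  qed
qed

end
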